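(* Let $\mathsf{D}$ be a Hom-finite, Krull-Schmidt, $\mathbf{k}$-linear triangulated category (with shift $\Sigma$ and Serre functor $\mathbb{S}$) and let $w \geq 1$. Suppose $\mathsf{S}$ is a $w$-orthogonal collection in $\mathsf{D}$ which is an $\mathbb{S}_{-w}$-subcategory of $\mathsf{D}$ and whose extension closure $\langle \mathsf{S}\rangle$ is functorially finite in $\mathsf{D}$. Let $$\mathsf{Z} = \{ d \in \mathsf{D} \mid \mathrm{Hom}(\Sigma^i \mathsf{S}, d) = 0 \text{ and } \mathrm{Hom}(d, \Sigma^{-i}\mathsf{S}) = 0 \text{ for all } i = 0, \ldots, w-1 \},$$ regarded as a triangulated category with the structure $(\langle1\rangle,\Delta)$ described in the context. Then there is a bijection $$\{ w\text{-simple-minded systems in } \mathsf{D} \text{ containing } \mathsf{S} \} \stackrel{1-1}{\longleftrightarrow} \{ w\text{-simple-minded systems in } \mathsf{Z} \}.$$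
   Context: $\mathbf{k}$ is an algebraically closed field. All subcategories are full and strict (closed under isomorphism). For subcategories $\mathsf{X},\mathsf{Y}$ of $\mathsf{D}$, $\mathsf{X}*\mathsf{Y}$ is the subcategory of those $d$ for which there is a triangle $x\to d\to y\to\Sigma x$ with $x\in\mathsf{X}$, $y\in\mathsf{Y}$; $\mathsf{X}$ is extension-closed if $\mathsf{X}*\mathsf{X}=\mathsf{X}$, and $\langle\mathsf{X}\rangle$ is the smallest extension-closed subcategory containing $\mathsf{X}$. $\mathrm{Hom}(\mathsf{X},d)=0$ means $\mathrm{Hom}(x,d)=0$ for all $x\in\mathsf{X}$, and similarly for $\mathrm{Hom}(d,\mathsf{X})=0$. A collection of objects $\mathsf{S}$ is $w$-orthogonal if (1) $\dim\mathrm{Hom}(x,y)=\delta_{xy}$ for all $x,y\in\mathsf{S}$ (objects up to isomorphism), and (2) if $w\ge2$, $\mathrm{Hom}(\Sigma^k x,y)=0$ for $1\le k\le w-1$ and $x,y\in\mathsf{S}$. It is a $w$-simple-minded system in $\mathsf{D}$ if additionally (3) $\mathsf{D}=\mathrm{add}(\langle\mathsf{S},\Sigma^{-1}\mathsf{S},\ldots,\Sigma^{1-w}\mathsf{S}\rangle)$. A $w$-simple-minded system in $\mathsf{Z}$ is defined in the same way, replacing $\mathsf{D}$ by $\mathsf{Z}$, $\Sigma$ by $\langle1\rangle$, and extension closures by those with respect to the triangles $\Delta$ of $\mathsf{Z}$. A Serre functor is an autoequivalence $\mathbb{S}$ of $\mathsf{D}$ with isomorphisms $\mathrm{Hom}(x,y)\simeq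 D\mathrm{Hom}(y,\mathbb{S}x)$ natural in $x,y$, where $D$ is vector space duality. With $\mathbb{S}_m:=\mathbb{S}\Sigma^{-m}$ for $m\in\mathbb{Z}$, $\mathsf{X}$ is an $\mathbb{S}_m$-subcategory if $\mathsf{X}=\mathbb{S}_m\mathsf{X}=\mathbb{S}_m^{-1}\mathsf{X}$; in particular $\mathbb{S}_{-w}=\mathbb{S}\Sigma^{w}$. A right $\mathsf{X}$-approximation of $d$ is a morphism $x\to d$ with $x\in\mathsf{X}$ through which every morphism from an object of $\mathsf{X}$ to $d$ factors; a morphism $f\colon x\to d$ is right minimal if every $g\colon x\to x$ with $fg=f$ is an automorphism. Left approximations and left minimality are dual. $\mathsf{X}$ is functorially finite if every object of $\mathsf{D}$ has a right and a left $\mathsf{X}$-approximation. Structure on $\mathsf{Z}$. For each $x\in\mathsf{Z}$ fix a triangle $s_x\xrightarrow{\alpha_x}\Sigma x\xrightarrow{\beta_x}x\langle1\rangle\to\Sigma s_x$ in $\mathsf{D}$ with $\alpha_x$ a minimal right $\langle\mathsf{S}\rangle$-approximation; here $x\langle1\rangle\in\mathsf{Z}$. For $f\colon x\to x'$ in $\mathsf{Z}$, $f\langle1\rangle\colon x\langle1\rangle\to x'\langle1\rangle$ is the unique morphism with $f\langle1\rangle\,\beta_x=\beta_{x'}\,(\Sigma f)$. This is an autoequivalence of $\mathsf{Z}$; its quasi-inverse $\langle-1\rangle$ is given on objects by triangles $y\langle-1\rangle\to\Sigma^{-1}y\xrightarrow{\alpha^y}s^y\to\Sigma (y\langle-1\rangle)$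 with $\alpha^y$ a minimal left $\langle\mathsf{S}\rangle$-approximation. For $f\colon x\to y$ in $\mathsf{Z}$ take a triangle $x\xrightarrow{f}y\xrightarrow{g_1}c_f\xrightarrow{h_1}\Sigma x$ in $\mathsf{D}$ and a triangle $s_f\xrightarrow{\alpha_f}c_f\xrightarrow{\beta_f}z_f\to\Sigma s_f$ in $\mathsf{D}$ with $\alpha_f$ a minimal right $\langle\mathsf{S}\rangle$-approximation; here $z_f\in\mathsf{Z}$. Put $g=\beta_fg_1$ and let $h\colon z_f\to x\langle1\rangle$ be the unique morphism with $h\beta_f=\beta_xh_1$. The diagrams $x\xrightarrow{f}y\xrightarrow{g}z_f\xrightarrow{h}x\langle1\rangle$ are the standard triangles, and $\Delta$ is the class of all diagrams $x\to y\to z\to x\langle1\rangle$ in $\mathsf{Z}$ isomorphic to a standard triangle. With this structure $\mathsf{Z}$ is a triangulated category. *)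

theory Defs
  imports "HOL-Library.FuncSet" "HOL-Computational_Algebra.Polynomial"
begin

section \<open>Linear categories\<close>

text \<open>
  The Hom-spaces of a \<open>k\<close>-linear category are linear subspaces of one ambient \<open>k\<close>-vector space,
  the type \<open>'m\<close>. This is no restriction: the direct sum of all Hom-spaces can serve as ambient
  space, and composition extends to a single bilinear operation on it. Hom-spaces are not assumed
  to be disjoint, so the domain and codomain of a morphism are always given explicitly, and every
  operation that depends on them takes them as arguments.
\<close>

record ('k, 'o, 'm) lin_cat =
  Ob :: "'o set"
  Hom :: "'o \<Rightarrow> 'o \<Rightarrow> 'm set"
  idm :: "'o \<Rightarrow> 'm"
  cmp :: "'m \<Rightarrow> 'm \<Rightarrow> 'm" (infixl "\<cdot>\<index>" 70)
  scl :: "'k \<Rightarrow> 'm \<Rightarrow> 'm"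

locale linear_category = vector_space "scl C"
  for C :: "('k::field, 'o, 'm::ab_group_add, 'z) lin_cat_scheme" (structure) +
  assumes Hom_subspace: "\<lbrakk>x \<in> Ob C; y \<in> Ob C\<rbrakk> \<Longrightarrow> subspace (Hom C x y)"
    and idm_in: "x \<in> Ob C \<Longrightarrow> idm C x \<in> Hom C x x"
    and cmp_in: "\<lbrakk>x \<in> Ob C; y \<in> Ob C; z \<in> Ob C; f \<in> Hom C x y; g \<in> Hom C y z\<rbrakk>
      \<Longrightarrow> g \<cdot> f \<in> Hom C x z"
    and cmp_assoc: "\<lbrakk>x \<in> Ob C; y \<in> Ob C; z \<in> Ob C; t \<in> Ob C;
      f \<in> Hom C x y; g \<in> Hom C y z; h \<in> Hom C z t\<rbrakk> \<Longrightarrow> (h \<cdot> g) \<cdot> f = h \<cdot> (g \<cdot> f)"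
    and idm_right: "\<lbrakk>x \<in> Ob C; y \<in> Ob C; f \<in> Hom C x y\<rbrakk> \<Longrightarrow> f \<cdot> idm C x = f"
    and idm_left: "\<lbrakk>x \<in> Ob C; y \<in> Ob C; f \<in> Hom C x y\<rbrakk> \<Longrightarrow> idm C y \<cdot> f = f"
    and cmp_add_right: "\<lbrakk>x \<in> Ob C; y \<in> Ob C; z \<in> Ob C; f \<in> Hom C x y; f' \<in> Hom C x y; g \<in> Hom C y z\<rbrakk>
      \<Longrightarrow> g \<cdot> (f + f') = g \<cdot> f + g \<cdot> f'"
    and cmp_add_left: "\<lbrakk>x \<in> Ob C; y \<in> Ob C; z \<in> Ob C; f \<in> Hom C x y; g \<in> Hom C y z; g' \<in> Hom C y z\<rbrakk>
      \<Longrightarrow> (g + g') \<cdot> f = g \<cdot> f + g' \<cdot> f"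
    and cmp_scl_right: "\<lbrakk>x \<in> Ob C; y \<in> Ob C; z \<in> Ob C; f \<in> Hom C x y; g \<in> Hom C y z\<rbrakk>
      \<Longrightarrow> g \<cdot> scl C c f = scl C c (g \<cdot> f)"
    and cmp_scl_left: "\<lbrakk>x \<in> Ob C; y \<in> Ob C; z \<in> Ob C; f \<in> Hom C x y; g \<in> Hom C y z\<rbrakk>
      \<Longrightarrow> scl C c g \<cdot> f = scl C c (g \<cdot> f)"

definition is_iso :: "('k, 'o, 'm, 'z) lin_cat_scheme \<Rightarrow> 'o \<Rightarrow> 'o \<Rightarrow> 'm \<Rightarrow> bool" where
  "is_iso C x y f \<longleftrightarrow> f \<in> Hom C x y \<and>
    (\<exists>g \<in> Hom C y x. g \<cdot>\<^bsub>C\<^esub> f = idm C x \<and> f \<cdot>\<^bsub>C\<^esub> g = idm C y)"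

definition isomorphic :: "('k, 'o, 'm, 'z) lin_cat_scheme \<Rightarrow> 'o \<Rightarrow> 'o \<Rightarrow> bool" where
  "isomorphic C x y \<longleftrightarrow> (\<exists>f. is_iso C x y f)"

text \<open>Full strict subcategories are given by their sets of objects.\<close>

definition strict_subcat :: "('k, 'o, 'm, 'z) lin_cat_scheme \<Rightarrow> 'o set \<Rightarrow> bool" where
  "strict_subcat C X \<longleftrightarrow> X \<subseteq> Ob C \<and> (\<forall>x \<in> X. \<forall>y \<in> Ob C. isomorphic C x y \<longrightarrow> y \<in> X)"

definition iso_closure :: "('k, 'o, 'm, 'z) lin_cat_scheme \<Rightarrow> 'o set \<Rightarrow> 'o set" where
  "iso_closure C X = {d \<in> Ob C. \<exists>x \<in> X. isomorphic C x d}"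

definition is_zero :: "('k, 'o, 'm::zero, 'z) lin_cat_scheme \<Rightarrow> 'o \<Rightarrow> bool" where
  "is_zero C z \<longleftrightarrow> z \<in> Ob C \<and> (\<forall>x \<in> Ob C. Hom C x z = {0} \<and> Hom C z x = {0})"

text \<open>\<open>direct_sum C b xs\<close>: the object \<open>b\<close> is a biproduct of the finite family \<open>xs\<close>.\<close>

definition direct_sum :: "('k, 'o, 'm::ab_group_add, 'z) lin_cat_scheme \<Rightarrow> 'o \<Rightarrow> 'o list \<Rightarrow> bool" where
  "direct_sum C b xs \<longleftrightarrow> b \<in> Ob C \<and> set xs \<subseteq> Ob C \<and>
    (\<exists>\<iota> \<pi>. (\<forall>i < length xs. \<iota> i \<in> Hom C (xs ! i) b \<and> \<pi> i \<in> Hom C b (xs ! i)) \<and>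
      (\<forall>i < length xs. \<forall>j < length xs. \<pi> i \<cdot>\<^bsub>C\<^esub> \<iota> j = (if i = j then idm C (xs ! i) else 0)) \<and>
      (\<Sum>i < length xs. \<iota> i \<cdot>\<^bsub>C\<^esub> \<pi> i) = idm C b)"

locale additive_category = linear_category C
  for C :: "('k::field, 'o, 'm::ab_group_add, 'z) lin_cat_scheme" (structure) +
  assumes zero_exists: "\<exists>z. is_zero C z"
    and direct_sum_exists: "\<lbrakk>x \<in> Ob C; y \<in> Ob C\<rbrakk> \<Longrightarrow> \<exists>b. direct_sum C b [x, y]"

text \<open>
  \<open>add_closure C X\<close> is the subcategory \<open>add(X)\<close> of all direct summands of finite direct sums of
  objects of \<open>X\<close>.
\<close>

definition add_closure :: "('k, 'o, 'm::ab_group_add, 'z) lin_cat_scheme \<Rightarrow> 'o set \<Rightarrow> 'o set" where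
  "add_closure C X =
    {d \<in> Ob C. \<exists>xs b e. set xs \<subseteq> X \<and> direct_sum C b xs \<and> direct_sum C b [d, e]}"

definition hom_finite :: "('k::field, 'o, 'm::ab_group_add, 'z) lin_cat_scheme \<Rightarrow> bool" where
  "hom_finite C \<longleftrightarrow>
    (\<forall>x \<in> Ob C. \<forall>y \<in> Ob C. \<exists>B. finite B \<and> module.span (scl C) B = Hom C x y)"

text \<open>The endomorphism ring of \<open>x\<close> is local: nonzero, and its non-units are closed under addition.\<close>

definition local_end :: "('k, 'o, 'm::ab_group_add, 'z) lin_cat_scheme \<Rightarrow> 'o \<Rightarrow> bool" where
  "local_end C x \<longleftrightarrow> idm C x \<noteq> 0 \<and>
    (\<forall>f \<in> Hom C x x. \<forall>g \<in> Hom C x x. \<not> is_iso C x x f \<and> \<not> is_iso C x x g \<longrightarrow> \<not> is_iso C x x (f + g))"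

definition krull_schmidt :: "('k, 'o, 'm::ab_group_add, 'z) lin_cat_scheme \<Rightarrow> bool" where
  "krull_schmidt C \<longleftrightarrow>
    (\<forall>x \<in> Ob C. \<exists>xs. direct_sum C x xs \<and> (\<forall>y \<in> set xs. local_end C y))"


section \<open>Autoequivalences and Serre functors\<close>

record ('o, 'm) endo =
  fob :: "'o \<Rightarrow> 'o"
  fmor :: "'o \<Rightarrow> 'o \<Rightarrow> 'm \<Rightarrow> 'm"

definition linear_functor ::
    "('k, 'o, 'm::ab_group_add, 'z) lin_cat_scheme \<Rightarrow> ('o, 'm) endo \<Rightarrow> bool" where
  "linear_functor C F \<longleftrightarrow>
    (\<forall>x \<in> Ob C. fob F x \<in> Ob C \<and> fmor F x x (idm C x) = idm C (fob F x)) \<and>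
    (\<forall>x \<in> Ob C. \<forall>y \<in> Ob C. \<forall>f \<in> Hom C x y.
      fmor F x y f \<in> Hom C (fob F x) (fob F y) \<and>
      (\<forall>f' \<in> Hom C x y. fmor F x y (f + f') = fmor F x y f + fmor F x y f') \<and>
      (\<forall>c. fmor F x y (scl C c f) = scl C c (fmor F x y f)) \<and>
      (\<forall>z \<in> Ob C. \<forall>g \<in> Hom C y z. fmor F x z (g \<cdot>\<^bsub>C\<^esub> f) = fmor F y z g \<cdot>\<^bsub>C\<^esub> fmor F x y f))"

definition naturally_isomorphic ::
    "('k, 'o, 'm, 'z) lin_cat_scheme \<Rightarrow> ('o, 'm) endo \<Rightarrow> ('o, 'm) endo \<Rightarrow> bool" where
  "naturally_isomorphic C F G \<longleftrightarrow>
    (\<exists>\<eta>. (\<forall>x \<in> Ob C. is_iso C (fob F x) (fob G x) (\<eta> x)) \<and>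
      (\<forall>x \<in> Ob C. \<forall>y \<in> Ob C. \<forall>f \<in> Hom C x y.
        fmor G x y f \<cdot>\<^bsub>C\<^esub> \<eta> x = \<eta> y \<cdot>\<^bsub>C\<^esub> fmor F x y f))"

definition id_endo :: "('o, 'm) endo" where
  "id_endo = \<lparr>fob = (\<lambda>x. x), fmor = (\<lambda>x y f. f)\<rparr>"

definition comp_endo :: "('o, 'm) endo \<Rightarrow> ('o, 'm) endo \<Rightarrow> ('o, 'm) endo" where
  "comp_endo F G = \<lparr>fob = (\<lambda>x. fob F (fob G x)),
                   fmor = (\<lambda>x y f. fmor F (fob G x) (fob G y) (fmor G x y f))\<rparr>"

text \<open>\<open>F\<close> is an autoequivalence with quasi-inverse \<open>G\<close>.\<close>

definition autoequivalence ::
    "('k, 'o, 'm::ab_group_add, 'z) lin_cat_scheme \<Rightarrow> ('o, 'm) endo \<Rightarrow> ('o, 'm) endo \<Rightarrow> bool" where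
  "autoequivalence C F G \<longleftrightarrow> linear_functor C F \<and> linear_functor C G \<and>
    naturally_isomorphic C (comp_endo F G) id_endo \<and>
    naturally_isomorphic C (comp_endo G F) id_endo"

text \<open>
  The linear dual of a subspace \<open>V\<close> of the ambient space; functionals are \<open>undefined\<close> outside \<open>V\<close>,
  so that they are determined by their values on \<open>V\<close>.
\<close>

definition dual_space :: "('k::field, 'o, 'm::ab_group_add, 'z) lin_cat_scheme \<Rightarrow> 'm set \<Rightarrow> ('m \<Rightarrow> 'k) set" where
  "dual_space C V = {\<phi> \<in> extensional V.
    (\<forall>u \<in> V. \<forall>v \<in> V. \<phi> (u + v) = \<phi> u + \<phi> v) \<and> (\<forall>c. \<forall>u \<in> V. \<phi> (scl C c u) = c * \<phi> u)}"

text \<open>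
  \<open>S\<close> is a Serre functor with quasi-inverse \<open>S'\<close>. The family \<open>\<eta> x y\<close> consists of the linear
  isomorphisms from \<open>Hom(x,y)\<close> to the dual of \<open>Hom(y,Sx)\<close>; the last two conjuncts are naturality
  in \<open>x\<close> and in \<open>y\<close>.
\<close>

definition serre_functor ::
    "('k::field, 'o, 'm::ab_group_add, 'z) lin_cat_scheme \<Rightarrow> ('o, 'm) endo \<Rightarrow> ('o, 'm) endo \<Rightarrow> bool" where
  "serre_functor C S S' \<longleftrightarrow> autoequivalence C S S' \<and>
    (\<exists>\<eta>. \<forall>x \<in> Ob C. \<forall>y \<in> Ob C.
      bij_betw (\<eta> x y) (Hom C x y) (dual_space C (Hom C y (fob S x))) \<and>
      (\<forall>f \<in> Hom C x y. \<forall>f' \<in> Hom C x y. \<forall>u \<in> Hom C y (fob S x).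
        \<eta> x y (f + f') u = \<eta> x y f u + \<eta> x y f' u) \<and>
      (\<forall>c. \<forall>f \<in> Hom C x y. \<forall>u \<in> Hom C y (fob S x). \<eta> x y (scl C c f) u = c * \<eta> x y f u) \<and>
      (\<forall>x' \<in> Ob C. \<forall>a \<in> Hom C x' x. \<forall>f \<in> Hom C x y. \<forall>u \<in> Hom C y (fob S x').
        \<eta> x' y (f \<cdot>\<^bsub>C\<^esub> a) u = \<eta> x y f (fmor S x' x a \<cdot>\<^bsub>C\<^esub> u)) \<and>
      (\<forall>y' \<in> Ob C. \<forall>b \<in> Hom C y y'. \<forall>f \<in> Hom C x y. \<forall>u \<in> Hom C y' (fob S x).
        \<eta> x y' (b \<cdot>\<^bsub>C\<^esub> f) u = \<eta> x y f (u \<cdot>\<^bsub>C\<^esub> b)))"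


section \<open>Triangulated categories\<close>

text \<open>
  \<open>shift\<close> is the shift functor, \<open>unshift\<close> the object part of a quasi-inverse of it, and
  \<open>tri C x y z f g h\<close> says that \<open>x \<rightarrow> y \<rightarrow> z \<rightarrow> shift x\<close>, with morphisms \<open>f\<close>, \<open>g\<close>, \<open>h\<close>, is a
  distinguished triangle.
\<close>

record ('k, 'o, 'm) tri_cat = "('k, 'o, 'm) lin_cat" +
  shift :: "('o, 'm) endo"
  unshift :: "'o \<Rightarrow> 'o"
  tri :: "'o \<Rightarrow> 'o \<Rightarrow> 'o \<Rightarrow> 'm \<Rightarrow> 'm \<Rightarrow> 'm \<Rightarrow> bool"

abbreviation sh :: "('k, 'o, 'm, 'z) tri_cat_scheme \<Rightarrow> 'o \<Rightarrow> 'o" where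
  "sh C x \<equiv> fob (shift C) x"

locale triangulated_category = additive_category C
  for C :: "('k::field, 'o, 'm::ab_group_add, 'z) tri_cat_scheme" (structure) +
  assumes shift_autoequivalence: "\<exists>G. fob G = unshift C \<and> autoequivalence C (shift C) G"
    and tri_in: "tri C x y z f g h \<Longrightarrow> x \<in> Ob C \<and> y \<in> Ob C \<and> z \<in> Ob C \<and>
      f \<in> Hom C x y \<and> g \<in> Hom C y z \<and> h \<in> Hom C z (sh C x)"
    and tri_iso: "\<lbrakk>tri C x y z f g h; x' \<in> Ob C; y' \<in> Ob C; z' \<in> Ob C;
      f' \<in> Hom C x' y'; g' \<in> Hom C y' z'; h' \<in> Hom C z' (sh C x');
      is_iso C x x' a; is_iso C y y' b; is_iso C z z' c;
      b \<cdot> f = f' \<cdot> a; c \<cdot> g = g' \<cdot> b; fmor (shift C) x x' a \<cdot> h = h' \<cdot> c\<rbrakk>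
      \<Longrightarrow> tri C x' y' z' f' g' h'"
    and tri_id: "\<lbrakk>x \<in> Ob C; is_zero C z\<rbrakk> \<Longrightarrow> tri C x x z (idm C x) 0 0"
    and tri_cone: "\<lbrakk>x \<in> Ob C; y \<in> Ob C; f \<in> Hom C x y\<rbrakk> \<Longrightarrow> \<exists>z g h. tri C x y z f g h"
    and tri_rotate: "\<lbrakk>x \<in> Ob C; y \<in> Ob C; z \<in> Ob C;
      f \<in> Hom C x y; g \<in> Hom C y z; h \<in> Hom C z (sh C x)\<rbrakk>
      \<Longrightarrow> tri C x y z f g h \<longleftrightarrow> tri C y z (sh C x) g h (- fmor (shift C) x y f)"
    and tri_morphism: "\<lbrakk>tri C x y z f g h; tri C x' y' z' f' g' h';
      a \<in> Hom C x x'; b \<in> Hom C y y'; b \<cdot> f = f' \<cdot> a\<rbrakk>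
      \<Longrightarrow> \<exists>c \<in> Hom C z z'. c \<cdot> g = g' \<cdot> b \<and> fmor (shift C) x x' a \<cdot> h = h' \<cdot> c"
    and octahedral: "\<lbrakk>tri C x y z' f i i'; tri C y z x' g j j'; tri C x z y' (g \<cdot> f) k k'\<rbrakk>
      \<Longrightarrow> \<exists>u v. tri C z' y' x' u v (fmor (shift C) y z' i \<cdot> j') \<and>
        u \<cdot> i = k \<cdot> g \<and> k' \<cdot> u = i' \<and> v \<cdot> k = j \<and> j' \<cdot> v = fmor (shift C) x y f \<cdot> k'"

definition shift_pow :: "('k, 'o, 'm, 'z) tri_cat_scheme \<Rightarrow> int \<Rightarrow> 'o \<Rightarrow> 'o" where
  "shift_pow C n x = (if 0 \<le> n then (fob (shift C) ^^ nat n) x else (unshift C ^^ nat (- n)) x)"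

definition ext_star :: "('k, 'o, 'm, 'z) tri_cat_scheme \<Rightarrow> 'o set \<Rightarrow> 'o set \<Rightarrow> 'o set" where
  "ext_star C X Y = {d \<in> Ob C. \<exists>x \<in> X. \<exists>y \<in> Y. \<exists>f g h. tri C x d y f g h}"

text \<open>
  Extension-closed subcategories contain the zero objects. Without this convention a smallest
  subcategory \<open>X\<close> with \<open>X * X = X\<close> containing a given collection need not exist.
\<close>

definition ext_closed :: "('k, 'o, 'm::ab_group_add, 'z) tri_cat_scheme \<Rightarrow> 'o set \<Rightarrow> bool" where
  "ext_closed C X \<longleftrightarrow> strict_subcat C X \<and> (\<forall>z. is_zero C z \<longrightarrow> z \<in> X) \<and> ext_star C X X = X"

definition ext_closure :: "('k, 'o, 'm::ab_group_add, 'z) tri_cat_scheme \<Rightarrow> 'o set \<Rightarrow> 'o set" where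
  "ext_closure C X = \<Inter>{Y. ext_closed C Y \<and> X \<subseteq> Y}"

text \<open>
  With \<open>S_m = S \<circ> shift\<^sup>-\<^sup>m\<close>, whose quasi-inverse is \<open>shift\<^sup>m \<circ> S'\<close>: the subcategory \<open>X\<close> satisfies
  \<open>X = S_m X = S_m\<^sup>-\<^sup>1 X\<close>, images being closed under isomorphism.
\<close>

definition serre_subcat ::
    "('k, 'o, 'm, 'z) tri_cat_scheme \<Rightarrow> ('o, 'm) endo \<Rightarrow> ('o, 'm) endo \<Rightarrow> int \<Rightarrow> 'o set \<Rightarrow> bool" where
  "serre_subcat C S S' m X \<longleftrightarrow> strict_subcat C X \<and>
    X = iso_closure C ((\<lambda>x. fob S (shift_pow C (- m) x)) ` X) \<and>
    X = iso_closure C ((\<lambda>x. shift_pow C m (fob S' x)) ` X)"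


section \<open>Approximations\<close>

definition right_approx :: "('k, 'o, 'm, 'z) lin_cat_scheme \<Rightarrow> 'o set \<Rightarrow> 'o \<Rightarrow> 'o \<Rightarrow> 'm \<Rightarrow> bool" where
  "right_approx C X x d f \<longleftrightarrow> x \<in> X \<and> f \<in> Hom C x d \<and>
    (\<forall>x' \<in> X. \<forall>g \<in> Hom C x' d. \<exists>h \<in> Hom C x' x. g = f \<cdot>\<^bsub>C\<^esub> h)"

definition left_approx :: "('k, 'o, 'm, 'z) lin_cat_scheme \<Rightarrow> 'o set \<Rightarrow> 'o \<Rightarrow> 'o \<Rightarrow> 'm \<Rightarrow> bool" where
  "left_approx C X d x f \<longleftrightarrow> x \<in> X \<and> f \<in> Hom C d x \<and>
    (\<forall>x' \<in> X. \<forall>g \<in> Hom C d x'. \<exists>h \<in> Hom C x x'. g = h \<cdot>\<^bsub>C\<^esub> f)"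

definition min_right_approx :: "('k, 'o, 'm, 'z) lin_cat_scheme \<Rightarrow> 'o set \<Rightarrow> 'o \<Rightarrow> 'o \<Rightarrow> 'm \<Rightarrow> bool" where
  "min_right_approx C X x d f \<longleftrightarrow> right_approx C X x d f \<and>
    (\<forall>g \<in> Hom C x x. f \<cdot>\<^bsub>C\<^esub> g = f \<longrightarrow> is_iso C x x g)"

definition min_left_approx :: "('k, 'o, 'm, 'z) lin_cat_scheme \<Rightarrow> 'o set \<Rightarrow> 'o \<Rightarrow> 'o \<Rightarrow> 'm \<Rightarrow> bool" where
  "min_left_approx C X d x f \<longleftrightarrow> left_approx C X d x f \<and>
    (\<forall>g \<in> Hom C x x. g \<cdot>\<^bsub>C\<^esub> f = f \<longrightarrow> is_iso C x x g)"

definition functorially_finite :: "('k, 'o, 'm, 'z) lin_cat_scheme \<Rightarrow> 'o set \<Rightarrow> bool" where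
  "functorially_finite C X \<longleftrightarrow>
    (\<forall>d \<in> Ob C. (\<exists>x f. right_approx C X x d f) \<and> (\<exists>x f. left_approx C X d x f))"


section \<open>Simple-minded systems\<close>

text \<open>
  Collections of objects are considered up to isomorphism, so they are represented by sets of
  objects closed under isomorphism.
\<close>

definition w_orthogonal ::
    "('k::field, 'o, 'm::ab_group_add, 'z) tri_cat_scheme \<Rightarrow> nat \<Rightarrow> 'o set \<Rightarrow> bool" where
  "w_orthogonal C w S \<longleftrightarrow> strict_subcat C S \<and>
    (\<forall>x \<in> S. \<forall>y \<in> S.
      vector_space.dim (scl C) (Hom C x y) = (if isomorphic C x y then 1 else 0)) \<and>
    (2 \<le> w \<longrightarrow> (\<forall>k \<in> {1..w - 1}. \<forall>x \<in> S. \<forall>y \<in> S. Hom C (shift_pow C (int k) x) y = {0}))"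

definition simple_minded_system ::
    "('k::field, 'o, 'm::ab_group_add, 'z) tri_cat_scheme \<Rightarrow> nat \<Rightarrow> 'o set \<Rightarrow> bool" where
  "simple_minded_system C w S \<longleftrightarrow> w_orthogonal C w S \<and>
    Ob C = add_closure C (ext_closure C (\<Union>k \<in> {0..w - 1}. shift_pow C (- int k) ` S))"


section \<open>The reduction\<close>

definition Zob :: "('k, 'o, 'm::ab_group_add, 'z) tri_cat_scheme \<Rightarrow> nat \<Rightarrow> 'o set \<Rightarrow> 'o set" where
  "Zob D w S = {d \<in> Ob D. \<forall>i \<in> {0..w - 1}. \<forall>s \<in> S.
    Hom D (shift_pow D (int i) s) d = {0} \<and> Hom D d (shift_pow D (- int i) s) = {0}}"

text \<open>
  The choices entering the structure on \<open>Z\<close>: the objects \<open>T x = x\<langle>1\<rangle>\<close> with the morphisms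
  \<open>\<beta> x\<close> from \<open>shift x\<close> to \<open>x\<langle>1\<rangle>\<close>, and the objects \<open>U y = y\<langle>-1\<rangle>\<close>. The remaining parts of the
  chosen triangles do not enter the structure.
\<close>

definition reduction_choice ::
    "('k, 'o, 'm::ab_group_add, 'z) tri_cat_scheme \<Rightarrow> nat \<Rightarrow> 'o set \<Rightarrow>
      ('o \<Rightarrow> 'o) \<Rightarrow> ('o \<Rightarrow> 'm) \<Rightarrow> ('o \<Rightarrow> 'o) \<Rightarrow> bool" where
  "reduction_choice D w S T \<beta> U \<longleftrightarrow>
    (\<forall>x \<in> Zob D w S. \<exists>s \<alpha> \<gamma>.
      min_right_approx D (ext_closure D S) s (sh D x) \<alpha> \<and> tri D s (sh D x) (T x) \<alpha> (\<beta> x) \<gamma>) \<and>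
    (\<forall>y \<in> Zob D w S. \<exists>s \<alpha> \<gamma> \<delta>.
      min_left_approx D (ext_closure D S) (unshift D y) s \<alpha> \<and> tri D (U y) (unshift D y) s \<delta> \<alpha> \<gamma>)"

definition Zshift ::
    "('k, 'o, 'm::ab_group_add, 'z) tri_cat_scheme \<Rightarrow> ('o \<Rightarrow> 'o) \<Rightarrow> ('o \<Rightarrow> 'm) \<Rightarrow> ('o, 'm) endo" where
  "Zshift D T \<beta> = \<lparr>fob = T, fmor = (\<lambda>x x' f.
    THE f'. f' \<in> Hom D (T x) (T x') \<and> f' \<cdot>\<^bsub>D\<^esub> \<beta> x = \<beta> x' \<cdot>\<^bsub>D\<^esub> fmor (shift D) x x' f)\<rparr>"

definition Zstandard ::
    "('k, 'o, 'm::ab_group_add, 'z) tri_cat_scheme \<Rightarrow> nat \<Rightarrow> 'o set \<Rightarrow> ('o \<Rightarrow> 'o) \<Rightarrow> ('o \<Rightarrow> 'm) \<Rightarrow>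
      'o \<Rightarrow> 'o \<Rightarrow> 'o \<Rightarrow> 'm \<Rightarrow> 'm \<Rightarrow> 'm \<Rightarrow> bool" where
  "Zstandard D w S T \<beta> x y z f g h \<longleftrightarrow>
    x \<in> Zob D w S \<and> y \<in> Zob D w S \<and> f \<in> Hom D x y \<and>
    (\<exists>c g1 h1 s \<alpha>f \<beta>f \<gamma>f.
      tri D x y c f g1 h1 \<and>
      min_right_approx D (ext_closure D S) s c \<alpha>f \<and> tri D s c z \<alpha>f \<beta>f \<gamma>f \<and>
      g = \<beta>f \<cdot>\<^bsub>D\<^esub> g1 \<and>
      h \<in> Hom D z (T x) \<and> h \<cdot>\<^bsub>D\<^esub> \<beta>f = \<beta> x \<cdot>\<^bsub>D\<^esub> h1)"

definition Ztri ::
    "('k, 'o, 'm::ab_group_add, 'z) tri_cat_scheme \<Rightarrow> nat \<Rightarrow> 'o set \<Rightarrow> ('o \<Rightarrow> 'o) \<Rightarrow> ('o \<Rightarrow> 'm) \<Rightarrow>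
      'o \<Rightarrow> 'o \<Rightarrow> 'o \<Rightarrow> 'm \<Rightarrow> 'm \<Rightarrow> 'm \<Rightarrow> bool" where
  "Ztri D w S T \<beta> x y z f g h \<longleftrightarrow>
    x \<in> Zob D w S \<and> y \<in> Zob D w S \<and> z \<in> Zob D w S \<and>
    f \<in> Hom D x y \<and> g \<in> Hom D y z \<and> h \<in> Hom D z (T x) \<and>
    (\<exists>x' y' z' f' g' h' a b c.
      Zstandard D w S T \<beta> x' y' z' f' g' h' \<and>
      is_iso D x x' a \<and> is_iso D y y' b \<and> is_iso D z z' c \<and>
      b \<cdot>\<^bsub>D\<^esub> f = f' \<cdot>\<^bsub>D\<^esub> a \<and> c \<cdot>\<^bsub>D\<^esub> g = g' \<cdot>\<^bsub>D\<^esub> b \<and>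
      fmor (Zshift D T \<beta>) x x' a \<cdot>\<^bsub>D\<^esub> h = h' \<cdot>\<^bsub>D\<^esub> c)"

text \<open>The full subcategory \<open>Z\<close> of \<open>D\<close> with its own shift and triangles.\<close>

definition Zcat ::
    "('k, 'o, 'm::ab_group_add) tri_cat \<Rightarrow> nat \<Rightarrow> 'o set \<Rightarrow> ('o \<Rightarrow> 'o) \<Rightarrow> ('o \<Rightarrow> 'm) \<Rightarrow> ('o \<Rightarrow> 'o) \<Rightarrow>
      ('k, 'o, 'm) tri_cat" where
  "Zcat D w S T \<beta> U = D\<lparr>Ob := Zob D w S, shift := Zshift D T \<beta>, unshift := U,
                       tri := Ztri D w S T \<beta>\<rparr>"

end

theory Submission
  imports Defs
begin

text \<open>
  Write \<open>D\<close> for the ambient category and \<open>\<langle>X\<rangle>\<close> for the extension closure of \<open>X\<close>. The bijection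
  sends a simple-minded system \<open>X\<close> that contains \<open>S\<close> to \<open>X \<inter> Z\<close>, and its inverse sends \<open>R\<close> to \<open>R \<union>
  S\<close>. As sets of objects these are mutually inverse because a member of \<open>X\<close> outside \<open>S\<close> is
  orthogonal to \<open>S\<close> in all relevant degrees (\<open>orthogonal_cases\<close>), while \<open>S\<close> and \<open>Z\<close> are disjoint.
  Orthogonality passes back and forth because \<open>x\<langle>1\<rangle>\<close> differs from \<open>\<Sigma> x\<close> by an object of \<open>\<langle>S\<rangle>\<close>,
  which morphisms to \<open>Z\<close> do not see in the range of degrees concerned (\<open>T_perp\<close>). What remains is
  generation.

  The basic observation is that the members of a \<open>w\<close>-orthogonal collection \<open>X\<close> behave like simple
  objects. A nonzero morphism from \<open>x \<in> X\<close> to an object \<open>d\<close> of \<open>\<langle>X\<rangle> * \<Sigma>\<^sup>-\<^sup>1\<langle>X\<rangle> * \<dots> * \<Sigma>\<^sup>1\<^sup>-\<^sup>k\<langle>X\<rangle>\<close>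
  with \<open>k \<le> w\<close> has its cone in the same class, with one factor less (\<open>filtered_cone\<close>). By
  inductions on the number of factors this class is closed under direct summands
  (\<open>filtered_retract\<close>) and extensions (\<open>layers_extension\<close>). So for \<open>k = w\<close> it is the extension
  closure in the definition of a simple-minded system, and forming \<open>add\<close> changes nothing. The same
  length arguments produce minimal approximations by \<open>\<langle>S\<rangle>\<close> and show that a minimal right
  approximation \<open>t \<rightarrow> d\<close> is injective on \<open>Hom(S,-)\<close>, so that dividing by it does not lengthen
  filtrations either (\<open>filtered_cone_of_injective\<close>).

  Serre duality and the invariance of \<open>S\<close> describe \<open>Z\<close> by one-sided conditions: \<open>Hom(\<Sigma>\<^sup>i S, d) =
  0\<close> for \<open>0 \<le> i \<le> w\<close>, or dually \<open>Hom(\<Sigma>\<^sup>i d, S) = 0\<close> in the same degrees. With Wakamatsu's lemma,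
  \<open>Z\<close> contains \<open>x\<langle>1\<rangle>\<close>, \<open>x\<langle>-1\<rangle>\<close> and the third objects of standard triangles.

  Restriction (\<open>filtered_in_Zclosed\<close>): let \<open>X\<close> generate \<open>D\<close> and let \<open>z \<in> Z\<close> be filtered by shifts
  of \<open>X\<close>. An unshifted first factor \<open>x\<close> is not in \<open>S\<close>, since \<open>Hom(S, z) = 0\<close>. It lies in \<open>Z\<close>, and
  the third object of the triangle of \<open>Z\<close> on \<open>x \<rightarrow> z\<close> has a shorter filtration. If all factors are
  shifted, then \<open>z\<langle>1\<rangle>\<close> needs one shift less, and exactness of \<open>\<langle>-1\<rangle>\<close> (\<open>U_standard\<close>) leads back to
  \<open>z\<close>.

  Extension (\<open>sms_extend\<close>): the triangles of \<open>Z\<close> and the functor \<open>\<langle>-1\<rangle>\<close> are made from those of \<open>D\<close>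
  and objects of \<open>\<langle>S\<rangle>\<close>, so \<open>R \<union> S\<close> generates \<open>Z\<close> inside \<open>D\<close> (\<open>Z_in_layers\<close>). Finally, \<open>w\<close> left
  approximations and one right approximation by shifts of \<open>\<langle>S\<rangle>\<close> reduce an arbitrary object to one
  of \<open>Z\<close> (\<open>generated_by_Z\<close>).
\<close>

section \<open>Morphisms of a linear category\<close>

text \<open>
  A retract in a triangulated category is the same as a direct summand, the cone of the section
  being a complement. Retracts are easier to carry along triangles than decompositions.
\<close>

definition retract :: "('k::field, 'o, 'm::ab_group_add, 'z) lin_cat_scheme \<Rightarrow> 'o \<Rightarrow> 'o \<Rightarrow> bool" where
  "retract C a m \<longleftrightarrow> a \<in> Ob C \<and> m \<in> Ob C \<and>
     (\<exists>i \<in> Hom C a m. \<exists>p \<in> Hom C m a. p \<cdot>\<^bsub>C\<^esub> i = idm C a)"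

context linear_category
begin

text \<open>
  The Hom-spaces need not be disjoint, so a morphism always comes with its domain and codomain.
  Recording that these are objects removes the membership conditions from all later statements.
\<close>

definition arr :: "'m \<Rightarrow> 'o \<Rightarrow> 'o \<Rightarrow> bool" where
  "arr f x y \<longleftrightarrow> x \<in> Ob C \<and> y \<in> Ob C \<and> f \<in> Hom C x y"

lemma arr_ob: "arr f x y \<Longrightarrow> x \<in> Ob C" "arr f x y \<Longrightarrow> y \<in> Ob C"
  by (auto simp: arr_def)

lemma arr_comp: "\<lbrakk>arr f x y; arr g y z\<rbrakk> \<Longrightarrow> arr (g \<cdot> f) x z"
  using cmp_in by (auto simp: arr_def)

lemma comp_assoc:
  "\<lbrakk>arr f x y; arr g y z; arr h z t\<rbrakk> \<Longrightarrow> (h \<cdot> g) \<cdot> f = h \<cdot> (g \<cdot> f)"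
  using cmp_assoc by (auto simp: arr_def)

lemma arr_id: "x \<in> Ob C \<Longrightarrow> arr (idm C x) x x"
  using idm_in by (auto simp: arr_def)

lemma comp_id_right: "arr f x y \<Longrightarrow> f \<cdot> idm C x = f"
  using idm_right by (auto simp: arr_def)

lemma comp_id_left: "arr f x y \<Longrightarrow> idm C y \<cdot> f = f"
  using idm_left by (auto simp: arr_def)

lemma arr_zero: "\<lbrakk>x \<in> Ob C; y \<in> Ob C\<rbrakk> \<Longrightarrow> arr 0 x y"
  using Hom_subspace subspace_0 by (auto simp: arr_def)

lemma arr_add: "\<lbrakk>arr f x y; arr g x y\<rbrakk> \<Longrightarrow> arr (f + g) x y"
  using Hom_subspace subspace_add by (auto simp: arr_def)

lemma arr_minus: "arr f x y \<Longrightarrow> arr (- f) x y"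
  using Hom_subspace subspace_neg by (auto simp: arr_def)

lemma arr_diff: "\<lbrakk>arr f x y; arr g x y\<rbrakk> \<Longrightarrow> arr (f - g) x y"
  using Hom_subspace subspace_diff by (auto simp: arr_def)

lemma comp_add_right:
  "\<lbrakk>arr f x y; arr f' x y; arr g y z\<rbrakk> \<Longrightarrow> g \<cdot> (f + f') = g \<cdot> f + g \<cdot> f'"
  using cmp_add_right by (auto simp: arr_def)

lemma comp_add_left:
  "\<lbrakk>arr f x y; arr g y z; arr g' y z\<rbrakk> \<Longrightarrow> (g + g') \<cdot> f = g \<cdot> f + g' \<cdot> f"
  using cmp_add_left by (auto simp: arr_def)

lemma comp_zero_right: "arr g y z \<Longrightarrow> g \<cdot> 0 = 0"
  using comp_add_right[of 0 y y 0 g z] arr_zero[of y y] arr_ob by auto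

lemma comp_zero_left: "arr f x y \<Longrightarrow> 0 \<cdot> f = 0"
  using comp_add_left[of f x y 0 y 0] arr_zero[of y y] arr_ob by auto

lemma comp_minus_right: "\<lbrakk>arr f x y; arr g y z\<rbrakk> \<Longrightarrow> g \<cdot> (- f) = - (g \<cdot> f)"
  using comp_add_right[of f x y "- f" g z] arr_minus[of f x y] comp_zero_right[of g y z]
  by (simp add: eq_neg_iff_add_eq_0 add.commute)

lemma comp_minus_left: "\<lbrakk>arr f x y; arr g y z\<rbrakk> \<Longrightarrow> (- g) \<cdot> f = - (g \<cdot> f)"
  using comp_add_left[of f x y g z "- g"] arr_minus[of g y z] comp_zero_left[of f x y]
  by (simp add: eq_neg_iff_add_eq_0 add.commute)

lemma comp_diff_right:
  "\<lbrakk>arr f x y; arr f' x y; arr g y z\<rbrakk> \<Longrightarrow> g \<cdot> (f - f') = g \<cdot> f - g \<cdot> f'"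
  using comp_add_right[of f x y "- f'" g z] comp_minus_right[of f' x y g z] arr_minus[of f' x y]
  by simp

lemma comp_diff_left:
  "\<lbrakk>arr f x y; arr g y z; arr g' y z\<rbrakk> \<Longrightarrow> (g - g') \<cdot> f = g \<cdot> f - g' \<cdot> f"
  using comp_add_left[of f x y g z "- g'"] comp_minus_left[of f x y g' z] arr_minus[of g' y z]
  by simp

definition iso :: "'m \<Rightarrow> 'o \<Rightarrow> 'o \<Rightarrow> bool" where
  "iso f x y \<longleftrightarrow> x \<in> Ob C \<and> y \<in> Ob C \<and> is_iso C x y f"

definition iso_ob :: "'o \<Rightarrow> 'o \<Rightarrow> bool" (infix "\<cong>" 50) where
  "x \<cong> y \<longleftrightarrow> (\<exists>f. iso f x y)"

lemma iso_iff: "iso f x y \<longleftrightarrow> arr f x y \<and> (\<exists>g. arr g y x \<and> g \<cdot> f = idm C x \<and> f \<cdot> g = idm C y)"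
  by (auto simp: iso_def is_iso_def arr_def)

lemma iso_arr: "iso f x y \<Longrightarrow> arr f x y"
  by (simp add: iso_iff)

lemma iso_inverse: "iso f x y \<Longrightarrow> \<exists>g. iso g y x \<and> g \<cdot> f = idm C x \<and> f \<cdot> g = idm C y"
  by (auto simp: iso_iff)

lemma iso_idm: "x \<in> Ob C \<Longrightarrow> iso (idm C x) x x"
  unfolding iso_iff using arr_id comp_id_left by blast

lemma iso_comp:
  assumes "iso f x y" "iso g y z" shows "iso (g \<cdot> f) x z"
proof -
  obtain f' g' where f': "arr f' y x" "f' \<cdot> f = idm C x" "f \<cdot> f' = idm C y"
    and g': "arr g' z y" "g' \<cdot> g = idm C y" "g \<cdot> g' = idm C z"
    using assms by (auto simp: iso_iff)
  have a: "arr f x y" "arr g y z" using assms iso_arr by auto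
  have "(f' \<cdot> g') \<cdot> (g \<cdot> f) = f' \<cdot> ((g' \<cdot> g) \<cdot> f)"
    using comp_assoc[OF arr_comp[OF a] g'(1) f'(1)] comp_assoc[OF a g'(1)] by simp
  also have "\<dots> = idm C x" using a f' g' by (simp add: comp_id_left)
  finally have 1: "(f' \<cdot> g') \<cdot> (g \<cdot> f) = idm C x" .
  have "(g \<cdot> f) \<cdot> (f' \<cdot> g') = g \<cdot> ((f \<cdot> f') \<cdot> g')"
    using comp_assoc[OF arr_comp[OF g'(1) f'(1)] a] comp_assoc[OF g'(1) f'(1) a(1)] by simp
  also have "\<dots> = idm C z" using a f' g' by (simp add: comp_id_left)
  finally show ?thesis using 1 a f'(1) g'(1) arr_comp unfolding iso_iff by meson
qed

lemma iso_of_two_sided: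
  assumes "arr f x y" "arr l y x" "l \<cdot> f = idm C x" "arr r y x" "f \<cdot> r = idm C y"
  shows "iso f x y"
proof -
  have "l = l \<cdot> (f \<cdot> r)" using assms comp_id_right by simp
  also have "\<dots> = r" using comp_assoc[OF assms(4,1,2)] assms(3) comp_id_left[OF assms(4)] by simp
  finally show ?thesis using assms unfolding iso_iff by blast
qed

lemma iso_ob_refl: "x \<in> Ob C \<Longrightarrow> x \<cong> x"
  using iso_idm iso_ob_def by blast

lemma iso_ob_sym: "x \<cong> y \<Longrightarrow> y \<cong> x"
  using iso_inverse iso_ob_def by blast

lemma iso_ob_trans: "\<lbrakk>x \<cong> y; y \<cong> z\<rbrakk> \<Longrightarrow> x \<cong> z"
  unfolding iso_ob_def using iso_comp by blast

lemma iso_ob_in: "x \<cong> y \<Longrightarrow> x \<in> Ob C" "x \<cong> y \<Longrightarrow> y \<in> Ob C"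
  by (auto simp: iso_ob_def iso_def)

lemma isomorphic_iff: "\<lbrakk>x \<in> Ob C; y \<in> Ob C\<rbrakk> \<Longrightarrow> isomorphic C x y \<longleftrightarrow> x \<cong> y"
  by (auto simp: iso_ob_def iso_def isomorphic_def)

lemma iso_cancel_left:
  assumes "iso f y z" "arr g x y" "arr g' x y" "f \<cdot> g = f \<cdot> g'" shows "g = g'"
proof -
  obtain f' where f': "iso f' z y" "f' \<cdot> f = idm C y" using iso_inverse[OF assms(1)] by blast
  have "g = f' \<cdot> (f \<cdot> g)"
    using comp_assoc[OF assms(2) iso_arr[OF assms(1)] iso_arr[OF f'(1)]] comp_id_left[OF assms(2)] f'(2)
    by simp
  also have "\<dots> = f' \<cdot> (f \<cdot> g')" by (simp only: assms(4))
  also have "\<dots> = g'"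
    using comp_assoc[OF assms(3) iso_arr[OF assms(1)] iso_arr[OF f'(1)]] comp_id_left[OF assms(3)] f'(2)
    by simp
  finally show ?thesis .
qed

lemma iso_cancel_right:
  assumes "iso f x y" "arr g y z" "arr g' y z" "g \<cdot> f = g' \<cdot> f" shows "g = g'"
proof -
  obtain f' where f': "iso f' y x" "f \<cdot> f' = idm C y" using iso_inverse[OF assms(1)] by blast
  have "g = (g \<cdot> f) \<cdot> f'"
    using comp_assoc[OF iso_arr[OF f'(1)] iso_arr[OF assms(1)] assms(2)] comp_id_right[OF assms(2)] f'(2)
    by simp
  also have "\<dots> = (g' \<cdot> f) \<cdot> f'" by (simp only: assms(4))
  also have "\<dots> = g'"
    using comp_assoc[OF iso_arr[OF f'(1)] iso_arr[OF assms(1)] assms(3)] comp_id_right[OF assms(3)] f'(2)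
    by simp
  finally show ?thesis .
qed

definition perp :: "'o \<Rightarrow> 'o \<Rightarrow> bool" (infix "\<bottom>" 50) where
  "x \<bottom> y \<longleftrightarrow> (\<forall>f. arr f x y \<longrightarrow> f = 0)"

lemma perpD: "\<lbrakk>x \<bottom> y; arr f x y\<rbrakk> \<Longrightarrow> f = 0"
  by (simp add: perp_def)

lemma Hom_zero_iff: "\<lbrakk>x \<in> Ob C; y \<in> Ob C\<rbrakk> \<Longrightarrow> Hom C x y = {0} \<longleftrightarrow> x \<bottom> y"
  unfolding perp_def using arr_zero[of x y] by (auto simp: arr_def)

lemma perp_iso_left:
  assumes "x \<cong> x'" "x \<bottom> y" shows "x' \<bottom> y"
proof -
  obtain a where a: "iso a x x'" using assms iso_ob_def by blast
  show ?thesis unfolding perp_def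
  proof (intro allI impI)
    fix f assume f: "arr f x' y"
    have "f \<cdot> a = 0" using perpD[OF assms(2)] a f iso_arr arr_comp by blast
    then show "f = 0"
      using iso_cancel_right[OF a f arr_zero[OF arr_ob[OF f]]] comp_zero_left[OF iso_arr[OF a]] by simp
  qed
qed

lemma perp_iso_right:
  assumes "y \<cong> y'" "x \<bottom> y" shows "x \<bottom> y'"
proof -
  obtain a where a: "iso a y' y" using assms iso_ob_def iso_ob_sym by blast
  show ?thesis unfolding perp_def
  proof (intro allI impI)
    fix f assume f: "arr f x y'"
    have "a \<cdot> f = 0" using perpD[OF assms(2)] a f iso_arr arr_comp by blast
    then show "f = 0"
      using iso_cancel_left[OF a f arr_zero[OF arr_ob[OF f]]] comp_zero_right[OF iso_arr[OF a]] by simp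
  qed
qed

lemma zero_iff: "is_zero C z \<longleftrightarrow> z \<in> Ob C \<and> idm C z = 0"
proof
  assume "is_zero C z" then show "z \<in> Ob C \<and> idm C z = 0"
    using idm_in by (auto simp: is_zero_def)
next
  assume z: "z \<in> Ob C \<and> idm C z = 0"
  have "x \<bottom> z" "z \<bottom> x" for x
    using z comp_id_left comp_id_right comp_zero_left comp_zero_right by (fastforce simp: perp_def)+
  then show "is_zero C z" unfolding is_zero_def using Hom_zero_iff z by blast
qed

lemma zero_ob: "is_zero C z \<Longrightarrow> z \<in> Ob C"
  by (simp add: is_zero_def)

lemma zero_perp: "\<lbrakk>is_zero C z; x \<in> Ob C\<rbrakk> \<Longrightarrow> x \<bottom> z" "\<lbrakk>is_zero C z; x \<in> Ob C\<rbrakk> \<Longrightarrow> z \<bottom> x"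
  using Hom_zero_iff by (auto simp: is_zero_def)

lemma zero_arr: "\<lbrakk>is_zero C z; arr f x z\<rbrakk> \<Longrightarrow> f = 0" "\<lbrakk>is_zero C z; arr f z x\<rbrakk> \<Longrightarrow> f = 0"
  using zero_perp perpD arr_ob by blast+

lemma perp_self_zero: "\<lbrakk>x \<in> Ob C; x \<bottom> x\<rbrakk> \<Longrightarrow> is_zero C x"
  using zero_iff perpD arr_id by blast

lemma zero_iso: "\<lbrakk>is_zero C z; z \<cong> z'\<rbrakk> \<Longrightarrow> is_zero C z'"
  by (meson iso_ob_in perp_iso_left perp_iso_right perp_self_zero zero_perp)

lemma zero_iso_zero: "\<lbrakk>is_zero C z; is_zero C z'\<rbrakk> \<Longrightarrow> iso 0 z z'"
  unfolding iso_iff by (metis arr_zero comp_zero_left zero_iff)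

lemma retract_trans:
  assumes "retract C a b" "retract C b c" shows "retract C a c"
proof -
  obtain i p where i: "arr i a b" "arr p b a" "p \<cdot> i = idm C a"
    using assms(1) unfolding retract_def arr_def by blast
  obtain j q where j: "arr j b c" "arr q c b" "q \<cdot> j = idm C b"
    using assms(2) unfolding retract_def arr_def by blast
  have "(p \<cdot> q) \<cdot> (j \<cdot> i) = p \<cdot> ((q \<cdot> j) \<cdot> i)"
    using comp_assoc[OF arr_comp[OF i(1) j(1)] j(2) i(2)] comp_assoc[OF i(1) j(1,2)] by simp
  also have "\<dots> = idm C a" using i j comp_id_left by simp
  finally show ?thesis using arr_comp[OF i(1) j(1)] arr_comp[OF j(2) i(2)]
    unfolding retract_def arr_def by blast
qed

lemma iso_scale:
  assumes "iso f x y" "c \<noteq> 0" shows "iso (scl C c f) x y"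
proof -
  obtain g where g: "iso g y x" "g \<cdot> f = idm C x" "f \<cdot> g = idm C y" using iso_inverse assms by blast
  have ob: "x \<in> Ob C" "y \<in> Ob C" "f \<in> Hom C x y" "g \<in> Hom C y x"
    using iso_arr[OF assms(1)] iso_arr[OF g(1)] by (auto simp: arr_def)
  have h: "scl C c f \<in> Hom C x y" "scl C (inverse c) g \<in> Hom C y x"
    using ob Hom_subspace subspace_scale by auto
  have "scl C (inverse c) g \<cdot> scl C c f = scl C (inverse c) (scl C c (g \<cdot> f))"
    using cmp_scl_left[OF ob(1,2,1) h(1) ob(4)] cmp_scl_right[OF ob(1,2,1) ob(3) ob(4)] by simp
  moreover have "scl C c f \<cdot> scl C (inverse c) g = scl C c (scl C (inverse c) (f \<cdot> g))"
    using cmp_scl_left[OF ob(2,1,2) h(2) ob(3)] cmp_scl_right[OF ob(2,1,2) ob(4) ob(3)] by simp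
  ultimately show ?thesis using g(2,3) h ob(1,2) assms(2) unfolding iso_iff arr_def by auto
qed

lemma Hom_zero_of_dim_zero:
  assumes "hom_finite C" "x \<in> Ob C" "y \<in> Ob C" "dim (Hom C x y) = 0" shows "Hom C x y = {0}"
proof -
  obtain B where B: "B \<subseteq> Hom C x y" "independent B" "Hom C x y \<subseteq> span B" "card B = dim (Hom C x y)"
    using basis_exists by blast
  obtain A where A: "finite A" "span A = Hom C x y" using assms(1-3) unfolding hom_finite_def by blast
  have "finite B" using independent_span_bound[OF A(1) B(2)] B(1) A(2) by auto
  then have "B = {}" using B(4) assms(4) by simp
  then show ?thesis using B(3) arr_zero[OF assms(2,3)] by (auto simp: arr_def)
qed

lemma dim_zero_Hom: "dim {0} = 0"
  by (metis card.empty dim_eq_card_independent dim_span independent_empty span_empty)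

end

context triangulated_category
begin

abbreviation shift_ob :: "'o \<Rightarrow> 'o" ("\<Sigma>") where "\<Sigma> x \<equiv> sh C x"
abbreviation shift_mor :: "'o \<Rightarrow> 'o \<Rightarrow> 'm \<Rightarrow> 'm" ("\<Sigma>\<^sub>m") where "\<Sigma>\<^sub>m x y f \<equiv> fmor (shift C) x y f"

section \<open>The suspension functor\<close>

lemma shift_linear: "linear_functor C (shift C)"
  using shift_autoequivalence by (auto simp: autoequivalence_def)

lemma shift_in: "x \<in> Ob C \<Longrightarrow> \<Sigma> x \<in> Ob C"
  using shift_linear by (auto simp: linear_functor_def)

lemma shift_arr: "arr f x y \<Longrightarrow> arr (\<Sigma>\<^sub>m x y f) (\<Sigma> x) (\<Sigma> y)"
  using shift_linear by (auto simp: linear_functor_def arr_def)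

lemma shift_id: "x \<in> Ob C \<Longrightarrow> \<Sigma>\<^sub>m x x (idm C x) = idm C (\<Sigma> x)"
  using shift_linear by (auto simp: linear_functor_def)

lemma shift_comp: "\<lbrakk>arr f x y; arr g y z\<rbrakk> \<Longrightarrow> \<Sigma>\<^sub>m x z (g \<cdot> f) = \<Sigma>\<^sub>m y z g \<cdot> \<Sigma>\<^sub>m x y f"
  using shift_linear by (auto simp: linear_functor_def arr_def)

lemma shift_add: "\<lbrakk>arr f x y; arr g x y\<rbrakk> \<Longrightarrow> \<Sigma>\<^sub>m x y (f + g) = \<Sigma>\<^sub>m x y f + \<Sigma>\<^sub>m x y g"
  using shift_linear by (auto simp: linear_functor_def arr_def)

lemma shift_zero: "\<lbrakk>x \<in> Ob C; y \<in> Ob C\<rbrakk> \<Longrightarrow> \<Sigma>\<^sub>m x y 0 = 0"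
  using shift_add[of 0 x y 0] arr_zero by auto

lemma shift_minus: "arr f x y \<Longrightarrow> \<Sigma>\<^sub>m x y (- f) = - \<Sigma>\<^sub>m x y f"
  using shift_add[of f x y "- f"] arr_minus[of f x y] shift_zero[of x y] arr_ob
  by (simp add: eq_neg_iff_add_eq_0 add.commute)

lemma shift_inverse:
  "\<exists>G \<eta> \<theta>. linear_functor C G \<and> fob G = unshift C \<and>
    (\<forall>x. x \<in> Ob C \<longrightarrow> iso (\<eta> x) (fob G (\<Sigma> x)) x) \<and>
    (\<forall>x y f. arr f x y \<longrightarrow> f \<cdot> \<eta> x = \<eta> y \<cdot> fmor G (\<Sigma> x) (\<Sigma> y) (\<Sigma>\<^sub>m x y f)) \<and>
    (\<forall>x. x \<in> Ob C \<longrightarrow> iso (\<theta> x) (\<Sigma> (fob G x)) x) \<and>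
    (\<forall>x y f. arr f x y \<longrightarrow> f \<cdot> \<theta> x = \<theta> y \<cdot> \<Sigma>\<^sub>m (fob G x) (fob G y) (fmor G x y f))"
proof -
  obtain G where G: "fob G = unshift C" "linear_functor C G"
    "naturally_isomorphic C (comp_endo (shift C) G) id_endo"
    "naturally_isomorphic C (comp_endo G (shift C)) id_endo"
    using shift_autoequivalence by (auto simp: autoequivalence_def)
  have ob: "x \<in> Ob C \<Longrightarrow> fob G x \<in> Ob C" for x
    using G(2) by (auto simp: linear_functor_def)
  have "\<exists>\<theta>. (\<forall>x. x \<in> Ob C \<longrightarrow> iso (\<theta> x) (\<Sigma> (fob G x)) x) \<and>
      (\<forall>x y f. arr f x y \<longrightarrow> f \<cdot> \<theta> x = \<theta> y \<cdot> \<Sigma>\<^sub>m (fob G x) (fob G y) (fmor G x y f))"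
    using G(3) unfolding naturally_isomorphic_def comp_endo_def id_endo_def arr_def iso_def
    by (elim exE, rule_tac x=\<eta> in exI) (simp add: ob shift_in)
  then obtain \<theta> where \<theta>: "\<And>x. x \<in> Ob C \<Longrightarrow> iso (\<theta> x) (\<Sigma> (fob G x)) x"
    "\<And>x y f. arr f x y \<Longrightarrow> f \<cdot> \<theta> x = \<theta> y \<cdot> \<Sigma>\<^sub>m (fob G x) (fob G y) (fmor G x y f)"
    by blast
  have "\<exists>\<eta>. (\<forall>x. x \<in> Ob C \<longrightarrow> iso (\<eta> x) (fob G (\<Sigma> x)) x) \<and>
      (\<forall>x y f. arr f x y \<longrightarrow> f \<cdot> \<eta> x = \<eta> y \<cdot> fmor G (\<Sigma> x) (\<Sigma> y) (\<Sigma>\<^sub>m x y f))"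
    using G(4) unfolding naturally_isomorphic_def comp_endo_def id_endo_def arr_def iso_def
    by (elim exE, rule_tac x=\<eta> in exI) (simp add: ob shift_in)
  then obtain \<eta> where \<eta>: "\<And>x. x \<in> Ob C \<Longrightarrow> iso (\<eta> x) (fob G (\<Sigma> x)) x"
    "\<And>x y f. arr f x y \<Longrightarrow> f \<cdot> \<eta> x = \<eta> y \<cdot> fmor G (\<Sigma> x) (\<Sigma> y) (\<Sigma>\<^sub>m x y f)"
    by blast
  show ?thesis using G(1,2) \<eta> \<theta> by blast
qed

lemma shift_faithful:
  assumes "arr f x y" "arr g x y" "\<Sigma>\<^sub>m x y f = \<Sigma>\<^sub>m x y g" shows "f = g"
proof -
  obtain G :: "('o, 'm) endo" and \<eta> where
    "(\<forall>x. x \<in> Ob C \<longrightarrow> iso (\<eta> x) (fob G (\<Sigma> x)) x) \<and>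
     (\<forall>x y f. arr f x y \<longrightarrow> f \<cdot> \<eta> x = \<eta> y \<cdot> fmor G (\<Sigma> x) (\<Sigma> y) (\<Sigma>\<^sub>m x y f))"
    using shift_inverse by (elim exE conjE) blast
  then have \<eta>: "\<And>x. x \<in> Ob C \<Longrightarrow> iso (\<eta> x) (fob G (\<Sigma> x)) x"
    "\<And>x y f. arr f x y \<Longrightarrow> f \<cdot> \<eta> x = \<eta> y \<cdot> fmor G (\<Sigma> x) (\<Sigma> y) (\<Sigma>\<^sub>m x y f)"
    by blast+
  show ?thesis using iso_cancel_right[OF \<eta>(1)] \<eta>(2) assms arr_ob by metis
qed

text \<open>
  With \<open>\<eta>: G\<Sigma> \<cong> id\<close> the only candidate is the conjugate of \<open>G g\<close> by \<open>\<eta>\<close>. It has the same image as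
  \<open>g\<close> under \<open>G\<close>, and \<open>G\<close> is faithful because \<open>\<Sigma> G \<cong> id\<close>.
\<close>

lemma shift_full:
  assumes "arr g (\<Sigma> x) (\<Sigma> y)" "x \<in> Ob C" "y \<in> Ob C"
  shows "\<exists>f. arr f x y \<and> \<Sigma>\<^sub>m x y f = g"
proof -
  obtain G \<eta> \<theta> where G: "linear_functor C G"
    and \<eta>: "\<And>x. x \<in> Ob C \<Longrightarrow> iso (\<eta> x) (fob G (\<Sigma> x)) x"
    "\<And>x y f. arr f x y \<Longrightarrow> f \<cdot> \<eta> x = \<eta> y \<cdot> fmor G (\<Sigma> x) (\<Sigma> y) (\<Sigma>\<^sub>m x y f)"
    and \<theta>: "\<And>x. x \<in> Ob C \<Longrightarrow> iso (\<theta> x) (\<Sigma> (fob G x)) x"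
    "\<And>x y f. arr f x y \<Longrightarrow> f \<cdot> \<theta> x = \<theta> y \<cdot> \<Sigma>\<^sub>m (fob G x) (fob G y) (fmor G x y f)"
    using shift_inverse by blast
  have Garr: "\<And>x y f. arr f x y \<Longrightarrow> arr (fmor G x y f) (fob G x) (fob G y)"
    using G by (auto simp: linear_functor_def arr_def)
  obtain e where e: "iso e x (fob G (\<Sigma> x))" "\<eta> x \<cdot> e = idm C x" "e \<cdot> \<eta> x = idm C (fob G (\<Sigma> x))"
    using iso_inverse[OF \<eta>(1)[OF assms(2)]] by blast
  let ?g = "fmor G (\<Sigma> x) (\<Sigma> y) g"
  define f where "f = \<eta> y \<cdot> (?g \<cdot> e)"
  have ag: "arr ?g (fob G (\<Sigma> x)) (fob G (\<Sigma> y))" using Garr assms by blast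
  have f: "arr f x y" unfolding f_def
    using ag e(1) \<eta>(1)[OF assms(3)] by (meson arr_comp iso_arr)
  have "f \<cdot> \<eta> x = \<eta> y \<cdot> (?g \<cdot> (e \<cdot> \<eta> x))" unfolding f_def
    using ag e(1) \<eta>(1)[OF assms(3)] \<eta>(1)[OF assms(2)] by (metis arr_comp comp_assoc iso_arr)
  then have "f \<cdot> \<eta> x = \<eta> y \<cdot> ?g" using e(3) ag comp_id_right by simp
  then have "\<eta> y \<cdot> fmor G (\<Sigma> x) (\<Sigma> y) (\<Sigma>\<^sub>m x y f) = \<eta> y \<cdot> ?g" using \<eta>(2)[OF f] by simp
  then have eq: "fmor G (\<Sigma> x) (\<Sigma> y) (\<Sigma>\<^sub>m x y f) = ?g"
    using iso_cancel_left[OF \<eta>(1)[OF assms(3)]] ag Garr[OF shift_arr[OF f]] by blast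
  have "\<Sigma>\<^sub>m x y f \<cdot> \<theta> (\<Sigma> x) = g \<cdot> \<theta> (\<Sigma> x)"
    using \<theta>(2)[OF shift_arr[OF f]] \<theta>(2)[OF assms(1)] eq by simp
  then have "\<Sigma>\<^sub>m x y f = g"
    using iso_cancel_right[OF \<theta>(1)[OF shift_in[OF assms(2)]] shift_arr[OF f] assms(1)] by blast
  with f show ?thesis by blast
qed

lemma shift_eq_zero_iff: "arr f x y \<Longrightarrow> \<Sigma>\<^sub>m x y f = 0 \<longleftrightarrow> f = 0"
  using shift_faithful[of f x y 0] shift_zero[of x y] arr_zero[of x y] arr_ob by auto

lemma unshift_in: "x \<in> Ob C \<Longrightarrow> unshift C x \<in> Ob C"
  using shift_inverse by (auto simp: linear_functor_def)

lemma shift_unshift: "x \<in> Ob C \<Longrightarrow> \<Sigma> (unshift C x) \<cong> x"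
  using shift_inverse iso_ob_def by fastforce

lemma shift_iso: "iso f x y \<Longrightarrow> iso (\<Sigma>\<^sub>m x y f) (\<Sigma> x) (\<Sigma> y)"
  unfolding iso_iff by (metis shift_arr shift_comp shift_id arr_ob(1))

lemma shift_iso_reflect:
  assumes "arr f x y" "iso (\<Sigma>\<^sub>m x y f) (\<Sigma> x) (\<Sigma> y)" shows "iso f x y"
proof -
  have ob: "x \<in> Ob C" "y \<in> Ob C" using assms arr_ob by auto
  obtain G where G: "arr G (\<Sigma> y) (\<Sigma> x)" "G \<cdot> \<Sigma>\<^sub>m x y f = idm C (\<Sigma> x)" "\<Sigma>\<^sub>m x y f \<cdot> G = idm C (\<Sigma> y)"
    using assms unfolding iso_iff by blast
  obtain g where g: "arr g y x" "\<Sigma>\<^sub>m y x g = G" using shift_full[OF G(1)] ob by blast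
  have "g \<cdot> f = idm C x"
    using shift_faithful[OF arr_comp[OF assms(1) g(1)] arr_id[OF ob(1)]] shift_comp[OF assms(1) g(1)]
      g(2) G(2) shift_id[OF ob(1)] by simp
  moreover have "f \<cdot> g = idm C y"
    using shift_faithful[OF arr_comp[OF g(1) assms(1)] arr_id[OF ob(2)]] shift_comp[OF g(1) assms(1)]
      g(2) G(3) shift_id[OF ob(2)] by simp
  ultimately show ?thesis using g assms unfolding iso_iff by blast
qed

lemma shift_iso_ob: "x \<cong> y \<Longrightarrow> \<Sigma> x \<cong> \<Sigma> y"
  using shift_iso iso_ob_def by blast

lemma shift_iso_ob_reflect:
  assumes "\<Sigma> x \<cong> \<Sigma> y" "x \<in> Ob C" "y \<in> Ob C" shows "x \<cong> y"
  using assms by (metis iso_arr iso_ob_def shift_full shift_iso_reflect)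

lemma shift_perp:
  assumes "x \<in> Ob C" "y \<in> Ob C" shows "\<Sigma> x \<bottom> \<Sigma> y \<longleftrightarrow> x \<bottom> y"
  unfolding perp_def using shift_full[OF _ assms] shift_arr shift_zero assms shift_eq_zero_iff by metis

lemma shift_zero_ob: "x \<in> Ob C \<Longrightarrow> is_zero C (\<Sigma> x) \<longleftrightarrow> is_zero C x"
  by (metis perp_self_zero shift_in shift_perp zero_perp(1))

lemma funpow_shift_in: "x \<in> Ob C \<Longrightarrow> (\<Sigma> ^^ n) x \<in> Ob C"
  by (induction n) (auto intro: shift_in)

lemma funpow_shift_iso: "x \<cong> y \<Longrightarrow> (\<Sigma> ^^ n) x \<cong> (\<Sigma> ^^ n) y"
  by (induction n) (auto intro: shift_iso_ob)

lemma funpow_shift_perp: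
  "\<lbrakk>x \<in> Ob C; y \<in> Ob C\<rbrakk> \<Longrightarrow> (\<Sigma> ^^ n) x \<bottom> (\<Sigma> ^^ n) y \<longleftrightarrow> x \<bottom> y"
  by (induction n) (auto simp: shift_perp funpow_shift_in)

lemma funpow_shift_perp_add:
  "\<lbrakk>x \<in> Ob C; y \<in> Ob C\<rbrakk> \<Longrightarrow> (\<Sigma> ^^ (n + m)) x \<bottom> (\<Sigma> ^^ n) y \<longleftrightarrow> (\<Sigma> ^^ m) x \<bottom> y"
  by (simp add: funpow_add funpow_shift_perp funpow_shift_in)

lemma funpow_unshift_in: "x \<in> Ob C \<Longrightarrow> (unshift C ^^ n) x \<in> Ob C"
  by (induction n) (auto intro: unshift_in)

lemma funpow_shift_unshift: "x \<in> Ob C \<Longrightarrow> (\<Sigma> ^^ n) ((unshift C ^^ n) x) \<cong> x"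
proof (induction n arbitrary: x)
  case (Suc n)
  have "(\<Sigma> ^^ Suc n) ((unshift C ^^ Suc n) x) = \<Sigma> ((\<Sigma> ^^ n) ((unshift C ^^ n) (unshift C x)))"
    by (simp add: funpow_swap1)
  also have "\<dots> \<cong> \<Sigma> (unshift C x)"
    using Suc.IH[OF unshift_in[OF Suc.prems]] shift_iso_ob by blast
  finally show ?case using shift_unshift[OF Suc.prems] iso_ob_trans by blast
qed (auto intro: iso_ob_refl)

section \<open>Long exact sequences of triangles\<close>

lemma tri_arr: "tri C x y z f g h \<Longrightarrow> arr f x y" "tri C x y z f g h \<Longrightarrow> arr g y z"
  "tri C x y z f g h \<Longrightarrow> arr h z (\<Sigma> x)"
  using tri_in shift_in by (auto simp: arr_def)

lemma tri_ob: "tri C x y z f g h \<Longrightarrow> x \<in> Ob C" "tri C x y z f g h \<Longrightarrow> y \<in> Ob C"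
  "tri C x y z f g h \<Longrightarrow> z \<in> Ob C"
  using tri_in by auto

lemma cone_exists: "arr f x y \<Longrightarrow> \<exists>z g h. tri C x y z f g h"
  using tri_cone by (auto simp: arr_def)

lemma rotate: "tri C x y z f g h \<Longrightarrow> tri C y z (\<Sigma> x) g h (- \<Sigma>\<^sub>m x y f)"
  using tri_rotate tri_in by meson

lemma rotate_back:
  assumes "tri C y z (\<Sigma> x) g h (- \<Sigma>\<^sub>m x y f)" "arr f x y" shows "tri C x y z f g h"
  using assms tri_rotate[of x y z f g h] tri_in[OF assms(1)] by (auto simp: arr_def)

lemma morphism_exists:
  assumes "tri C x y z f g h" "tri C x' y' z' f' g' h'" "arr a x x'" "arr b y y'" "b \<cdot> f = f' \<cdot> a"
  shows "\<exists>c. arr c z z' \<and> c \<cdot> g = g' \<cdot> b \<and> \<Sigma>\<^sub>m x x' a \<cdot> h = h' \<cdot> c"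
  using tri_morphism[OF assms(1,2), of a b] assms(3-5) tri_in[OF assms(1)] tri_in[OF assms(2)]
  by (auto simp: arr_def)

text \<open>
  The trivial triangle on \<open>x\<close> maps to the given one, and its third object is zero.
\<close>

lemma tri_comp_zero:
  assumes "tri C x y z f g h" shows "g \<cdot> f = 0"
proof -
  obtain o' where o': "is_zero C o'" using zero_exists by blast
  have "tri C x x o' (idm C x) 0 0" using tri_id tri_ob[OF assms] o' by blast
  then obtain c where "arr c o' z" "c \<cdot> 0 = g \<cdot> f"
    using morphism_exists[OF _ assms, of x x o' "idm C x" 0 0 "idm C x" f] tri_arr[OF assms] tri_ob[OF assms]
      arr_id comp_id_right by auto
  then show ?thesis using comp_zero_right by metis
qed

lemma tri_comp_zero': "tri C x y z f g h \<Longrightarrow> h \<cdot> g = 0"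
  using rotate tri_comp_zero by blast

lemma tri_comp_zero'': "tri C x y z f g h \<Longrightarrow> \<Sigma>\<^sub>m x y f \<cdot> h = 0"
  using tri_comp_zero'[OF rotate] comp_minus_left[of h z "\<Sigma> x" "\<Sigma>\<^sub>m x y f" "\<Sigma> y"] tri_arr shift_arr
  by (metis neg_equal_0_iff_equal)

text \<open>
  Exactness of \<open>Hom(d,-)\<close> on a triangle: the triangle with connecting morphism \<open>- id\<close> on \<open>\<Sigma> d\<close>
  maps to the rotated triangle, and the completed morphism is a suspension. A prime moves the
  statement one place along the triangle.
\<close>

lemma tri_lift:
  assumes t: "tri C x y z f g h" and p: "arr p d y" "g \<cdot> p = 0"
  shows "\<exists>q. arr q d x \<and> f \<cdot> q = p"
proof -
  obtain o' where o': "is_zero C o'" using zero_exists by blast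
  have d: "d \<in> Ob C" using p arr_ob by auto
  have 1: "tri C d o' (\<Sigma> d) 0 0 (- idm C (\<Sigma> d))"
    using rotate[OF tri_id[OF d o']] shift_id[OF d] by simp
  have "0 \<cdot> 0 = g \<cdot> p" using p(2) arr_zero[OF zero_ob[OF o'] zero_ob[OF o']] comp_zero_left by simp
  then obtain c where c: "arr c (\<Sigma> d) (\<Sigma> x)" "\<Sigma>\<^sub>m d y p \<cdot> - idm C (\<Sigma> d) = - \<Sigma>\<^sub>m x y f \<cdot> c"
    using morphism_exists[OF 1 rotate[OF t] p(1), of 0] arr_zero zero_ob[OF o'] tri_ob[OF t] by metis
  obtain q where q: "arr q d x" "\<Sigma>\<^sub>m d x q = c" using shift_full[OF c(1)] d tri_ob[OF t] by blast
  have sf: "arr (\<Sigma>\<^sub>m x y f) (\<Sigma> x) (\<Sigma> y)" using tri_arr(1)[OF t] shift_arr by blast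
  have "\<Sigma>\<^sub>m d y p = \<Sigma>\<^sub>m x y f \<cdot> c"
    using c(2) comp_minus_left[OF c(1) sf] comp_minus_right[OF arr_id[OF shift_in[OF d]] shift_arr[OF p(1)]]
      comp_id_right[OF shift_arr[OF p(1)]] by simp
  then have "\<Sigma>\<^sub>m d y p = \<Sigma>\<^sub>m d y (f \<cdot> q)" using q shift_comp[OF q(1) tri_arr(1)[OF t]] by simp
  then have "p = f \<cdot> q" using shift_faithful[OF p(1)] arr_comp[OF q(1) tri_arr(1)[OF t]] by blast
  with q show ?thesis by blast
qed

lemma tri_lift': "\<lbrakk>tri C x y z f g h; arr p d z; h \<cdot> p = 0\<rbrakk> \<Longrightarrow> \<exists>q. arr q d y \<and> g \<cdot> q = p"
  using tri_lift[OF rotate] by blast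

text \<open>
  Exactness of \<open>Hom(-,d)\<close>, by mapping the triangle to the trivial one on \<open>d\<close>. Primes again move
  one place to the right.
\<close>

lemma tri_extend:
  assumes t: "tri C x y z f g h" and p: "arr p y d" "p \<cdot> f = 0"
  shows "\<exists>q. arr q z d \<and> q \<cdot> g = p"
proof -
  obtain o' where o': "is_zero C o'" using zero_exists by blast
  have d: "d \<in> Ob C" using p arr_ob by auto
  have "tri C o' d d 0 (idm C d) 0"
  proof (rule rotate_back)
    show "tri C d d (\<Sigma> o') (idm C d) 0 (- \<Sigma>\<^sub>m o' d 0)"
      using tri_id[OF d] o' shift_zero_ob[OF zero_ob[OF o']] shift_zero[OF zero_ob[OF o'] d] by simp
  qed (use arr_zero d zero_ob[OF o'] in blast)
  moreover have "p \<cdot> f = 0 \<cdot> 0" using p(2) arr_zero[OF zero_ob[OF o'] d] comp_zero_right by simp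
  ultimately obtain c where "arr c z d" "c \<cdot> g = idm C d \<cdot> p"
    using morphism_exists[OF t _ _ p(1)] arr_zero[OF tri_ob(1)[OF t] zero_ob[OF o']] by blast
  then show ?thesis using comp_id_left[OF p(1)] by auto
qed

lemma tri_extend': "\<lbrakk>tri C x y z f g h; arr p z d; p \<cdot> g = 0\<rbrakk> \<Longrightarrow> \<exists>q. arr q (\<Sigma> x) d \<and> q \<cdot> h = p"
  using tri_extend[OF rotate] by blast

lemma tri_extend'':
  assumes "tri C x y z f g h" "arr p (\<Sigma> x) d" "p \<cdot> h = 0"
  shows "\<exists>q. arr q (\<Sigma> y) d \<and> q \<cdot> \<Sigma>\<^sub>m x y f = p"
proof -
  obtain q where q: "arr q (\<Sigma> y) d" "q \<cdot> - \<Sigma>\<^sub>m x y f = p"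
    using tri_extend'[OF rotate[OF assms(1)] assms(2,3)] by blast
  have sf: "arr (\<Sigma>\<^sub>m x y f) (\<Sigma> x) (\<Sigma> y)" using tri_arr(1)[OF assms(1)] shift_arr by blast
  have "(- q) \<cdot> \<Sigma>\<^sub>m x y f = p"
    using q comp_minus_left[OF sf q(1)] comp_minus_right[OF sf q(1)] by simp
  then show ?thesis using arr_minus[OF q(1)] by blast
qed

lemma iso_of_square_zero:
  assumes "arr e z z" "arr n z z" "e = idm C z + n" "n \<cdot> n = 0" shows "iso e z z"
proof -
  have z: "z \<in> Ob C" using assms arr_ob by auto
  have i: "arr (idm C z) z z" using arr_id z by blast
  have d: "arr (idm C z - n) z z" using arr_diff i assms by blast
  have "(idm C z - n) \<cdot> e = idm C z"
    using assms comp_add_right[OF i assms(2) d] comp_diff_left[OF assms(2) i assms(2)]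
      comp_id_right[OF d] comp_id_left[OF assms(2)] by simp
  moreover have "e \<cdot> (idm C z - n) = idm C z"
    using assms comp_diff_right[OF i assms(2,1)] comp_add_left[OF assms(2) i assms(2)]
      comp_id_right[OF assms(1)] comp_id_left[OF assms(2)] by simp
  ultimately show ?thesis using assms(1) d unfolding iso_iff by blast
qed

text \<open>
  The difference \<open>e - id\<close> kills \<open>g\<close> and is killed by \<open>h\<close>. It therefore lifts through \<open>g\<close>, and so
  its square is zero.
\<close>

lemma tri_endo_iso:
  assumes t: "tri C x y z f g h" and e: "arr e z z" "e \<cdot> g = g" "h \<cdot> e = h" shows "iso e z z"
proof -
  have z: "z \<in> Ob C" using tri_ob[OF t] by blast
  have i: "arr (idm C z) z z" using arr_id z by blast
  define n where "n = e - idm C z"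
  have n: "arr n z z" unfolding n_def using arr_diff e i by blast
  have ng: "n \<cdot> g = 0" unfolding n_def using comp_diff_left[OF tri_arr(2)[OF t] e(1) i] e
      comp_id_left[OF tri_arr(2)[OF t]] by simp
  have hn: "h \<cdot> n = 0" unfolding n_def using comp_diff_right[OF e(1) i tri_arr(3)[OF t]] e
      comp_id_right[OF tri_arr(3)[OF t]] by simp
  obtain q where q: "arr q z y" "g \<cdot> q = n" using tri_lift'[OF t n hn] by blast
  have "n \<cdot> n = 0" using q ng comp_assoc[OF q(1) tri_arr(2)[OF t] n] comp_zero_left[OF q(1)] by simp
  then show ?thesis using iso_of_square_zero[OF e(1) n] by (simp add: n_def)
qed

text \<open>
  A completion of the inverse morphisms composes with \<open>c\<close>, on either side, to an endomorphism of a
  triangle over identities. Both composites are invertible, so \<open>c\<close> has a left and a right inverse.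
\<close>

lemma tri_iso_third:
  assumes t: "tri C x y z f g h" and t': "tri C x' y' z' f' g' h'"
    and a: "iso a x x'" and b: "iso b y y'" "b \<cdot> f = f' \<cdot> a"
    and c: "arr c z z'" "c \<cdot> g = g' \<cdot> b" "\<Sigma>\<^sub>m x x' a \<cdot> h = h' \<cdot> c"
  shows "iso c z z'"
proof -
  obtain a' where a': "iso a' x' x" "a' \<cdot> a = idm C x" "a \<cdot> a' = idm C x'" using iso_inverse[OF a] by blast
  obtain b' where b': "iso b' y' y" "b' \<cdot> b = idm C y" "b \<cdot> b' = idm C y'" using iso_inverse[OF b(1)] by blast
  note A = iso_arr[OF a] iso_arr[OF a'(1)] iso_arr[OF b(1)] iso_arr[OF b'(1)]
  note T = tri_arr[OF t] and T' = tri_arr[OF t']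
  have "b' \<cdot> f' = b' \<cdot> (f' \<cdot> (a \<cdot> a'))" using a'(3) comp_id_right[OF T'(1)] by simp
  also have "\<dots> = b' \<cdot> ((b \<cdot> f) \<cdot> a')" using comp_assoc[OF A(2,1) T'(1)] b(2) by simp
  also have "\<dots> = (b' \<cdot> b) \<cdot> (f \<cdot> a')"
    using comp_assoc[OF A(2) T(1) A(3)] comp_assoc[OF arr_comp[OF A(2) T(1)] A(3,4)] by simp
  also have "\<dots> = f \<cdot> a'" using b'(2) comp_id_left[OF arr_comp[OF A(2) T(1)]] by simp
  finally obtain c' where c': "arr c' z' z" "c' \<cdot> g' = g \<cdot> b'" "\<Sigma>\<^sub>m x' x a' \<cdot> h' = h \<cdot> c'"
    using morphism_exists[OF t' t A(2,4)] by blast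
  have 1: "iso (c' \<cdot> c) z z"
  proof (rule tri_endo_iso[OF t])
    show "arr (c' \<cdot> c) z z" using c(1) c'(1) arr_comp by blast
    have "(c' \<cdot> c) \<cdot> g = c' \<cdot> (g' \<cdot> b)" using comp_assoc[OF T(2) c(1) c'(1)] c(2) by simp
    also have "\<dots> = (g \<cdot> b') \<cdot> b" using comp_assoc[OF A(3) T'(2) c'(1)] c'(2) by simp
    also have "\<dots> = g" using comp_assoc[OF A(3,4) T(2)] b'(2) comp_id_right[OF T(2)] by simp
    finally show "(c' \<cdot> c) \<cdot> g = g" .
    have "h \<cdot> (c' \<cdot> c) = (\<Sigma>\<^sub>m x' x a' \<cdot> h') \<cdot> c" using comp_assoc[OF c(1) c'(1) T(3)] c'(3) by simp
    also have "\<dots> = \<Sigma>\<^sub>m x' x a' \<cdot> (\<Sigma>\<^sub>m x x' a \<cdot> h)"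
      using comp_assoc[OF c(1) T'(3) shift_arr[OF A(2)]] c(3) by simp
    also have "\<dots> = \<Sigma>\<^sub>m x x (a' \<cdot> a) \<cdot> h"
      using comp_assoc[OF T(3) shift_arr[OF A(1)] shift_arr[OF A(2)]] shift_comp[OF A(1,2)] by simp
    also have "\<dots> = h" using a'(2) shift_id[OF tri_ob(1)[OF t]] comp_id_left[OF T(3)] by simp
    finally show "h \<cdot> (c' \<cdot> c) = h" .
  qed
  have 2: "iso (c \<cdot> c') z' z'"
  proof (rule tri_endo_iso[OF t'])
    show "arr (c \<cdot> c') z' z'" using c(1) c'(1) arr_comp by blast
    have "(c \<cdot> c') \<cdot> g' = c \<cdot> (g \<cdot> b')" using comp_assoc[OF T'(2) c'(1) c(1)] c'(2) by simp
    also have "\<dots> = (g' \<cdot> b) \<cdot> b'" using comp_assoc[OF A(4) T(2) c(1)] c(2) by simp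
    also have "\<dots> = g'" using comp_assoc[OF A(4,3) T'(2)] b'(3) comp_id_right[OF T'(2)] by simp
    finally show "(c \<cdot> c') \<cdot> g' = g'" .
    have "h' \<cdot> (c \<cdot> c') = (\<Sigma>\<^sub>m x x' a \<cdot> h) \<cdot> c'" using comp_assoc[OF c'(1) c(1) T'(3)] c(3) by simp
    also have "\<dots> = \<Sigma>\<^sub>m x x' a \<cdot> (\<Sigma>\<^sub>m x' x a' \<cdot> h')"
      using comp_assoc[OF c'(1) T(3) shift_arr[OF A(1)]] c'(3) by simp
    also have "\<dots> = \<Sigma>\<^sub>m x' x' (a \<cdot> a') \<cdot> h'"
      using comp_assoc[OF T'(3) shift_arr[OF A(2)] shift_arr[OF A(1)]] shift_comp[OF A(2,1)] by simp
    also have "\<dots> = h'" using a'(3) shift_id[OF tri_ob(1)[OF t']] comp_id_left[OF T'(3)] by simp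
    finally show "h' \<cdot> (c \<cdot> c') = h'" .
  qed
  obtain l where l: "arr l z z" "l \<cdot> (c' \<cdot> c) = idm C z" using 1 unfolding iso_iff by blast
  obtain r where r: "arr r z' z'" "(c \<cdot> c') \<cdot> r = idm C z'" using 2 unfolding iso_iff by blast
  show ?thesis
  proof (rule iso_of_two_sided[OF c(1)])
    show "arr (l \<cdot> c') z' z" "arr (c' \<cdot> r) z' z" using l r c' arr_comp by blast+
    show "(l \<cdot> c') \<cdot> c = idm C z" using comp_assoc[OF c(1) c'(1) l(1)] l by simp
    show "c \<cdot> (c' \<cdot> r) = idm C z'" using comp_assoc[OF r(1) c'(1) c(1)] r by simp
  qed
qed

lemma cone_unique:
  assumes t: "tri C x y z f g h" and t': "tri C x y z' f g' h'"
  shows "\<exists>c. iso c z z' \<and> c \<cdot> g = g' \<and> h = h' \<cdot> c"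
proof -
  have ob: "x \<in> Ob C" "y \<in> Ob C" using tri_ob[OF t] by auto
  note T = tri_arr[OF t] and T' = tri_arr[OF t']
  have s: "idm C y \<cdot> f = f \<cdot> idm C x" using comp_id_left comp_id_right T by simp
  obtain c where c: "arr c z z'" "c \<cdot> g = g' \<cdot> idm C y" "\<Sigma>\<^sub>m x x (idm C x) \<cdot> h = h' \<cdot> c"
    using morphism_exists[OF t t' arr_id[OF ob(1)] arr_id[OF ob(2)] s] by blast
  have "iso c z z'" using tri_iso_third[OF t t' iso_idm[OF ob(1)] iso_idm[OF ob(2)] s c] .
  then show ?thesis using c comp_id_right[OF T'(2)] shift_id[OF ob(1)] comp_id_left[OF T(3)] by metis
qed

lemma tri_cong:
  assumes t: "tri C x y z f g h" and a: "iso a x x'" and b: "iso b y y'" and c: "iso c z z'"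
    and f: "arr f' x' y'" "b \<cdot> f = f' \<cdot> a" and g: "arr g' y' z'" "c \<cdot> g = g' \<cdot> b"
    and h: "arr h' z' (\<Sigma> x')" "\<Sigma>\<^sub>m x x' a \<cdot> h = h' \<cdot> c"
  shows "tri C x' y' z' f' g' h'"
  using tri_iso[OF t, of x' y' z' f' g' h' a b c] assms(2-) by (auto simp: arr_def iso_def)

lemma tri_replace_third:
  assumes t: "tri C x y z f g h" and c: "iso c z z'"
  shows "\<exists>h'. arr h' z' (\<Sigma> x) \<and> h' \<cdot> c = h \<and> tri C x y z' f (c \<cdot> g) h'"
proof -
  have ob: "x \<in> Ob C" "y \<in> Ob C" using tri_ob[OF t] by auto
  note T = tri_arr[OF t]
  obtain c' where c': "iso c' z' z" "c' \<cdot> c = idm C z" "c \<cdot> c' = idm C z'" using iso_inverse[OF c] by blast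
  have e: "(h \<cdot> c') \<cdot> c = h" using comp_assoc[OF iso_arr[OF c] iso_arr[OF c'(1)] T(3)] c'(2) comp_id_right[OF T(3)] by simp
  have "tri C x y z' f (c \<cdot> g) (h \<cdot> c')"
    by (rule tri_cong[OF t iso_idm[OF ob(1)] iso_idm[OF ob(2)] c])
      (use T arr_comp[OF T(2) iso_arr[OF c]] arr_comp[OF iso_arr[OF c'(1)] T(3)] e
        in \<open>auto simp: comp_id_left comp_id_right shift_id[OF ob(1)]\<close>)
  then show ?thesis using e tri_arr by blast
qed

lemma tri_replace_second:
  assumes t: "tri C x y z f g h" and b: "iso b y y'"
  shows "\<exists>g'. arr g' y' z \<and> g' \<cdot> b = g \<and> tri C x y' z (b \<cdot> f) g' h"
proof -
  have ob: "x \<in> Ob C" "z \<in> Ob C" using tri_ob[OF t] by auto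
  note T = tri_arr[OF t]
  obtain b' where b': "iso b' y' y" "b' \<cdot> b = idm C y" "b \<cdot> b' = idm C y'" using iso_inverse[OF b] by blast
  have e: "(g \<cdot> b') \<cdot> b = g" using comp_assoc[OF iso_arr[OF b] iso_arr[OF b'(1)] T(2)] b'(2) comp_id_right[OF T(2)] by simp
  have bf: "arr (b \<cdot> f) x y'" "arr (g \<cdot> b') y' z" using T b' iso_arr[OF b] iso_arr[OF b'(1)] arr_comp by blast+
  have "tri C x y' z (b \<cdot> f) (g \<cdot> b') h"
    by (rule tri_cong[OF t iso_idm[OF ob(1)] b iso_idm[OF ob(2)]])
      (use T bf e in \<open>auto simp: comp_id_left comp_id_right shift_id[OF ob(1)]\<close>)
  then show ?thesis using e tri_arr by blast
qed

lemma tri_replace_first: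
  assumes t: "tri C x y z f g h" and a: "iso a x' x"
  shows "\<exists>h'. arr h' z (\<Sigma> x') \<and> \<Sigma>\<^sub>m x' x a \<cdot> h' = h \<and> tri C x' y z (f \<cdot> a) g h'"
proof -
  have ob: "y \<in> Ob C" "z \<in> Ob C" "x \<in> Ob C" using tri_ob[OF t] by auto
  note T = tri_arr[OF t]
  obtain b where b: "iso b x x'" "b \<cdot> a = idm C x'" "a \<cdot> b = idm C x" using iso_inverse[OF a] by blast
  note A = iso_arr[OF a] iso_arr[OF b(1)]
  have "(f \<cdot> a) \<cdot> b = f" using comp_assoc[OF A(2,1) T(1)] b(3) comp_id_right[OF T(1)] by simp
  moreover have "arr (f \<cdot> a) x' y" "arr (\<Sigma>\<^sub>m x x' b \<cdot> h) z (\<Sigma> x')" using T A shift_arr arr_comp by blast+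
  ultimately have "tri C x' y z (f \<cdot> a) g (\<Sigma>\<^sub>m x x' b \<cdot> h)"
    by (intro tri_cong[OF t b(1) iso_idm[OF ob(1)] iso_idm[OF ob(2)]])
      (use T in \<open>auto simp: comp_id_left comp_id_right\<close>)
  moreover have "\<Sigma>\<^sub>m x' x a \<cdot> (\<Sigma>\<^sub>m x x' b \<cdot> h) = h"
    using comp_assoc[OF T(3) shift_arr[OF A(2)] shift_arr[OF A(1)]] shift_comp[OF A(2,1)] b(3)
      shift_id[OF ob(3)] comp_id_left[OF T(3)] by simp
  ultimately show ?thesis using tri_arr by blast
qed

lemma cone_of_iso_zero:
  assumes t: "tri C x y z f g h" and f: "iso f x y" shows "is_zero C z"
proof -
  have z: "z \<in> Ob C" using tri_ob[OF t] by blast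
  note T = tri_arr[OF t]
  have "g \<cdot> f = 0 \<cdot> f" using tri_comp_zero[OF t] comp_zero_left[OF T(1)] by simp
  then have g0: "g = 0" using iso_cancel_right[OF f T(2)] arr_zero tri_ob[OF t] by blast
  have sf: "iso (\<Sigma>\<^sub>m x y f) (\<Sigma> x) (\<Sigma> y)" using shift_iso f by blast
  have "\<Sigma>\<^sub>m x y f \<cdot> h = \<Sigma>\<^sub>m x y f \<cdot> 0"
    using tri_comp_zero''[OF t] comp_zero_right[OF iso_arr[OF sf]] by simp
  then have "h = 0"
    using iso_cancel_left[OF sf T(3)] arr_zero z shift_in[OF tri_ob(1)[OF t]] by blast
  then have "h \<cdot> idm C z = 0" using comp_zero_left[OF arr_id[OF z]] by simp
  then obtain q where q: "arr q z y" "g \<cdot> q = idm C z" using tri_lift'[OF t arr_id[OF z]] by blast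
  then have "idm C z = 0" using g0 comp_zero_left[OF q(1)] by simp
  then show ?thesis using zero_iff z by blast
qed

lemma iso_of_cone_zero:
  assumes t: "tri C x y z f g h" and z: "is_zero C z" shows "iso f x y"
proof -
  note T = tri_arr[OF t] and ob = tri_ob[OF t]
  have g0: "g = 0" and h0: "h = 0" using zero_arr z T by blast+
  have "g \<cdot> idm C y = 0" using g0 comp_zero_left[OF arr_id[OF ob(2)]] by simp
  then obtain r where r: "arr r y x" "f \<cdot> r = idm C y" using tri_lift[OF t arr_id[OF ob(2)]] by blast
  have sx: "\<Sigma> x \<in> Ob C" using shift_in ob by blast
  have "idm C (\<Sigma> x) \<cdot> h = 0" using h0 comp_zero_right[OF arr_id[OF sx]] by simp
  then obtain q where q: "arr q (\<Sigma> y) (\<Sigma> x)" "q \<cdot> \<Sigma>\<^sub>m x y f = idm C (\<Sigma> x)"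
    using tri_extend''[OF t arr_id[OF sx]] by blast
  obtain l where l: "arr l y x" "\<Sigma>\<^sub>m y x l = q" using shift_full[OF q(1)] ob by blast
  have "\<Sigma>\<^sub>m x x (l \<cdot> f) = \<Sigma>\<^sub>m x x (idm C x)" using q l shift_comp[OF T(1) l(1)] shift_id[OF ob(1)] by simp
  then have "l \<cdot> f = idm C x" using shift_faithful[OF arr_comp[OF T(1) l(1)] arr_id[OF ob(1)]] by blast
  then show ?thesis using iso_of_two_sided[OF T(1) l(1) _ r] by blast
qed

lemma perp_middle_right:
  assumes t: "tri C x y z f g h" and "d \<bottom> x" "d \<bottom> z" shows "d \<bottom> y"
  unfolding perp_def
proof (intro allI impI)
  fix p assume p: "arr p d y"
  have "g \<cdot> p = 0" using perpD[OF assms(3)] arr_comp p tri_arr(2)[OF t] by blast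
  then obtain q where q: "arr q d x" "f \<cdot> q = p" using tri_lift[OF t p] by blast
  then show "p = 0" using perpD[OF assms(2) q(1)] comp_zero_right[OF tri_arr(1)[OF t]] by simp
qed

lemma perp_middle_left:
  assumes t: "tri C x y z f g h" and "x \<bottom> d" "z \<bottom> d" shows "y \<bottom> d"
  unfolding perp_def
proof (intro allI impI)
  fix p assume p: "arr p y d"
  have "p \<cdot> f = 0" using perpD[OF assms(2)] arr_comp p tri_arr(1)[OF t] by blast
  then obtain q where q: "arr q z d" "q \<cdot> g = p" using tri_extend[OF t p] by blast
  then show "p = 0" using perpD[OF assms(3) q(1)] comp_zero_left[OF tri_arr(2)[OF t]] by simp
qed

lemma perp_cone_right: "\<lbrakk>tri C x y z f g h; d \<bottom> y; d \<bottom> \<Sigma> x\<rbrakk> \<Longrightarrow> d \<bottom> z"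
  using perp_middle_right[OF rotate] by blast

text \<open>
  The suspension is full, so the third morphism of any triangle that ends in a suspension is of
  the form required for a rotation backwards.
\<close>

lemma rotate_back_full:
  assumes t: "tri C y z (\<Sigma> x) g h k" and x: "x \<in> Ob C"
  shows "\<exists>f. arr f x y \<and> k = - \<Sigma>\<^sub>m x y f \<and> tri C x y z f g h"
proof -
  obtain e where e: "arr e x y" "\<Sigma>\<^sub>m x y e = k"
    using shift_full[OF tri_arr(3)[OF t] x tri_ob(1)[OF t]] by blast
  have "k = - \<Sigma>\<^sub>m x y (- e)" using e shift_minus by simp
  then show ?thesis using rotate_back t arr_minus[OF e(1)] by metis
qed

lemma cocone_exists:
  assumes f: "arr f x y" shows "\<exists>w e h. tri C w x y e f h"
proof -
  obtain z g h where t: "tri C x y z f g h" using cone_exists f by blast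
  have z: "z \<in> Ob C" using tri_ob t by blast
  obtain c where c: "iso c z (\<Sigma> (unshift C z))"
    using iso_ob_sym[OF shift_unshift[OF z]] iso_ob_def by blast
  obtain h' where "tri C x y (\<Sigma> (unshift C z)) f (c \<cdot> g) h'" using tri_replace_third[OF t c] by blast
  then show ?thesis using rotate_back_full unshift_in[OF z] by blast
qed

text \<open>
  Three rotations negate all three morphisms. The isomorphism \<open>- id\<close> at the middle object removes
  two of the signs.
\<close>

lemma shift_triangle:
  assumes t: "tri C x y z f g h"
  shows "tri C (\<Sigma> x) (\<Sigma> y) (\<Sigma> z) (\<Sigma>\<^sub>m x y f) (\<Sigma>\<^sub>m y z g) (- \<Sigma>\<^sub>m z (\<Sigma> x) h)"
proof -
  note T = tri_arr[OF t] and ob = tri_ob[OF t]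
  note S = shift_in[OF ob(1)] shift_in[OF ob(2)] shift_in[OF ob(3)]
  note A = shift_arr[OF T(1)] shift_arr[OF T(2)] shift_arr[OF T(3)]
  have m: "iso (- idm C (\<Sigma> y)) (\<Sigma> y) (\<Sigma> y)"
    unfolding iso_iff using arr_minus[OF arr_id[OF S(2)]] arr_id[OF S(2)]
      comp_minus_left[OF arr_minus[OF arr_id[OF S(2)]] arr_id[OF S(2)]] comp_minus_right[OF arr_id[OF S(2)] arr_id[OF S(2)]]
      comp_id_left[OF arr_id[OF S(2)]] by force
  show ?thesis
    by (rule tri_cong[OF rotate[OF rotate[OF rotate[OF t]]] iso_idm[OF S(1)] m iso_idm[OF S(3)]])
      (use A comp_minus_left[OF arr_minus[OF A(1)] arr_id[OF S(2)]] comp_minus_right[OF arr_id[OF S(2)] A(2)]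
         comp_id_left[OF arr_minus[OF A(2)]] arr_minus[OF A(3)] comp_id_left[OF arr_minus[OF A(3)]]
         comp_id_left[OF arr_minus[OF A(1)]] comp_id_right[OF A(1)] comp_id_right[OF A(2)] comp_id_right[OF arr_minus[OF A(3)]]
         shift_id[OF S(1)] in auto)
qed

lemma unshift_triangle:
  assumes t: "tri C (\<Sigma> x) (\<Sigma> y) (\<Sigma> z) F G H" and ob: "x \<in> Ob C" "y \<in> Ob C" "z \<in> Ob C"
  shows "\<exists>f g h. tri C x y z f g h \<and> \<Sigma>\<^sub>m x y f = F \<and> \<Sigma>\<^sub>m y z g = G"
proof -
  obtain f where f: "arr f x y" "\<Sigma>\<^sub>m x y f = F" using shift_full[OF tri_arr(1)[OF t] ob(1,2)] by blast
  obtain c g h where c: "tri C x y c f g h" using cone_exists f by blast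
  have cob: "c \<in> Ob C" using tri_ob c by blast
  obtain e where e: "iso e (\<Sigma> c) (\<Sigma> z)" "e \<cdot> \<Sigma>\<^sub>m y c g = G"
    using cone_unique[OF shift_triangle[OF c]] t f by blast
  obtain e' where e': "arr e' c z" "\<Sigma>\<^sub>m c z e' = e" using shift_full[OF iso_arr[OF e(1)] cob ob(3)] by blast
  have "iso e' c z" using shift_iso_reflect e e' by blast
  then obtain h' where "tri C x y z f (e' \<cdot> g) h'" using tri_replace_third[OF c] by blast
  moreover have "\<Sigma>\<^sub>m y z (e' \<cdot> g) = G" using shift_comp[OF tri_arr(2)[OF c] e'(1)] e e' by simp
  ultimately show ?thesis using f by blast
qed

section \<open>Triangles on objects\<close>

text \<open>
  Only the existence of a triangle on given objects matters for extension closures. In this form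
  triangles can be moved freely along isomorphisms of objects.
\<close>

definition triangle :: "'o \<Rightarrow> 'o \<Rightarrow> 'o \<Rightarrow> bool" where
  "triangle x y z \<longleftrightarrow> (\<exists>f g h. tri C x y z f g h)"

lemma triangle_ob: "triangle x y z \<Longrightarrow> x \<in> Ob C" "triangle x y z \<Longrightarrow> y \<in> Ob C"
  "triangle x y z \<Longrightarrow> z \<in> Ob C"
  unfolding triangle_def using tri_ob by blast+

lemma triangle_cong:
  assumes "triangle x y z" "x \<cong> x'" "y \<cong> y'" "z \<cong> z'" shows "triangle x' y' z'"
  using assms tri_replace_first tri_replace_second tri_replace_third iso_ob_sym
  unfolding triangle_def iso_ob_def by metis

lemma triangle_rotate: "triangle x y z \<Longrightarrow> triangle y z (\<Sigma> x)"
  unfolding triangle_def using rotate by blast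

lemma triangle_rotate_back: "\<lbrakk>triangle y z (\<Sigma> x); x \<in> Ob C\<rbrakk> \<Longrightarrow> triangle x y z"
  unfolding triangle_def using rotate_back_full by blast

lemma triangle_shift: "triangle x y z \<Longrightarrow> triangle (\<Sigma> x) (\<Sigma> y) (\<Sigma> z)"
  unfolding triangle_def using shift_triangle by blast

lemma triangle_unshift:
  "\<lbrakk>triangle (\<Sigma> x) (\<Sigma> y) (\<Sigma> z); x \<in> Ob C; y \<in> Ob C; z \<in> Ob C\<rbrakk> \<Longrightarrow> triangle x y z"
  unfolding triangle_def using unshift_triangle by blast

lemma triangle_funpow_shift: "triangle x y z \<Longrightarrow> triangle ((\<Sigma> ^^ n) x) ((\<Sigma> ^^ n) y) ((\<Sigma> ^^ n) z)"
  by (induction n) (auto intro: triangle_shift)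

lemma triangle_funpow_unshift:
  "\<lbrakk>triangle ((\<Sigma> ^^ n) x) ((\<Sigma> ^^ n) y) ((\<Sigma> ^^ n) z); x \<in> Ob C; y \<in> Ob C; z \<in> Ob C\<rbrakk>
    \<Longrightarrow> triangle x y z"
  by (induction n) (auto dest: triangle_unshift intro: funpow_shift_in)

lemma triangle_zero_first: "\<lbrakk>triangle x y z; is_zero C x\<rbrakk> \<Longrightarrow> y \<cong> z"
proof -
  assume "triangle x y z" "is_zero C x"
  then obtain f g h where "tri C y z (\<Sigma> x) f g h" "is_zero C (\<Sigma> x)"
    using triangle_rotate shift_zero_ob zero_ob unfolding triangle_def by metis
  then show ?thesis using iso_of_cone_zero iso_ob_def by blast
qed

lemma triangle_zero_third: "\<lbrakk>triangle x y z; is_zero C z\<rbrakk> \<Longrightarrow> x \<cong> y"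
  unfolding triangle_def using iso_of_cone_zero iso_ob_def by blast

lemma triangle_zero_second:
  assumes "triangle x y z" "is_zero C y" shows "z \<cong> \<Sigma> x"
proof -
  obtain f g h where t: "tri C x y z f g h" using assms triangle_def by blast
  have "is_zero C (\<Sigma> y)" using assms shift_zero_ob zero_ob by blast
  then show ?thesis using iso_of_cone_zero[OF rotate[OF rotate[OF t]]] iso_ob_def by blast
qed

lemma triangle_trivial_left: "\<lbrakk>x \<cong> y; is_zero C z\<rbrakk> \<Longrightarrow> triangle x y z"
  by (meson iso_ob_in iso_ob_refl triangle_cong triangle_def tri_id zero_ob)

lemma triangle_trivial_right: "\<lbrakk>is_zero C x; y \<cong> z\<rbrakk> \<Longrightarrow> triangle x y z"
  by (meson shift_zero_ob triangle_rotate_back triangle_trivial_left zero_ob)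

text \<open>
  The identities of \<open>z\<close> and \<open>\<Sigma> x\<close> compose to zero with the connecting morphism, so the triangle
  splits. For the reversed triangle, compare the cone of the section with \<open>x\<close> by the octahedron
  over \<open>g \<sigma> = id\<close>.
\<close>

lemma split_cone:
  assumes t: "tri C x y z f g 0"
  shows "triangle z y x"
    and "\<exists>\<sigma> \<rho>. arr \<sigma> z y \<and> arr \<rho> y x \<and> g \<cdot> \<sigma> = idm C z \<and> \<rho> \<cdot> f = idm C x \<and> \<rho> \<cdot> \<sigma> = 0"
proof -
  note T = tri_arr[OF t] and ob = tri_ob[OF t]
  have "0 \<cdot> idm C z = 0" using comp_zero_left[OF arr_id[OF ob(3)]] .
  then obtain s where s: "arr s z y" "g \<cdot> s = idm C z" using tri_lift'[OF t arr_id[OF ob(3)]] by blast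
  have sx: "\<Sigma> x \<in> Ob C" using shift_in ob by blast
  have "idm C (\<Sigma> x) \<cdot> 0 = 0" using comp_zero_right[OF arr_id[OF sx]] .
  then obtain q where q: "arr q (\<Sigma> y) (\<Sigma> x)" "q \<cdot> \<Sigma>\<^sub>m x y f = idm C (\<Sigma> x)"
    using tri_extend''[OF t arr_id[OF sx]] by blast
  obtain r where r: "arr r y x" "\<Sigma>\<^sub>m y x r = q" using shift_full[OF q(1)] ob by blast
  have "\<Sigma>\<^sub>m x x (r \<cdot> f) = \<Sigma>\<^sub>m x x (idm C x)" using q r shift_comp[OF T(1) r(1)] shift_id[OF ob(1)] by simp
  then have rf: "r \<cdot> f = idm C x" using shift_faithful[OF arr_comp[OF T(1) r(1)] arr_id[OF ob(1)]] by blast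
  have rs: "arr (r \<cdot> s) z x" using arr_comp s r by blast
  have frs: "arr (f \<cdot> (r \<cdot> s)) z y" using arr_comp[OF rs T(1)] .
  \<comment> \<open>Correct the section so that the retraction kills it.\<close>
  let ?s = "s - f \<cdot> (r \<cdot> s)"
  have s': "arr ?s z y" using arr_diff[OF s(1) frs] .
  have "g \<cdot> (f \<cdot> (r \<cdot> s)) = 0"
    using comp_assoc[OF rs T(1,2)] tri_comp_zero[OF t] comp_zero_left[OF rs] by simp
  then have gs: "g \<cdot> ?s = idm C z" using comp_diff_right[OF s(1) frs T(2)] s(2) by simp
  have "r \<cdot> (f \<cdot> (r \<cdot> s)) = r \<cdot> s" using comp_assoc[OF rs T(1) r(1)] rf comp_id_left[OF rs] by simp
  then have "r \<cdot> ?s = 0" using comp_diff_right[OF s(1) frs r(1)] by simp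
  then show "\<exists>\<sigma> \<rho>. arr \<sigma> z y \<and> arr \<rho> y x \<and> g \<cdot> \<sigma> = idm C z \<and> \<rho> \<cdot> f = idm C x \<and> \<rho> \<cdot> \<sigma> = 0"
    using s' gs r rf by blast
  obtain c k k' where c: "tri C z y c s k k'" using cone_exists s by blast
  obtain o' where o': "is_zero C o'" using zero_exists by blast
  have "tri C z z o' (g \<cdot> s) 0 0" using tri_id[OF ob(3) o'] s by simp
  from octahedral[OF c rotate[OF t] this] have "triangle c o' (\<Sigma> x)" unfolding triangle_def by blast
  then have "\<Sigma> c \<cong> \<Sigma> x" using triangle_zero_second o' iso_ob_sym by blast
  then have "c \<cong> x" using shift_iso_ob_reflect tri_ob(3)[OF c] ob by blast
  then show "triangle z y x" using c triangle_cong iso_ob_refl ob unfolding triangle_def by metis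
qed

lemma split_triangle_exists:
  assumes "x \<in> Ob C" "z \<in> Ob C" shows "\<exists>y f g. tri C x y z f g 0"
proof -
  obtain w e h where t: "tri C w z (\<Sigma> x) e 0 h"
    using cocone_exists arr_zero assms shift_in by metis
  then show ?thesis using rotate_back_full assms by metis
qed

lemma tri_first_zero_retract:
  assumes t: "tri C x y z 0 g h" shows "retract C y z"
proof -
  have ob: "y \<in> Ob C" "z \<in> Ob C" using tri_ob t by auto
  have "idm C y \<cdot> 0 = 0" using comp_zero_right[OF arr_id[OF ob(1)]] .
  then obtain q where "arr q z y" "q \<cdot> g = idm C y" using tri_extend[OF t arr_id[OF ob(1)]] by blast
  then show ?thesis using tri_in[OF t] unfolding retract_def arr_def by blast
qed

lemma octahedral_cones:
  assumes "tri C x y z' f i i'" "tri C x z y' (g \<cdot> f) k k'" "arr g y z" "tri C y z x' g j j'"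
  shows "\<exists>u v w. tri C z' y' x' u v w \<and> u \<cdot> i = k \<cdot> g \<and> k' \<cdot> u = i' \<and> v \<cdot> k = j \<and>
    j' \<cdot> v = \<Sigma>\<^sub>m x y f \<cdot> k'"
  using octahedral[OF assms(1,4,2)] by blast

text \<open>
  Dividing \<open>d\<close> first by \<open>f\<close> and then by the image of \<open>s\<close> gives the same as dividing first by \<open>s\<close>
  and then by the image of \<open>f\<close>.
\<close>

lemma octahedral_quotient:
  assumes s: "tri C s d d' i q \<delta>" and c: "tri C x d c f p \<gamma>" and c': "tri C x d' c' (q \<cdot> f) k k'"
  shows "\<exists>u v. tri C s c c' (p \<cdot> i) u v"
proof -
  obtain u v where t: "tri C c c' (\<Sigma> s) u v (\<Sigma>\<^sub>m d c p \<cdot> (- \<Sigma>\<^sub>m s d i))"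
    using octahedral[OF c rotate[OF s] c'] by blast
  note a = tri_arr(1)[OF s] tri_arr(2)[OF c]
  have "\<Sigma>\<^sub>m d c p \<cdot> (- \<Sigma>\<^sub>m s d i) = - \<Sigma>\<^sub>m s c (p \<cdot> i)"
    using comp_minus_right[OF shift_arr[OF a(1)] shift_arr[OF a(2)]] shift_comp[OF a] by simp
  then show ?thesis using rotate_back t arr_comp[OF a] by metis
qed

text \<open>
  This lemma and the next are associativity of the operation \<open>*\<close> on subcategories.
\<close>

lemma triangle_assoc_left:
  assumes "triangle x a a'" "triangle a d b"
  shows "\<exists>d'. triangle x d d' \<and> triangle a' d' b"
proof -
  obtain f g h f' g' h' where t: "tri C x a a' f g h" "tri C a d b f' g' h'"
    using assms unfolding triangle_def by blast
  obtain d' k k' where c: "tri C x d d' (f' \<cdot> f) k k'" using cone_exists arr_comp tri_arr(1) t by metis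
  show ?thesis using octahedral_cones[OF t(1) c tri_arr(1)[OF t(2)] t(2)] c unfolding triangle_def by blast
qed

lemma triangle_assoc_right:
  assumes "triangle a d b" "triangle x b b'"
  shows "\<exists>d'. triangle a d' x \<and> triangle d' d b'"
proof -
  obtain f g h f' g' h' where t: "tri C a d b f g h" "tri C x b b' f' g' h'"
    using assms unfolding triangle_def by blast
  have gg: "arr (g' \<cdot> g) d b'" using arr_comp tri_arr(2) t by blast
  obtain d' e k where c: "tri C d' d b' e (g' \<cdot> g) k" using cocone_exists[OF gg] by blast
  have "triangle (\<Sigma> a) (\<Sigma> d') (\<Sigma> x)"
    using octahedral_cones[OF rotate[OF t(1)] rotate[OF c] tri_arr(2)[OF t(2)] rotate[OF t(2)]]
    unfolding triangle_def by blast
  then have "triangle a d' x" using triangle_unshift tri_ob t c by blast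
  then show ?thesis using c unfolding triangle_def by blast
qed

lemma retract_shift:
  assumes "retract C a m" shows "retract C (\<Sigma> a) (\<Sigma> m)"
proof -
  obtain i p where i: "arr i a m" "arr p m a" "p \<cdot> i = idm C a"
    using assms unfolding retract_def arr_def by blast
  have "\<Sigma>\<^sub>m m a p \<cdot> \<Sigma>\<^sub>m a m i = idm C (\<Sigma> a)" using i shift_comp[OF i(1,2)] shift_id arr_ob by metis
  then show ?thesis using shift_arr[OF i(1)] shift_arr[OF i(2)] unfolding retract_def arr_def by blast
qed

text \<open>
  The section and the retraction induce morphisms between the cones. Their composite on \<open>a'\<close> is
  compatible with the identities of \<open>s\<close> and \<open>a\<close>, hence it is invertible, though it need not be the
  identity.
\<close>

lemma cone_retract:
  assumes u: "tri C s a a' u b c" and v: "tri C s m m' (\<iota> \<cdot> u) g h"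
    and r: "arr \<iota> a m" "arr \<pi> m a" "\<pi> \<cdot> \<iota> = idm C a"
  shows "retract C a' m'"
proof -
  note U = tri_arr[OF u] and V = tri_arr[OF v]
  have s: "s \<in> Ob C" "a \<in> Ob C" using tri_ob u by auto
  note ids = arr_id[OF s(1)]
  have e: "\<pi> \<cdot> (\<iota> \<cdot> u) = u" using comp_assoc[OF U(1) r(1,2)] r(3) comp_id_left[OF U(1)] by simp
  obtain \<alpha> where \<alpha>: "arr \<alpha> a' m'" "\<alpha> \<cdot> b = g \<cdot> \<iota>" "\<Sigma>\<^sub>m s s (idm C s) \<cdot> c = h \<cdot> \<alpha>"
    using morphism_exists[OF u v ids r(1)] comp_id_right[OF V(1)] by auto
  obtain \<beta> where \<beta>: "arr \<beta> m' a'" "\<beta> \<cdot> g = b \<cdot> \<pi>" "\<Sigma>\<^sub>m s s (idm C s) \<cdot> h = c \<cdot> \<beta>"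
    using morphism_exists[OF v u ids r(2)] comp_id_right[OF U(1)] e by auto
  have c: "h \<cdot> \<alpha> = c" "c \<cdot> \<beta> = h"
    using \<alpha>(3) \<beta>(3) shift_id[OF s(1)] comp_id_left[OF U(3)] comp_id_left[OF V(3)] by auto
  have "iso (\<beta> \<cdot> \<alpha>) a' a'"
  proof (rule tri_endo_iso[OF u])
    show "arr (\<beta> \<cdot> \<alpha>) a' a'" using arr_comp \<alpha> \<beta> by blast
    have "(\<beta> \<cdot> \<alpha>) \<cdot> b = (\<beta> \<cdot> g) \<cdot> \<iota>"
      using comp_assoc[OF U(2) \<alpha>(1) \<beta>(1)] comp_assoc[OF r(1) V(2) \<beta>(1)] \<alpha>(2) by simp
    also have "\<dots> = b" using \<beta>(2) comp_assoc[OF r(1,2) U(2)] r(3) comp_id_right[OF U(2)] by simp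
    finally show "(\<beta> \<cdot> \<alpha>) \<cdot> b = b" .
    show "c \<cdot> (\<beta> \<cdot> \<alpha>) = c" using comp_assoc[OF \<alpha>(1) \<beta>(1) U(3)] c by simp
  qed
  then obtain e where e: "arr e a' a'" "e \<cdot> (\<beta> \<cdot> \<alpha>) = idm C a'" unfolding iso_iff by blast
  then have "(e \<cdot> \<beta>) \<cdot> \<alpha> = idm C a'" using comp_assoc[OF \<alpha>(1) \<beta>(1) e(1)] by simp
  then show ?thesis using arr_comp[OF \<beta>(1) e(1)] \<alpha>(1) unfolding retract_def arr_def by blast
qed

section \<open>Filtrations by shifts of an orthogonal collection\<close>

text \<open>
  What \<open>w\<close>-orthogonality provides apart from dimensions: a Schur lemma for the members of \<open>X\<close>, and
  the vanishing of morphisms from their positive shifts up to \<open>w - 1\<close>.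
\<close>

definition orthogonal :: "nat \<Rightarrow> 'o set \<Rightarrow> bool" where
  "orthogonal w X \<longleftrightarrow> strict_subcat C X \<and> (\<forall>x \<in> X. idm C x \<noteq> 0) \<and>
    (\<forall>x \<in> X. \<forall>y \<in> X. \<forall>f. arr f x y \<and> f \<noteq> 0 \<longrightarrow> iso f x y) \<and>
    (\<forall>x \<in> X. \<forall>y \<in> X. \<forall>k. 1 \<le> k \<and> k < w \<longrightarrow> (\<Sigma> ^^ k) x \<bottom> y)"

text \<open>
  \<open>filtered X k n d\<close> builds \<open>d\<close> from \<open>n\<close> members of \<open>X, \<Sigma>\<^sup>-\<^sup>1 X, \<dots>, \<Sigma>\<^sup>1\<^sup>-\<^sup>k X\<close> in this order, the
  unshifted ones coming first; that is, \<open>d\<close> lies in \<open>\<langle>X\<rangle> * \<Sigma>\<^sup>-\<^sup>1\<langle>X\<rangle> * \<dots> * \<Sigma>\<^sup>1\<^sup>-\<^sup>k\<langle>X\<rangle>\<close>. Shifts of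
  \<open>d\<close> replace negative shifts of the factors, so that only the suspension itself occurs.

  The first morphism of each step has to be nonzero. Otherwise a filtration could contain
  superfluous factors when \<open>w = 1\<close>: if \<open>\<Sigma> x\<close> lies in \<open>\<langle>X\<rangle>\<close>, then \<open>x \<rightarrow> d \<rightarrow> d \<oplus> \<Sigma> x\<close> would count \<open>x\<close>
  once and \<open>\<Sigma> x\<close> again. Arguments by minimal length and by additivity of length depend on this.
\<close>

inductive filtered :: "'o set \<Rightarrow> nat \<Rightarrow> nat \<Rightarrow> 'o \<Rightarrow> bool" for X where
  zero: "is_zero C d \<Longrightarrow> filtered X k 0 d"
| step: "\<lbrakk>x \<in> X; tri C x d d' f g h; f \<noteq> 0; filtered X (Suc k) n d'\<rbrakk>
    \<Longrightarrow> filtered X (Suc k) (Suc n) d"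
| shift: "\<lbrakk>d \<in> Ob C; filtered X k n (\<Sigma> d)\<rbrakk> \<Longrightarrow> filtered X (Suc k) n d"

definition layers :: "'o set \<Rightarrow> nat \<Rightarrow> 'o set" where
  "layers X k = {d. \<exists>n. filtered X k n d}"

text \<open>
  For an orthogonal \<open>X\<close> one layer is the extension closure of \<open>X\<close>, see \<open>ext_closure_eq_layers\<close>
  below.
\<close>

abbreviation hull :: "'o set \<Rightarrow> 'o set" ("\<langle>_\<rangle>") where
  "\<langle>X\<rangle> \<equiv> layers X (Suc 0)"

lemma layersI: "filtered X k n d \<Longrightarrow> d \<in> layers X k"
  by (auto simp: layers_def)

lemma filtered_ob: "filtered X k n d \<Longrightarrow> d \<in> Ob C"
  by (induction rule: filtered.induct) (auto intro: zero_ob tri_ob)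

lemma filtered_mono: "\<lbrakk>filtered X k n d; X \<subseteq> Y\<rbrakk> \<Longrightarrow> filtered Y k n d"
  by (induction rule: filtered.induct) (auto intro: filtered.intros)

lemma filtered_Suc: "filtered X k n d \<Longrightarrow> filtered X (Suc k) n d"
  by (induction rule: filtered.induct) (auto intro: filtered.intros)

lemma filtered_le: "\<lbrakk>filtered X k n d; k \<le> k'\<rbrakk> \<Longrightarrow> filtered X k' n d"
  by (induction k') (auto simp: le_Suc_eq intro: filtered_Suc)

lemma filtered_no_layers: "filtered X 0 n d \<Longrightarrow> n = 0 \<and> is_zero C d"
  by (auto elim: filtered.cases)

lemma filtered_length_zero: "filtered X k 0 d \<Longrightarrow> is_zero C d"
proof (induction k arbitrary: d)
  case (Suc k)
  from Suc.prems show ?case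
    by (cases rule: filtered.cases) (auto dest: Suc.IH simp: shift_zero_ob)
qed (auto dest: filtered_no_layers)

lemma filtered_iso: "\<lbrakk>filtered X k n d; d \<cong> e\<rbrakk> \<Longrightarrow> filtered X k n e"
proof (induction arbitrary: e rule: filtered.induct)
  case (zero d k) then show ?case using zero_iso filtered.zero by blast
next
  case (step x d d' f g h k n)
  obtain b where b: "iso b d e" using step.prems iso_ob_def by blast
  obtain g' where t: "tri C x e d' (b \<cdot> f) g' h" using tri_replace_second[OF step.hyps(2) b] by blast
  note f = tri_arr(1)[OF step.hyps(2)]
  have "b \<cdot> f \<noteq> 0"
    using iso_cancel_left[OF b f arr_zero[OF arr_ob[OF f]]] comp_zero_right[OF iso_arr[OF b]] step.hyps(3)
    by auto
  then show ?case using filtered.step[OF step.hyps(1) t] step.hyps(4) by blast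
next
  case (shift d k n) then show ?case using shift_iso_ob iso_ob_in filtered.shift by meson
qed

lemma filtered_funpow: "\<lbrakk>filtered X k n ((\<Sigma> ^^ j) d); d \<in> Ob C\<rbrakk> \<Longrightarrow> filtered X (j + k) n d"
proof (induction j arbitrary: d)
  case (Suc j)
  have "filtered X (j + k) n (\<Sigma> d)" using Suc.IH[of "\<Sigma> d"] Suc.prems shift_in by (simp add: funpow_swap1)
  then show ?case using filtered.shift[OF Suc.prems(2)] by simp
qed simp

lemma orthogonal_ob: "\<lbrakk>orthogonal w X; x \<in> X\<rbrakk> \<Longrightarrow> x \<in> Ob C"
  by (auto simp: orthogonal_def strict_subcat_def)

lemma orthogonal_iso_closed: "\<lbrakk>orthogonal w X; x \<in> X; x \<cong> y\<rbrakk> \<Longrightarrow> y \<in> X"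
  using isomorphic_iff iso_ob_in by (fastforce simp: orthogonal_def strict_subcat_def)

lemma orthogonal_iso: "\<lbrakk>orthogonal w X; x \<in> X; y \<in> X; arr f x y; f \<noteq> 0\<rbrakk> \<Longrightarrow> iso f x y"
  by (auto simp: orthogonal_def)

lemma orthogonal_perp: "\<lbrakk>orthogonal w X; x \<in> X; y \<in> X; 1 \<le> k; k < w\<rbrakk> \<Longrightarrow> (\<Sigma> ^^ k) x \<bottom> y"
  by (auto simp: orthogonal_def)

lemma filtered_object:
  assumes "orthogonal w X" "x \<in> X" shows "filtered X (Suc k) 1 x"
proof -
  obtain o' where o': "is_zero C o'" using zero_exists by blast
  have "tri C x x o' (idm C x) 0 0" using tri_id[OF orthogonal_ob[OF assms] o'] .
  then show ?thesis
    using filtered.step[OF assms(2), of x o' "idm C x" 0 0 k 0] filtered.zero[OF o'] assms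
    by (auto simp: orthogonal_def)
qed

text \<open>
  The factors of \<open>d\<close> are \<open>\<Sigma>\<^sup>-\<^sup>i x'\<close> with \<open>i < k\<close>, and \<open>Hom(\<Sigma>\<^sup>j x, \<Sigma>\<^sup>-\<^sup>i x') = Hom(\<Sigma>\<^sup>i\<^sup>+\<^sup>j x, x')\<close>
  with \<open>1 \<le> i + j < w\<close>.
\<close>

lemma shift_perp_filtered:
  assumes "filtered X k n d" "orthogonal w X" "x \<in> X" "1 \<le> j" "j + k \<le> w"
  shows "(\<Sigma> ^^ j) x \<bottom> d"
  using assms
proof (induction arbitrary: j rule: filtered.induct)
  case (zero d k) then show ?case using zero_perp funpow_shift_in orthogonal_ob by blast
next
  case (step x' d d' f g h k n)
  have "(\<Sigma> ^^ j) x \<bottom> x'" using orthogonal_perp step.prems step.hyps(1) by simp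
  then show ?case using perp_middle_right[OF step.hyps(2)] step.IH step.prems by blast
next
  case (shift d k n)
  have "(\<Sigma> ^^ Suc j) x \<bottom> \<Sigma> d" using shift.IH[of "Suc j"] shift.prems by simp
  then show ?case using shift_perp shift.hyps(1) funpow_shift_in orthogonal_ob shift.prems(1,2) by simp
qed

text \<open>
  The members of \<open>X\<close> behave like simple objects: a nonzero morphism from one of them is a
  subobject, and dividing by it removes one factor. Let \<open>s\<close> be the first factor of \<open>d\<close>. If \<open>f\<close>
  factors through \<open>s\<close>, then \<open>x \<cong> s\<close> by the Schur lemma and the cone is \<open>d'\<close>. Otherwise \<open>f\<close> stays
  nonzero in \<open>d'\<close> and induction applies there. Morphisms to the shifted layers vanish.
\<close>

lemma filtered_cone:
  assumes "filtered X k n d" "orthogonal w X" "k \<le> w" "x \<in> X" "tri C x d c f p \<gamma>" "f \<noteq> 0"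
  shows "\<exists>m. n = Suc m \<and> filtered X k m c"
  using assms
proof (induction arbitrary: x c f p \<gamma> rule: filtered.induct)
  case (zero d k) then show ?case using zero_arr(1) tri_arr(1) by blast
next
  case (step s d d' i q \<delta> k n)
  note t = step.hyps(2) and t' = step.prems(4)
  note T = tri_arr[OF t] and T' = tri_arr[OF t']
  show ?case
  proof (cases "q \<cdot> f = 0")
    case True
    then obtain u where u: "arr u x s" "i \<cdot> u = f" using tri_lift[OF t T'(1)] by blast
    have "u \<noteq> 0" using u step.prems(5) comp_zero_right[OF T(1)] by auto
    then have iu: "iso u x s" using orthogonal_iso u step.prems(1,3) step.hyps(1) by blast
    obtain h' where "tri C x d d' f q h'" using tri_replace_first[OF t iu] u by auto
    then have "d' \<cong> c" using cone_unique t' iso_ob_def by blast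
    then show ?thesis using filtered_iso step.hyps(4) by blast
  next
    case False
    obtain c' k1 k' where c': "tri C x d' c' (q \<cdot> f) k1 k'"
      using cone_exists arr_comp[OF T'(1) T(2)] by blast
    obtain m where m: "n = Suc m" "filtered X (Suc k) m c'"
      using step.IH[OF step.prems(1-3) c' False] by blast
    obtain u v where tc: "tri C s c c' (p \<cdot> i) u v" using octahedral_quotient[OF t t' c'] by blast
    \<comment> \<open>Otherwise \<open>i\<close> factors through \<open>f\<close> by an isomorphism \<open>e: s \<rightarrow> x\<close>, and then \<open>q i = 0\<close> forces \<open>q f = 0\<close>.\<close>
    have "p \<cdot> i \<noteq> 0"
    proof
      assume "p \<cdot> i = 0"
      then obtain e where e: "arr e s x" "f \<cdot> e = i" using tri_lift[OF t' T(1)] by blast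
      have "e \<noteq> 0" using e step.hyps(3) comp_zero_right[OF T'(1)] by auto
      then have ie: "iso e s x" using orthogonal_iso e step.prems(1,3) step.hyps(1) by blast
      have "(q \<cdot> f) \<cdot> e = 0" using comp_assoc[OF e(1) T'(1) T(2)] e(2) tri_comp_zero[OF t] by simp
      then have "q \<cdot> f = 0"
        using iso_cancel_right[OF ie arr_comp[OF T'(1) T(2)] arr_zero] arr_ob[OF arr_comp[OF T'(1) T(2)]]
          comp_zero_left[OF e(1)] by simp
      then show False using False by blast
    qed
    then show ?thesis using filtered.step[OF step.hyps(1) tc] m by blast
  qed
next
  case (shift d k n)
  have "(\<Sigma> ^^ 1) x \<bottom> \<Sigma> d"
    by (rule shift_perp_filtered[OF shift.hyps(2) shift.prems(1,3)]) (use shift.prems(2) in auto)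
  then have "x \<bottom> d" using shift_perp shift.hyps(1) orthogonal_ob[OF shift.prems(1,3)] by simp
  then show ?case using perpD tri_arr(1)[OF shift.prems(4)] shift.prems(5) by blast
qed

text \<open>
  Follow the first factor \<open>s\<close> of \<open>m\<close> into \<open>a\<close>. If it dies there, then \<open>a\<close> is a retract of the
  rest. If not, then \<open>s\<close> is a factor of \<open>a\<close> and, through \<open>\<iota>\<close>, also of \<open>m\<close>, and it can be removed
  from both. This is why the closure under direct summands adds nothing.
\<close>

lemma filtered_retract:
  assumes "filtered X k n m" "orthogonal w X" "k \<le> w" "retract C a m"
  shows "\<exists>n' \<le> n. filtered X k n' a"
  using assms
proof (induction "k + n" arbitrary: k n m a rule: less_induct)
  case less
  obtain \<iota> \<pi> where r: "arr \<iota> a m" "arr \<pi> m a" "\<pi> \<cdot> \<iota> = idm C a"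
    using less.prems(4) unfolding retract_def arr_def by blast
  have a: "a \<in> Ob C" using r arr_ob by blast
  from less.prems(1) show ?case
  proof (cases rule: filtered.cases)
    case zero
    then have "\<pi> = 0" using zero_arr(2) r by blast
    then have "is_zero C a" using zero_iff a r(1,3) comp_zero_left by metis
    then show ?thesis using filtered.zero by blast
  next
    case (step s m' f g h k0 n0)
    note T = tri_arr[OF step(4)]
    show ?thesis
    proof (cases "\<pi> \<cdot> f = 0")
      case True
      then obtain \<pi>' where p: "arr \<pi>' m' a" "\<pi>' \<cdot> g = \<pi>" using tri_extend[OF step(4) r(2)] by blast
      have "\<pi>' \<cdot> (g \<cdot> \<iota>) = idm C a" using comp_assoc[OF r(1) T(2) p(1)] p(2) r(3) by simp
      then have "retract C a m'" using arr_comp[OF r(1) T(2)] p(1) unfolding retract_def arr_def by blast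
      then obtain n' where "n' \<le> n0" "filtered X k n' a"
        using less.hyps[of k n0 m' a] step less.prems by auto
      then show ?thesis using step(2) le_SucI by blast
    next
      case False
      let ?u = "\<pi> \<cdot> f"
      have u: "arr ?u s a" using arr_comp[OF T(1) r(2)] .
      have iu: "arr (\<iota> \<cdot> ?u) s m" using arr_comp[OF u r(1)] .
      have "\<pi> \<cdot> (\<iota> \<cdot> ?u) = ?u" using comp_assoc[OF u r(1,2)] r(3) comp_id_left[OF u] by simp
      then have nz: "\<iota> \<cdot> ?u \<noteq> 0" using False comp_zero_right[OF r(2)] by auto
      obtain a' b c where ta: "tri C s a a' ?u b c" using cone_exists[OF u] by blast
      obtain m1 b' c' where tm: "tri C s m m1 (\<iota> \<cdot> ?u) b' c'" using cone_exists[OF iu] by blast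
      have "filtered X k n0 m1" using filtered_cone[OF less.prems(1-3) step(3) tm nz] step by auto
      moreover have "retract C a' m1" using cone_retract[OF ta tm r] .
      ultimately obtain n' where n': "n' \<le> n0" "filtered X k n' a'"
        using less.hyps[of k n0 m1 a'] step less.prems by auto
      then have "filtered X k (Suc n') a" using filtered.step[OF step(3) ta False] step(1) by simp
      then show ?thesis using n' step by auto
    qed
  next
    case (shift k0)
    then obtain n' where "n' \<le> n" "filtered X k0 n' (\<Sigma> a)"
      using less.hyps[of k0 n "\<Sigma> m" "\<Sigma> a"] less.prems retract_shift by auto
    then show ?thesis using filtered.shift[OF a] shift by blast
  qed
qed

lemma layers_ob: "d \<in> layers X k \<Longrightarrow> d \<in> Ob C"
  by (auto simp: layers_def dest: filtered_ob)

lemma layers_zero: "is_zero C d \<Longrightarrow> d \<in> layers X k"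
  by (auto simp: layers_def intro: filtered.zero)

lemma layers_iso: "\<lbrakk>d \<in> layers X k; d \<cong> e\<rbrakk> \<Longrightarrow> e \<in> layers X k"
  by (auto simp: layers_def dest: filtered_iso)

lemma layers_retract:
  "\<lbrakk>d \<in> layers X k; orthogonal w X; k \<le> w; retract C a d\<rbrakk> \<Longrightarrow> a \<in> layers X k"
  by (auto simp: layers_def dest: filtered_retract)

lemma layers_shift: "\<lbrakk>\<Sigma> d \<in> layers X k; d \<in> Ob C\<rbrakk> \<Longrightarrow> d \<in> layers X (Suc k)"
  by (auto simp: layers_def intro: filtered.shift)

text \<open>
  If \<open>f = 0\<close>, then \<open>d\<close> is a retract of \<open>d'\<close>, so the condition \<open>f \<noteq> 0\<close> in the definition of
  filtrations does not shrink the class.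
\<close>

lemma layers_step:
  assumes "orthogonal w X" "Suc k \<le> w" "x \<in> X" "triangle x d d'" "d' \<in> layers X (Suc k)"
  shows "d \<in> layers X (Suc k)"
proof -
  obtain f g h where t: "tri C x d d' f g h" using assms triangle_def by blast
  show ?thesis
  proof (cases "f = 0")
    case True
    then have "retract C d d'" using tri_first_zero_retract t by blast
    then show ?thesis using layers_retract assms by blast
  next
    case False
    then show ?thesis using filtered.step[OF assms(3) t] assms(5) by (auto simp: layers_def)
  qed
qed

text \<open>
  Restoring the order of the factors when \<open>x\<close> is appended to the right of \<open>\<Sigma>\<^sup>-\<^sup>1 b\<close>: the
  connecting morphism \<open>x \<rightarrow> b\<close> is either zero, and the two factors commute, or nonzero, and then
  \<open>d\<close> is the desuspension of its cone, which is again filtered by \<open>filtered_cone\<close>.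
\<close>

lemma layers_snoc:
  assumes "filtered X (Suc k) n a" "orthogonal w X" "Suc k \<le> w" "x \<in> X" "triangle a d x"
  shows "d \<in> layers X (Suc k)"
  using assms
proof (induction n arbitrary: a d rule: less_induct)
  case (less n)
  from less.prems(1) show ?case
  proof (cases rule: filtered.cases)
    case zero
    then have "x \<cong> d" using triangle_zero_first less.prems(5) iso_ob_sym by blast
    then show ?thesis using filtered_object[OF less.prems(2,4)] filtered_iso unfolding layers_def by blast
  next
    case (step s a' f g h n0)
    obtain d' where d': "triangle s d d'" "triangle a' d' x"
      using triangle_assoc_left less.prems(5) step(3) triangle_def by metis
    then have "d' \<in> layers X (Suc k)" using less.IH[of n0 a' d'] step less.prems by auto
    then show ?thesis using layers_step less.prems step(2) d'(1) by blast
  next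
    case shift
    obtain f g h where t: "tri C a d x f g h" using less.prems(5) triangle_def by blast
    show ?thesis
    proof (cases "h = 0")
      case True
      then have "triangle x d a" using split_cone(1) t by blast
      then show ?thesis using layers_step[OF less.prems(2,3,4) _ layersI[OF less.prems(1)]] by blast
    next
      case False
      then obtain m where "filtered X k m (\<Sigma> d)"
        using filtered_cone[OF shift(2) less.prems(2) _ less.prems(4) rotate[OF rotate[OF t]] False]
          Suc_leD[OF less.prems(3)] by blast
      then show ?thesis using layersI[OF filtered.shift[OF tri_ob(2)[OF t]]] by blast
    qed
  qed
qed

lemma layers_extension:
  assumes "orthogonal w X" "k \<le> w" "a \<in> layers X k" "b \<in> layers X k" "triangle a d b"
  shows "d \<in> layers X k"
  using assms(2-)
proof (induction k arbitrary: a b d)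
  case 0
  then have "is_zero C a" "is_zero C b" by (auto simp: layers_def dest: filtered_no_layers)
  then show ?case using triangle_zero_third 0(4) zero_iso layers_zero by blast
next
  case (Suc k)
  have first: "d \<in> layers X (Suc k)"
    if "filtered X (Suc k) n a" "triangle a d b" "b \<in> layers X (Suc k)" "\<Sigma> b \<in> layers X k" for n a b d
    using that
  proof (induction n arbitrary: a d rule: less_induct)
    case (less n)
    from less.prems(1) show ?case
    proof (cases rule: filtered.cases)
      case zero
      then show ?thesis using triangle_zero_first less.prems layers_iso iso_ob_sym by blast
    next
      case (step s a' f g h n0)
      obtain d' where d': "triangle s d d'" "triangle a' d' b"
        using triangle_assoc_left less.prems(2) step(3) triangle_def by metis
      then have "d' \<in> layers X (Suc k)" using less.IH[of n0 a' d'] step less.prems by auto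
      then show ?thesis using layers_step assms(1) Suc.prems(1) step(2) d'(1) by blast
    next
      case shift
      then have "\<Sigma> d \<in> layers X k"
        using Suc.IH[of "\<Sigma> a" "\<Sigma> b" "\<Sigma> d"] Suc.prems(1) less.prems triangle_shift by (auto simp: layers_def)
      then show ?thesis using layers_shift triangle_ob(2) less.prems(2) by blast
    qed
  qed
  have "d \<in> layers X (Suc k)"
    if "filtered X (Suc k) n b" "triangle a d b" "a \<in> layers X (Suc k)" for n a b d
    using that
  proof (induction n arbitrary: a b d rule: less_induct)
    case (less n)
    from less.prems(1) show ?case
    proof (cases rule: filtered.cases)
      case zero
      then show ?thesis using triangle_zero_third less.prems layers_iso by blast
    next
      case (step s b' f g h n0)
      obtain d' where d': "triangle a d' s" "triangle d' d b'"
        using triangle_assoc_right less.prems(2) step(3) triangle_def by metis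
      then have "d' \<in> layers X (Suc k)"
        using layers_snoc assms(1) Suc.prems(1) step(2) less.prems(3) by (auto simp: layers_def)
      then show ?thesis using less.IH[of n0 b' d' d] step d' by auto
    next
      case shift
      obtain na where "filtered X (Suc k) na a" using less.prems(3) unfolding layers_def by blast
      then show ?thesis using first less.prems(1,2) shift(2) layersI by blast
    qed
  qed
  moreover obtain n where "filtered X (Suc k) n b" using Suc.prems(3) unfolding layers_def by blast
  ultimately show ?case using Suc.prems(2,4) by blast
qed

lemma layers_object: "\<lbrakk>orthogonal w X; x \<in> X\<rbrakk> \<Longrightarrow> x \<in> layers X (Suc k)"
  using filtered_object unfolding layers_def by blast

text \<open>
  A morphism that is injective on \<open>Hom(s,-)\<close> for \<open>s \<in> S\<close> is a subobject, and lengths add. Divide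
  by the first factor \<open>s\<close> of \<open>t\<close> in both \<open>t\<close> and \<open>y\<close>. The induced morphism \<open>u\<close> is again injective:
  a morphism that it kills comes from one to \<open>t\<close> which \<open>g\<close> sends into the image of \<open>s\<close>.
\<close>

lemma filtered_cone_of_injective:
  assumes "filtered S k0 a t" "k0 = Suc 0" "filtered X k b y" "orthogonal w X" "k \<le> w" "S \<subseteq> X"
    "tri C t y c g p h" "\<And>s f. \<lbrakk>s \<in> S; arr f s t; g \<cdot> f = 0\<rbrakk> \<Longrightarrow> f = 0"
  shows "a \<le> b \<and> filtered X k (b - a) c"
  using assms
proof (induction arbitrary: b y c g p h rule: filtered.induct)
  case (zero d k)
  then have "y \<cong> c" using triangle_zero_first triangle_def by blast
  then show ?case using filtered_iso zero.prems(2) by auto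
next
  case (step s t t' i q \<delta> k0 n)
  note t = step.hyps(2) and ty = step.prems(6)
  note T = tri_arr[OF t] and Y = tri_arr[OF ty]
  have gi: "arr (g \<cdot> i) s y" using arr_comp[OF T(1) Y(1)] .
  have nz: "g \<cdot> i \<noteq> 0" using step.prems(7)[OF step.hyps(1) T(1)] step.hyps(3) by blast
  obtain y' r r' where ty': "tri C s y y' (g \<cdot> i) r r'" using cone_exists[OF gi] by blast
  obtain b' where b: "b = Suc b'" "filtered X k b' y'"
    using filtered_cone[OF step.prems(2-4) _ ty' nz] step.hyps(1) step.prems(5) by blast
  obtain u v x where u: "tri C t' y' c u v x" "u \<cdot> q = r \<cdot> g" "r' \<cdot> u = \<delta>"
    using octahedral_cones[OF t ty' Y(1) ty] by blast
  note U = tri_arr[OF u(1)] and Y' = tri_arr[OF ty']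
  have "n \<le> b' \<and> filtered X k (b' - n) c"
  proof (rule step.IH[OF step.prems(1) b(2) step.prems(3-5) u(1)])
    fix s' f' assume s': "s' \<in> S" and f': "arr f' s' t'" "u \<cdot> f' = 0"
    have "\<delta> \<cdot> f' = 0" using comp_assoc[OF f'(1) U(1) Y'(3)] u(3) f'(2) comp_zero_right[OF Y'(3)] by simp
    then obtain f2 where f2: "arr f2 s' t" "q \<cdot> f2 = f'" using tri_lift'[OF t f'(1)] by blast
    have gf: "arr (g \<cdot> f2) s' y" using arr_comp[OF f2(1) Y(1)] .
    have "r \<cdot> (g \<cdot> f2) = u \<cdot> (q \<cdot> f2)"
      using comp_assoc[OF f2(1) Y(1) Y'(2)] comp_assoc[OF f2(1) T(2) U(1)] u(2) by simp
    then have "r \<cdot> (g \<cdot> f2) = 0" using f2 f' by simp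
    then obtain e where e: "arr e s' s" "(g \<cdot> i) \<cdot> e = g \<cdot> f2" using tri_lift[OF ty' gf] by blast
    have ie: "arr (i \<cdot> e) s' t" using arr_comp[OF e(1) T(1)] .
    have "g \<cdot> (f2 - i \<cdot> e) = 0"
      using comp_diff_right[OF f2(1) ie Y(1)] comp_assoc[OF e(1) T(1) Y(1)] e(2) by simp
    then have "f2 = i \<cdot> e" using step.prems(7)[OF s' arr_diff[OF f2(1) ie]] by simp
    then show "f' = 0"
      using f2(2) comp_assoc[OF e(1) T(1,2)] tri_comp_zero[OF t] comp_zero_left[OF e(1)] by simp
  qed
  then show ?case using b by simp
next
  case (shift d k0 n)
  have "filtered S 0 n (\<Sigma> d)" using shift.hyps(2) shift.prems(1) by simp
  then have "n = 0" "is_zero C d" using filtered_no_layers shift_zero_ob[OF shift.hyps(1)] by blast+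
  moreover from this have "y \<cong> c" using triangle_zero_first triangle_def shift.prems(6) by blast
  ultimately show ?case using filtered_iso shift.prems(2) by auto
qed

text \<open>
  The dual of \<open>filtered_cone\<close> for one layer: a nonzero morphism to a member of \<open>X\<close> has its cocone
  in \<open>\<langle>X\<rangle>\<close>. The proof uses the same filtration from the left.
\<close>

lemma layers_cocone:
  assumes "filtered X k0 n t" "k0 = Suc 0" "orthogonal w X" "1 \<le> w" "x \<in> X" "tri C e t x \<epsilon> f h" "f \<noteq> 0"
  shows "e \<in> layers X (Suc 0)"
  using assms
proof (induction arbitrary: e \<epsilon> f h rule: filtered.induct)
  case (zero d k) then show ?case using zero_arr(2) tri_arr(2) by blast
next
  case (step s t t' i q \<delta> k n)
  note t = step.hyps(2) and tx = step.prems(5)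
  note T = tri_arr[OF t] and X = tri_arr[OF tx]
  have e: "e \<in> Ob C" "s \<in> Ob C" "t' \<in> Ob C" using tri_ob tx t by auto
  show ?case
  proof (cases "f \<cdot> i = 0")
    case True
    then obtain f' where f': "arr f' t' x" "f' \<cdot> q = f" using tri_extend[OF t X(2)] by blast
    have nz: "f' \<noteq> 0" using f' step.prems(6) comp_zero_left[OF T(2)] by auto
    obtain e' \<epsilon>' h' where te': "tri C e' t' x \<epsilon>' f' h'" using cocone_exists[OF f'(1)] by blast
    have e': "e' \<in> layers X (Suc 0)" using step.IH[OF step.prems(1-4) te' nz] .
    have "tri C t x (\<Sigma> e) (f' \<cdot> q) h (- \<Sigma>\<^sub>m e t \<epsilon>)" using rotate[OF tx] f' by simp
    then have "triangle (\<Sigma> s) (\<Sigma> e) (\<Sigma> e')"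
      using octahedral_cones[OF rotate[OF t] _ f'(1) rotate[OF te']] unfolding triangle_def by blast
    then have "triangle s e e'" using triangle_unshift e layers_ob[OF e'] by blast
    then show ?thesis using layers_step[of w X 0] step.prems step.hyps(1) e' by auto
  next
    case False
    then have fi: "iso (f \<cdot> i) s x" using orthogonal_iso step.prems step.hyps(1) arr_comp[OF T(1) X(2)] by blast
    obtain z k1 k2 where z: "tri C s x z (f \<cdot> i) k1 k2" using cone_exists iso_arr[OF fi] by blast
    have "is_zero C z" using cone_of_iso_zero z fi by blast
    moreover have "triangle t' z (\<Sigma> e)"
      using octahedral_cones[OF t z X(2) rotate[OF tx]] unfolding triangle_def by blast
    ultimately have "\<Sigma> e \<cong> \<Sigma> t'" using triangle_zero_second by blast
    then have "t' \<cong> e" using shift_iso_ob_reflect e iso_ob_sym by blast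
    then show ?thesis using filtered_iso[OF step.hyps(4)] step.prems(1) unfolding layers_def by blast
  qed
next
  case (shift d k n)
  have "filtered X 0 n (\<Sigma> d)" using shift.hyps(2) shift.prems(1) by simp
  then have "is_zero C d" using filtered_no_layers shift_zero_ob[OF shift.hyps(1)] by blast
  then show ?case using zero_arr(2) tri_arr(2)[OF shift.prems(5)] shift.prems(6) by blast
qed

section \<open>Extension closures\<close>

lemma shift_pow_nonneg: "shift_pow C (int n) x = (\<Sigma> ^^ n) x"
  by (simp add: shift_pow_def)

lemma shift_pow_nonpos: "shift_pow C (- int n) x = (unshift C ^^ n) x"
  by (cases "n = 0") (auto simp: shift_pow_def)

lemma funpow_shift_zero_ob: "x \<in> Ob C \<Longrightarrow> is_zero C ((\<Sigma> ^^ n) x) \<longleftrightarrow> is_zero C x"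
  by (induction n) (auto simp: shift_zero_ob funpow_shift_in)

lemma ext_closed_layers:
  assumes "orthogonal w X" "k \<le> w" shows "ext_closed C (layers X k)"
proof -
  have "strict_subcat C (layers X k)"
  proof (unfold strict_subcat_def, intro conjI subsetI ballI impI)
    fix x y assume "x \<in> layers X k" "y \<in> Ob C" "isomorphic C x y"
    then show "y \<in> layers X k" using layers_iso layers_ob isomorphic_iff by meson
  qed (rule layers_ob)
  moreover have "ext_star C (layers X k) (layers X k) \<subseteq> layers X k"
  proof
    fix d assume "d \<in> ext_star C (layers X k) (layers X k)"
    then obtain a b where "a \<in> layers X k" "b \<in> layers X k" "triangle a d b"
      unfolding ext_star_def triangle_def by blast
    then show "d \<in> layers X k" using layers_extension[OF assms] by blast
  qed
  moreover have "layers X k \<subseteq> ext_star C (layers X k) (layers X k)"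
  proof
    fix d assume d: "d \<in> layers X k"
    obtain o' where o': "is_zero C o'" using zero_exists by blast
    have "tri C d d o' (idm C d) 0 0" using tri_id layers_ob[OF d] o' by blast
    then show "d \<in> ext_star C (layers X k) (layers X k)"
      using d layers_ob[OF d] layers_zero[OF o'] unfolding ext_star_def by blast
  qed
  moreover have "\<forall>z. is_zero C z \<longrightarrow> z \<in> layers X k" using layers_zero by blast
  ultimately show ?thesis unfolding ext_closed_def by (intro conjI subset_antisym)
qed

text \<open>
  Every factor of \<open>d\<close> is a desuspension of a member of \<open>X\<close>. The induction runs over all shifts \<open>j\<close>
  because each \<open>shift\<close> step of a filtration raises the suspension by one.
\<close>

lemma filtered_in_ext_closed:
  assumes "filtered X k n e" "ext_closed C Y" "e \<cong> (\<Sigma> ^^ j) d" "d \<in> Ob C"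
    "\<And>i. \<lbrakk>j \<le> i; i < j + k\<rbrakk> \<Longrightarrow> (unshift C ^^ i) ` X \<subseteq> Y"
  shows "d \<in> Y"
  using assms
proof (induction arbitrary: j d rule: filtered.induct)
  case (zero e k)
  then have "is_zero C ((\<Sigma> ^^ j) d)" using zero_iso by blast
  then show ?case using funpow_shift_zero_ob zero.prems by (auto simp: ext_closed_def)
next
  case (step x e e' f g h k n)
  let ?u = "unshift C ^^ j"
  have ob: "x \<in> Ob C" "e' \<in> Ob C" using tri_ob[OF step.hyps(2)] by auto
  have e': "?u e' \<in> Y"
    using step.IH[OF step.prems(1) iso_ob_sym[OF funpow_shift_unshift[OF ob(2)]] funpow_unshift_in[OF ob(2)]
        step.prems(4)] .
  have "?u ` X \<subseteq> Y" using step.prems(4)[of j] by simp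
  then have x: "?u x \<in> Y" using step.hyps(1) by blast
  have "triangle x e e'" using step.hyps(2) triangle_def by blast
  then have "triangle ((\<Sigma> ^^ j) (?u x)) ((\<Sigma> ^^ j) d) ((\<Sigma> ^^ j) (?u e'))"
    by (rule triangle_cong) (use iso_ob_sym funpow_shift_unshift ob step.prems(2) in blast)+
  then have "triangle (?u x) d (?u e')"
    using triangle_funpow_unshift funpow_unshift_in ob step.prems(3) by blast
  then have "d \<in> ext_star C Y Y" using x e' step.prems(3) unfolding ext_star_def triangle_def by blast
  then show ?case using step.prems(1) by (simp add: ext_closed_def)
next
  case (shift e k n)
  have "\<Sigma> e \<cong> (\<Sigma> ^^ Suc j) d" using shift_iso_ob[OF shift.prems(2)] by simp
  then show ?case
    by (rule shift.IH[OF shift.prems(1) _ shift.prems(3)]) (rule shift.prems(4), auto)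
qed

text \<open>
  The ordered filtrations already give the extension closure of all the shifts: they form an
  extension-closed class by \<open>layers_extension\<close>, and any such class contains them.
\<close>

lemma ext_closure_shifts:
  assumes X: "orthogonal w X" and k: "1 \<le> k" "k \<le> w"
  shows "ext_closure C (\<Union>j \<in> {0..k - 1}. shift_pow C (- int j) ` X) = layers X k"
proof -
  have "{0..k - 1} = {..<k}" using k by auto
  then have U: "(\<Union>j \<in> {0..k - 1}. shift_pow C (- int j) ` X) = (\<Union>j < k. (unshift C ^^ j) ` X)"
    (is "?V = ?U") by (simp add: shift_pow_nonpos)
  have "(unshift C ^^ j) x \<in> layers X k" if j: "j < k" and x: "x \<in> X" for j x
  proof -
    have xo: "x \<in> Ob C" using orthogonal_ob X x by blast
    have "filtered X (Suc 0) 1 ((\<Sigma> ^^ j) ((unshift C ^^ j) x))"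
      using filtered_iso[OF filtered_object[OF X x] iso_ob_sym[OF funpow_shift_unshift[OF xo]]] .
    then have "filtered X (j + Suc 0) 1 ((unshift C ^^ j) x)"
      using filtered_funpow funpow_unshift_in[OF xo] by blast
    then have "filtered X k 1 ((unshift C ^^ j) x)" using filtered_le j by fastforce
    then show ?thesis unfolding layers_def by blast
  qed
  then have "?U \<subseteq> layers X k" by blast
  moreover have "layers X k \<subseteq> Y" if Y: "ext_closed C Y" "?U \<subseteq> Y" for Y
  proof
    fix d assume "d \<in> layers X k"
    then obtain n where n: "filtered X k n d" unfolding layers_def by blast
    have "d \<cong> (\<Sigma> ^^ 0) d" using iso_ob_refl filtered_ob[OF n] by simp
    moreover have "(unshift C ^^ i) ` X \<subseteq> Y" if "i < 0 + k" for i
      using Y(2) that by auto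
    ultimately show "d \<in> Y" using filtered_in_ext_closed[OF n Y(1)] filtered_ob[OF n] by blast
  qed
  ultimately show ?thesis
    unfolding ext_closure_def U using ext_closed_layers[OF X k(2)]
    by (intro subset_antisym Inter_lower Inter_greatest) auto
qed

lemma ext_closure_eq_layers:
  assumes "orthogonal w X" "1 \<le> w" shows "ext_closure C X = layers X (Suc 0)"
  using ext_closure_shifts[OF assms(1), of 1] assms(2) by (simp add: shift_pow_def)

lemma perp_layers:
  assumes "t \<in> \<langle>X\<rangle>" "d \<in> Ob C" "\<And>x. x \<in> X \<Longrightarrow> d \<bottom> x" shows "d \<bottom> t"
proof -
  have "filtered X k n t \<Longrightarrow> k \<le> Suc 0 \<Longrightarrow> d \<bottom> t" for k n t
  proof (induction rule: filtered.induct)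
    case (zero t k) then show ?case using zero_perp(1) assms by blast
  next
    case (step x t t' f g h k n) then show ?case using perp_middle_right assms(3) by blast
  next
    case (shift t k n)
    then show ?case using zero_perp(1) filtered_no_layers shift_zero_ob assms(2) by blast
  qed
  then show ?thesis using assms(1) unfolding layers_def by blast
qed

lemma shift_layers_perp:
  assumes "t \<in> \<langle>X\<rangle>" "d \<in> Ob C" "\<And>x. x \<in> X \<Longrightarrow> (\<Sigma> ^^ i) x \<bottom> d" shows "(\<Sigma> ^^ i) t \<bottom> d"
proof -
  have "filtered X k n t \<Longrightarrow> k \<le> Suc 0 \<Longrightarrow> (\<Sigma> ^^ i) t \<bottom> d" for k n t
  proof (induction rule: filtered.induct)
    case (zero t k) then show ?case using zero_perp(2) funpow_shift_zero_ob zero_ob assms(2) by blast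
  next
    case (step x t t' f g h k n)
    have "triangle ((\<Sigma> ^^ i) x) ((\<Sigma> ^^ i) t) ((\<Sigma> ^^ i) t')"
      using triangle_funpow_shift step.hyps(2) triangle_def by blast
    then show ?case using perp_middle_left assms(3)[OF step.hyps(1)] step unfolding triangle_def by blast
  next
    case (shift t k n)
    then have "is_zero C t" using filtered_no_layers shift_zero_ob[OF shift.hyps(1)] by auto
    then show ?case using zero_perp(2) funpow_shift_zero_ob shift.hyps(1) assms(2) by blast
  qed
  then show ?thesis using assms(1) unfolding layers_def by blast
qed

section \<open>Direct sums\<close>

text \<open>
  A sum of morphisms that factor through objects of \<open>L\<close> factors through an iterated split
  extension of these objects. This replaces the partial sums of a biproduct of a list, which are
  not part of the data of the biproduct.
\<close>

lemma sum_factors: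
  fixes n :: nat
  assumes L: "\<And>d. is_zero C d \<Longrightarrow> d \<in> L" "\<And>a d b. \<lbrakk>a \<in> L; b \<in> L; triangle a d b\<rbrakk> \<Longrightarrow> d \<in> L"
    "L \<subseteq> Ob C" and ab: "a \<in> Ob C" "b \<in> Ob C"
    and x: "\<And>i. i < n \<Longrightarrow> x i \<in> L \<and> arr (f i) a (x i) \<and> arr (g i) (x i) b"
  shows "\<exists>m \<in> L. \<exists>F G. arr F a m \<and> arr G m b \<and> G \<cdot> F = (\<Sum>i < n. g i \<cdot> f i)"
  using x
proof (induction n)
  case 0
  obtain o' where o': "is_zero C o'" using zero_exists by blast
  have "arr 0 a o'" "arr 0 o' b" using arr_zero ab zero_ob[OF o'] by auto
  moreover have "(0::'m) \<cdot> 0 = 0" using comp_zero_left[OF \<open>arr 0 a o'\<close>] .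
  ultimately show ?case using L(1)[OF o'] by fastforce
next
  case (Suc n)
  then obtain m F G where m: "m \<in> L" "arr F a m" "arr G m b" "G \<cdot> F = (\<Sum>i < n. g i \<cdot> f i)"
    by (meson less_Suc_eq)
  have xn: "x n \<in> L" "arr (f n) a (x n)" "arr (g n) (x n) b" using Suc.prems by auto
  have ob: "m \<in> Ob C" "x n \<in> Ob C" using m xn L(3) by auto
  obtain y \<iota> p where t: "tri C m y (x n) \<iota> p 0" using split_triangle_exists ob by blast
  have y: "y \<in> L" using L(2) m xn t triangle_def by blast
  obtain \<sigma> \<rho> where s: "arr \<sigma> (x n) y" "arr \<rho> y m" "p \<cdot> \<sigma> = idm C (x n)" "\<rho> \<cdot> \<iota> = idm C m" "\<rho> \<cdot> \<sigma> = 0"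
    using split_cone(2)[OF t] by blast
  note T = tri_arr[OF t]
  have 1: "arr (\<iota> \<cdot> F) a y" "arr (\<sigma> \<cdot> f n) a y" using arr_comp m T s xn by blast+
  have 2: "arr (G \<cdot> \<rho>) y b" "arr (g n \<cdot> p) y b" using arr_comp m T s xn by blast+
  have z: "p \<cdot> \<iota> = 0" using tri_comp_zero[OF t] .
  have e1: "(G \<cdot> \<rho>) \<cdot> (\<iota> \<cdot> F) = G \<cdot> F"
    using comp_assoc[OF 1(1) s(2) m(3)] comp_assoc[OF m(2) T(1) s(2)] s(4) comp_id_left[OF m(2)] by simp
  have e2: "(G \<cdot> \<rho>) \<cdot> (\<sigma> \<cdot> f n) = 0"
    using comp_assoc[OF 1(2) s(2) m(3)] comp_assoc[OF xn(2) s(1,2)] s(5) comp_zero_left[OF xn(2)]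
      comp_zero_right[OF m(3)] by simp
  have e3: "(g n \<cdot> p) \<cdot> (\<iota> \<cdot> F) = 0"
    using comp_assoc[OF 1(1) T(2) xn(3)] comp_assoc[OF m(2) T(1,2)] z comp_zero_left[OF m(2)]
      comp_zero_right[OF xn(3)] by simp
  have e4: "(g n \<cdot> p) \<cdot> (\<sigma> \<cdot> f n) = g n \<cdot> f n"
    using comp_assoc[OF 1(2) T(2) xn(3)] comp_assoc[OF xn(2) s(1) T(2)] s(3) comp_id_left[OF xn(2)] by simp
  have "(G \<cdot> \<rho> + g n \<cdot> p) \<cdot> (\<iota> \<cdot> F + \<sigma> \<cdot> f n) = (\<Sum>i < Suc n. g i \<cdot> f i)"
    using comp_add_right[OF 1 arr_add[OF 2]] comp_add_left[OF 1(1) 2] comp_add_left[OF 1(2) 2]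
      e1 e2 e3 e4 m(4) by simp
  then show ?case using y arr_add[OF 1] arr_add[OF 2] by blast
qed

lemma direct_sum_retract:
  assumes L: "\<And>d. is_zero C d \<Longrightarrow> d \<in> L" "\<And>a d b. \<lbrakk>a \<in> L; b \<in> L; triangle a d b\<rbrakk> \<Longrightarrow> d \<in> L"
    "L \<subseteq> Ob C" and b: "direct_sum C b xs" "set xs \<subseteq> L"
  shows "\<exists>m \<in> L. retract C b m"
proof -
  obtain \<iota> \<pi> where s: "b \<in> Ob C" "\<And>i. i < length xs \<Longrightarrow> \<iota> i \<in> Hom C (xs ! i) b \<and> \<pi> i \<in> Hom C b (xs ! i)"
    "(\<Sum>i < length xs. \<iota> i \<cdot> \<pi> i) = idm C b"
    using b(1) unfolding direct_sum_def by blast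
  have "\<exists>m \<in> L. \<exists>F G. arr F b m \<and> arr G m b \<and> G \<cdot> F = (\<Sum>i < length xs. \<iota> i \<cdot> \<pi> i)"
  proof (rule sum_factors[OF L s(1) s(1)])
    fix i assume i: "i < length xs"
    then have "xs ! i \<in> L" using b(2) by auto
    then show "xs ! i \<in> L \<and> arr (\<pi> i) b (xs ! i) \<and> arr (\<iota> i) (xs ! i) b"
      using s(1) s(2)[OF i] L(3) by (auto simp: arr_def)
  qed
  then show ?thesis using s(3) unfolding retract_def arr_def by auto
qed

lemma direct_sum_summand:
  assumes "direct_sum C b [d, e]" shows "retract C d b"
proof -
  let ?xs = "[d, e]"
  obtain \<iota> \<pi> where s: "\<And>i. i < length ?xs \<Longrightarrow> \<iota> i \<in> Hom C (?xs ! i) b \<and> \<pi> i \<in> Hom C b (?xs ! i)"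
    "\<And>i j. \<lbrakk>i < length ?xs; j < length ?xs\<rbrakk> \<Longrightarrow> \<pi> i \<cdot> \<iota> j = (if i = j then idm C (?xs ! i) else 0)"
    using assms unfolding direct_sum_def by blast
  have "\<iota> 0 \<in> Hom C d b" "\<pi> 0 \<in> Hom C b d" "\<pi> 0 \<cdot> \<iota> 0 = idm C d"
    using s(1)[of 0] s(2)[of 0 0] by auto
  moreover have "b \<in> Ob C" "d \<in> Ob C" using assms unfolding direct_sum_def by auto
  ultimately show ?thesis unfolding retract_def by blast
qed

lemma direct_sum_self:
  assumes "d \<in> Ob C" "is_zero C z"
  shows "direct_sum C d [d]" "direct_sum C d [d, z]"
proof -
  have i: "idm C d \<in> Hom C d d" "idm C d \<cdot> idm C d = idm C d"
    using arr_id comp_id_left assms arr_def by auto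
  show "direct_sum C d [d]" unfolding direct_sum_def using assms i
    by (intro conjI exI[of _ "\<lambda>_. idm C d"]) auto
  have z: "z \<in> Ob C" "idm C z = 0" "0 \<in> Hom C z d" "0 \<in> Hom C d z"
    using zero_iff assms arr_zero by (auto simp: arr_def)
  have "(0::'m) \<cdot> 0 = 0" "idm C d \<cdot> 0 = 0" "0 \<cdot> idm C d = 0"
    using comp_zero_left[OF arr_zero[OF assms(1) assms(1)]] comp_zero_right[OF arr_id[OF assms(1)]]
      comp_zero_left[OF arr_id[OF assms(1)]] by auto
  then show "direct_sum C d [d, z]" unfolding direct_sum_def using assms i z
    by (intro conjI exI[of _ "\<lambda>i::nat. if i = 0 then idm C d else 0"]) (auto simp: less_Suc_eq nth_Cons')
qed

lemma add_closure_layers: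
  assumes X: "orthogonal w X" "k \<le> w" and d: "d \<in> add_closure C (layers X k)"
  shows "d \<in> layers X k"
proof -
  obtain xs b e where b: "set xs \<subseteq> layers X k" "direct_sum C b xs" "direct_sum C b [d, e]"
    using d unfolding add_closure_def by blast
  have "\<exists>m \<in> layers X k. retract C b m"
    by (rule direct_sum_retract[OF _ _ _ b(2,1)]) (use layers_zero layers_extension[OF X] layers_ob in blast)+
  then obtain m where m: "m \<in> layers X k" "retract C b m" by blast
  have "retract C d m" using retract_trans[OF direct_sum_summand[OF b(3)] m(2)] .
  then show ?thesis using layers_retract m X by blast
qed

section \<open>Schur's lemma\<close>

text \<open>
  A one-dimensional space that contains an isomorphism consists of its multiples, which gives the
  Schur lemma. Finiteness is needed to read dimension \<open>0\<close> as vanishing, because an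
  infinite-dimensional space also has \<open>dim\<close> equal to \<open>0\<close>.
\<close>

lemma orthogonal_of_w_orthogonal:
  assumes hf: "hom_finite C" and X: "w_orthogonal C w X" shows "orthogonal w X"
proof -
  have st: "strict_subcat C X" using X by (simp add: w_orthogonal_def)
  have ob: "x \<in> Ob C" if "x \<in> X" for x using st that by (auto simp: strict_subcat_def)
  have dims: "dim (Hom C x y) = (if isomorphic C x y then 1 else 0)" if "x \<in> X" "y \<in> X" for x y
    using X that by (simp add: w_orthogonal_def)
  have nz: "idm C x \<noteq> 0" if x: "x \<in> X" for x
  proof
    assume "idm C x = 0"
    then have "Hom C x x = {0}" using zero_iff[of x] ob[OF x] by (auto simp: is_zero_def)
    moreover have "isomorphic C x x" using isomorphic_iff iso_ob_refl ob[OF x] by blast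
    ultimately show False using dims[OF x x] dim_zero_Hom by simp
  qed
  have iso: "iso f x y" if x: "x \<in> X" "y \<in> X" and f: "arr f x y" "f \<noteq> 0" for x y f
  proof -
    have "isomorphic C x y"
      using Hom_zero_of_dim_zero[OF hf ob[OF x(1)] ob[OF x(2)]] dims[OF x] f
      by (cases "isomorphic C x y") (auto simp: arr_def)
    then obtain a where a: "iso a x y" using isomorphic_iff ob x iso_ob_def by blast
    have "dim (Hom C x y) = 1" using dims[OF x] \<open>isomorphic C x y\<close> by simp
    then obtain B where B: "B \<subseteq> Hom C x y" "Hom C x y \<subseteq> span B" "card B = 1"
      using basis_exists[of "Hom C x y"] by metis
    then obtain b where b: "B = {b}" by (auto simp: card_1_singleton_iff)
    obtain c where c: "f = scl C c b" using B(2) f b by (auto simp: arr_def span_singleton)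
    obtain d where d: "a = scl C d b" using B(2) iso_arr[OF a] b by (auto simp: arr_def span_singleton)
    have "a \<noteq> 0"
    proof
      assume "a = 0"
      then have "idm C x = 0" using a comp_zero_right unfolding iso_iff by metis
      then show False using nz x by blast
    qed
    then have d0: "d \<noteq> 0" using d by auto
    have c0: "c \<noteq> 0" using c f by auto
    have "f = scl C (c / d) a" using c d d0 by simp
    then show ?thesis using iso_scale[OF a, of "c / d"] c0 d0 by simp
  qed
  have "(\<Sigma> ^^ k) x \<bottom> y" if "x \<in> X" "y \<in> X" "1 \<le> k" "k < w" for x y k
  proof -
    have "2 \<le> w" "k \<in> {1..w - 1}" using that by auto
    then have "Hom C (shift_pow C (int k) x) y = {0}" using X that by (auto simp: w_orthogonal_def)
    then show ?thesis using Hom_zero_iff funpow_shift_in ob that(1,2) by (simp add: shift_pow_nonneg)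
  qed
  then show ?thesis unfolding orthogonal_def using st nz iso by blast
qed

lemma tri_extend_first:
  assumes t: "tri C x y z f g h" and p: "arr p x d" "\<Sigma>\<^sub>m x d p \<cdot> h = 0"
  shows "\<exists>q. arr q y d \<and> q \<cdot> f = p"
proof -
  have d: "d \<in> Ob C" "x \<in> Ob C" "y \<in> Ob C" using p arr_ob tri_ob[OF t] by auto
  obtain q' where q': "arr q' (\<Sigma> y) (\<Sigma> d)" "q' \<cdot> \<Sigma>\<^sub>m x y f = \<Sigma>\<^sub>m x d p"
    using tri_extend''[OF t shift_arr[OF p(1)] p(2)] by blast
  obtain q where q: "arr q y d" "\<Sigma>\<^sub>m y d q = q'" using shift_full[OF q'(1)] d by blast
  have "\<Sigma>\<^sub>m x d (q \<cdot> f) = \<Sigma>\<^sub>m x d p" using shift_comp[OF tri_arr(1)[OF t] q(1)] q q' by simp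
  then show ?thesis using shift_faithful[OF arr_comp[OF tri_arr(1)[OF t] q(1)] p(1)] q by blast
qed

text \<open>
  The extension with class \<open>c\<close> is the cocone of \<open>c\<close>.
\<close>

lemma extension_exists:
  assumes "arr c s (\<Sigma> t)" "t \<in> Ob C" shows "\<exists>x f g. tri C t x s f g c"
proof -
  obtain w e h where "tri C w s (\<Sigma> t) e c h" using cocone_exists assms by blast
  then show ?thesis using rotate_back_full assms(2) by blast
qed

section \<open>Minimal approximations by an extension closure\<close>

lemma right_approx_arr:
  assumes "right_approx C L t c \<alpha>" "L \<subseteq> Ob C" "c \<in> Ob C"
  shows "t \<in> L" "arr \<alpha> t c" "\<And>x g. \<lbrakk>x \<in> L; arr g x c\<rbrakk> \<Longrightarrow> \<exists>h. arr h x t \<and> g = \<alpha> \<cdot> h"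
  using assms unfolding right_approx_def arr_def by blast+

lemma left_approx_arr:
  assumes "left_approx C L d t \<alpha>" "L \<subseteq> Ob C" "d \<in> Ob C"
  shows "t \<in> L" "arr \<alpha> d t" "\<And>x g. \<lbrakk>x \<in> L; arr g d x\<rbrakk> \<Longrightarrow> \<exists>h. arr h t x \<and> g = h \<cdot> \<alpha>"
  using assms unfolding left_approx_def arr_def by blast+

context
  fixes w :: nat and S :: "'o set"
  assumes S: "orthogonal w S" and w: "1 \<le> w"
begin

lemma hull_ob: "\<langle>S\<rangle> \<subseteq> Ob C" using layers_ob by blast

lemma S_hull: "s \<in> S \<Longrightarrow> s \<in> \<langle>S\<rangle>" using layers_object[OF S] .

lemma S_ob: "s \<in> S \<Longrightarrow> s \<in> Ob C" using orthogonal_ob[OF S] .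

lemma hull_extension: "\<lbrakk>a \<in> \<langle>S\<rangle>; b \<in> \<langle>S\<rangle>; triangle a d b\<rbrakk> \<Longrightarrow> d \<in> \<langle>S\<rangle>"
  using layers_extension[OF S w[unfolded One_nat_def]] by blast

text \<open>
  If \<open>\<alpha>\<close> kills \<open>f: s \<rightarrow> t\<close>, then \<open>\<alpha>\<close> factors through the cone of \<open>f\<close>, which lies in \<open>\<langle>S\<rangle>\<close>. Going
  back to \<open>t\<close> by the approximation property gives an endomorphism fixed by \<open>\<alpha>\<close> that kills \<open>f\<close>.
  Minimality makes it invertible.
\<close>

lemma min_right_approx_injective:
  assumes a: "min_right_approx C \<langle>S\<rangle> t c \<alpha>" and c: "c \<in> Ob C"
    and f: "s \<in> S" "arr f s t" "\<alpha> \<cdot> f = 0"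
  shows "f = 0"
proof (rule ccontr)
  assume nz: "f \<noteq> 0"
  have r: "right_approx C \<langle>S\<rangle> t c \<alpha>" using a by (simp add: min_right_approx_def)
  note R = right_approx_arr[OF r hull_ob c]
  obtain t1 q \<delta> where t1: "tri C s t t1 f q \<delta>" using cone_exists f by blast
  note T = tri_arr[OF t1]
  obtain n where n: "filtered S (Suc 0) n t" using R(1) unfolding layers_def by blast
  obtain m where "filtered S (Suc 0) m t1" using filtered_cone[OF n S _ f(1) t1 nz] w by auto
  then have "t1 \<in> \<langle>S\<rangle>" by (rule layersI)
  moreover obtain \<alpha>1 where \<alpha>1: "arr \<alpha>1 t1 c" "\<alpha>1 \<cdot> q = \<alpha>" using tri_extend[OF t1 R(2) f(3)] by blast
  ultimately obtain r where r: "arr r t1 t" "\<alpha>1 = \<alpha> \<cdot> r" using R(3) by blast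
  have rq: "arr (r \<cdot> q) t t" using arr_comp[OF T(2) r(1)] .
  have "\<alpha> \<cdot> (r \<cdot> q) = \<alpha>" using comp_assoc[OF T(2) r(1) R(2)] r \<alpha>1 by simp
  then have i: "iso (r \<cdot> q) t t" using a rq unfolding min_right_approx_def iso_def arr_def by blast
  have "(r \<cdot> q) \<cdot> f = 0" using comp_assoc[OF f(2) T(2) r(1)] tri_comp_zero[OF t1] comp_zero_right[OF r(1)] by simp
  then have "f = 0" using iso_cancel_left[OF i f(2) arr_zero[OF arr_ob[OF f(2)]]] comp_zero_right[OF rq] by simp
  then show False using nz by blast
qed

text \<open>
  The dual argument, with the cocone of \<open>f\<close> from \<open>layers_cocone\<close>.
\<close>

lemma min_left_approx_injective:
  assumes a: "min_left_approx C \<langle>S\<rangle> d t \<alpha>" and d: "d \<in> Ob C"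
    and f: "s \<in> S" "arr f t s" "f \<cdot> \<alpha> = 0"
  shows "f = 0"
proof (rule ccontr)
  assume nz: "f \<noteq> 0"
  have r: "left_approx C \<langle>S\<rangle> d t \<alpha>" using a by (simp add: min_left_approx_def)
  note R = left_approx_arr[OF r hull_ob d]
  obtain e \<epsilon> \<delta> where t1: "tri C e t s \<epsilon> f \<delta>" using cocone_exists f by blast
  note T = tri_arr[OF t1]
  obtain n where "filtered S (Suc 0) n t" using R(1) unfolding layers_def by blast
  then have "e \<in> \<langle>S\<rangle>" using layers_cocone[OF _ _ S w f(1) t1 nz] by blast
  moreover obtain \<alpha>1 where \<alpha>1: "arr \<alpha>1 d e" "\<epsilon> \<cdot> \<alpha>1 = \<alpha>" using tri_lift[OF t1 R(2) f(3)] by blast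
  ultimately obtain r where r: "arr r t e" "\<alpha>1 = r \<cdot> \<alpha>" using R(3) by blast
  have rq: "arr (\<epsilon> \<cdot> r) t t" using arr_comp[OF r(1) T(1)] .
  have "(\<epsilon> \<cdot> r) \<cdot> \<alpha> = \<alpha>" using comp_assoc[OF R(2) r(1) T(1)] r \<alpha>1 by simp
  then have i: "iso (\<epsilon> \<cdot> r) t t" using a rq unfolding min_left_approx_def iso_def arr_def by blast
  have "f \<cdot> (\<epsilon> \<cdot> r) = 0" using comp_assoc[OF r(1) T(1) f(2)] tri_comp_zero[OF t1] comp_zero_left[OF r(1)] by simp
  then have "f = 0" using iso_cancel_right[OF i f(2) arr_zero[OF arr_ob[OF f(2)]]] comp_zero_left[OF rq] by simp
  then show False using nz by blast
qed

lemma endo_iso_of_injective: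
  assumes t: "filtered S (Suc 0) n t" and g: "arr g t t"
    and inj: "\<And>s f. \<lbrakk>s \<in> S; arr f s t; g \<cdot> f = 0\<rbrakk> \<Longrightarrow> f = 0"
  shows "iso g t t"
proof -
  obtain c p h where c: "tri C t t c g p h" using cone_exists g by blast
  have "filtered S (Suc 0) 0 c"
    using filtered_cone_of_injective[OF t refl t S w[unfolded One_nat_def] subset_refl c inj] by simp
  then show ?thesis using filtered_length_zero iso_of_cone_zero[OF c] by blast
qed

text \<open>
  Take an approximation of minimal length. An endomorphism \<open>g\<close> with \<open>\<alpha> g = \<alpha>\<close> cannot kill a
  nonzero \<open>f: s \<rightarrow> t\<close>, since then \<open>\<alpha>\<close> would kill it too and the cone of \<open>f\<close> would carry a shorter
  approximation. So \<open>g\<close> is injective on \<open>Hom(S,-)\<close>, hence invertible.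
\<close>

lemma min_right_approx_exists:
  assumes "right_approx C \<langle>S\<rangle> t0 c \<alpha>0" and c: "c \<in> Ob C"
  shows "\<exists>t \<alpha>. min_right_approx C \<langle>S\<rangle> t c \<alpha>"
proof -
  let ?P = "\<lambda>n. \<exists>t \<alpha>. filtered S (Suc 0) n t \<and> right_approx C \<langle>S\<rangle> t c \<alpha>"
  have "\<exists>n. ?P n" using assms unfolding right_approx_def layers_def by blast
  then obtain n where n: "?P n" "\<And>m. m < n \<Longrightarrow> \<not> ?P m" using exists_least_iff[of ?P] by blast
  then obtain t \<alpha> where t: "filtered S (Suc 0) n t" "right_approx C \<langle>S\<rangle> t c \<alpha>" by blast
  note R = right_approx_arr[OF t(2) hull_ob c]
  have "iso g t t" if g: "arr g t t" "\<alpha> \<cdot> g = \<alpha>" for g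
  proof (rule endo_iso_of_injective[OF t(1) g(1)], rule ccontr)
    fix s f assume f: "s \<in> S" "arr f s t" "g \<cdot> f = 0" "f \<noteq> 0"
    obtain t1 q \<delta> where t1: "tri C s t t1 f q \<delta>" using cone_exists f by blast
    note T = tri_arr[OF t1]
    obtain m where m: "n = Suc m" "filtered S (Suc 0) m t1"
      using filtered_cone[OF t(1) S _ f(1) t1 f(4)] w by auto
    have "\<alpha> \<cdot> f = 0" using comp_assoc[OF f(2) g(1) R(2)] g(2) f(3) comp_zero_right[OF R(2)] by simp
    then obtain \<alpha>1 where \<alpha>1: "arr \<alpha>1 t1 c" "\<alpha>1 \<cdot> q = \<alpha>" using tri_extend[OF t1 R(2)] by blast
    have "right_approx C \<langle>S\<rangle> t1 c \<alpha>1" unfolding right_approx_def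
    proof (intro conjI ballI)
      show "t1 \<in> \<langle>S\<rangle>" using m layersI by blast
      show "\<alpha>1 \<in> Hom C t1 c" using \<alpha>1 by (simp add: arr_def)
      fix x p assume "x \<in> \<langle>S\<rangle>" "p \<in> Hom C x c"
      then have "x \<in> \<langle>S\<rangle>" "arr p x c" using hull_ob c by (auto simp: arr_def)
      then obtain h where h: "arr h x t" "p = \<alpha> \<cdot> h" using R(3) by blast
      then have "p = \<alpha>1 \<cdot> (q \<cdot> h)" using comp_assoc[OF h(1) T(2) \<alpha>1(1)] \<alpha>1(2) by simp
      then show "\<exists>h \<in> Hom C x t1. p = \<alpha>1 \<cdot> h" using arr_comp[OF h(1) T(2)] by (auto simp: arr_def)
    qed
    then show False using n(2)[of m] m by blast
  qed
  then have "min_right_approx C \<langle>S\<rangle> t c \<alpha>"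
    using t(2) R(1) hull_ob unfolding min_right_approx_def iso_def arr_def by blast
  then show ?thesis by blast
qed

text \<open>
  Here an endomorphism \<open>g\<close> that kills \<open>f: s \<rightarrow> t\<close> factors through the cone \<open>q\<close> of \<open>f\<close>, and \<open>q \<alpha>\<close> is
  a shorter approximation.
\<close>

lemma min_left_approx_exists:
  assumes "left_approx C \<langle>S\<rangle> d t0 \<alpha>0" and d: "d \<in> Ob C"
  shows "\<exists>t \<alpha>. min_left_approx C \<langle>S\<rangle> d t \<alpha>"
proof -
  let ?P = "\<lambda>n. \<exists>t \<alpha>. filtered S (Suc 0) n t \<and> left_approx C \<langle>S\<rangle> d t \<alpha>"
  have "\<exists>n. ?P n" using assms unfolding left_approx_def layers_def by blast
  then obtain n where n: "?P n" "\<And>m. m < n \<Longrightarrow> \<not> ?P m" using exists_least_iff[of ?P] by blast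
  then obtain t \<alpha> where t: "filtered S (Suc 0) n t" "left_approx C \<langle>S\<rangle> d t \<alpha>" by blast
  note R = left_approx_arr[OF t(2) hull_ob d]
  have "iso g t t" if g: "arr g t t" "g \<cdot> \<alpha> = \<alpha>" for g
  proof (rule endo_iso_of_injective[OF t(1) g(1)], rule ccontr)
    fix s f assume f: "s \<in> S" "arr f s t" "g \<cdot> f = 0" "f \<noteq> 0"
    obtain t1 q \<delta> where t1: "tri C s t t1 f q \<delta>" using cone_exists f by blast
    note T = tri_arr[OF t1]
    obtain m where m: "n = Suc m" "filtered S (Suc 0) m t1"
      using filtered_cone[OF t(1) S _ f(1) t1 f(4)] w by auto
    obtain g1 where g1: "arr g1 t1 t" "g1 \<cdot> q = g" using tri_extend[OF t1 g(1) f(3)] by blast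
    have "left_approx C \<langle>S\<rangle> d t1 (q \<cdot> \<alpha>)" unfolding left_approx_def
    proof (intro conjI ballI)
      show "t1 \<in> \<langle>S\<rangle>" using m layersI by blast
      show "q \<cdot> \<alpha> \<in> Hom C d t1" using arr_comp[OF R(2) T(2)] by (simp add: arr_def)
      fix x p assume "x \<in> \<langle>S\<rangle>" "p \<in> Hom C d x"
      then have "x \<in> \<langle>S\<rangle>" "arr p d x" using hull_ob d by (auto simp: arr_def)
      then obtain h where h: "arr h t x" "p = h \<cdot> \<alpha>" using R(3) by blast
      have "(h \<cdot> g1) \<cdot> (q \<cdot> \<alpha>) = h \<cdot> ((g1 \<cdot> q) \<cdot> \<alpha>)"
        using comp_assoc[OF arr_comp[OF R(2) T(2)] g1(1) h(1)] comp_assoc[OF R(2) T(2) g1(1)] by simp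
      then have "p = (h \<cdot> g1) \<cdot> (q \<cdot> \<alpha>)" using g1 g h by simp
      then show "\<exists>h \<in> Hom C t1 x. p = h \<cdot> (q \<cdot> \<alpha>)" using arr_comp[OF g1(1) h(1)] by (auto simp: arr_def)
    qed
    then show False using n(2)[of m] m by blast
  qed
  then have "min_left_approx C \<langle>S\<rangle> d t \<alpha>"
    using t(2) R(1) hull_ob unfolding min_left_approx_def iso_def arr_def by blast
  then show ?thesis by blast
qed

text \<open>
  Wakamatsu's lemma. The composite \<open>s \<rightarrow> z \<rightarrow> \<Sigma> t\<close> is the class of an extension \<open>x\<close> in \<open>\<langle>S\<rangle>\<close> to
  which \<open>\<alpha>\<close> extends. The extension factors through \<open>\<alpha>\<close>, and by minimality this splits \<open>x\<close>. So \<open>f\<close>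
  lifts to \<open>c\<close>, therefore to \<open>t\<close>, and vanishes.
\<close>

lemma right_wakamatsu:
  assumes a: "min_right_approx C \<langle>S\<rangle> t c \<alpha>" and z: "tri C t c z \<alpha> \<beta> \<gamma>" and s: "s \<in> S"
  shows "s \<bottom> z"
  unfolding perp_def
proof (intro allI impI)
  fix f assume f: "arr f s z"
  note Z = tri_arr[OF z] and ob = tri_ob[OF z]
  have r: "right_approx C \<langle>S\<rangle> t c \<alpha>" using a by (simp add: min_right_approx_def)
  note R = right_approx_arr[OF r hull_ob ob(2)]
  have gf: "arr (\<gamma> \<cdot> f) s (\<Sigma> t)" using arr_comp[OF f Z(3)] .
  obtain x i p where x: "tri C t x s i p (\<gamma> \<cdot> f)" using extension_exists[OF gf ob(1)] by blast
  note X = tri_arr[OF x]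
  have xL: "x \<in> \<langle>S\<rangle>" using hull_extension[OF R(1) S_hull[OF s]] x triangle_def by blast
  have "\<Sigma>\<^sub>m t c \<alpha> \<cdot> (\<gamma> \<cdot> f) = 0"
    using comp_assoc[OF f Z(3) shift_arr[OF Z(1)]] tri_comp_zero''[OF z] comp_zero_left[OF f] by simp
  then obtain a' where a': "arr a' x c" "a' \<cdot> i = \<alpha>" using tri_extend_first[OF x Z(1)] by blast
  obtain r where r: "arr r x t" "a' = \<alpha> \<cdot> r" using R(3)[OF xL a'(1)] by blast
  have ri: "arr (r \<cdot> i) t t" using arr_comp[OF X(1) r(1)] .
  have "\<alpha> \<cdot> (r \<cdot> i) = \<alpha>" using comp_assoc[OF X(1) r(1) Z(1)] r a' by simp
  then have "iso (r \<cdot> i) t t" using a ri unfolding min_right_approx_def iso_def arr_def by blast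
  then have iso: "iso (\<Sigma>\<^sub>m t t (r \<cdot> i)) (\<Sigma> t) (\<Sigma> t)" using shift_iso by blast
  have "\<Sigma>\<^sub>m t t (r \<cdot> i) \<cdot> (\<gamma> \<cdot> f) = \<Sigma>\<^sub>m x t r \<cdot> (\<Sigma>\<^sub>m t x i \<cdot> (\<gamma> \<cdot> f))"
    using shift_comp[OF X(1) r(1)] comp_assoc[OF gf shift_arr[OF X(1)] shift_arr[OF r(1)]] by simp
  also have "\<dots> = 0" using tri_comp_zero''[OF x] comp_zero_right[OF shift_arr[OF r(1)]] by simp
  finally have "\<gamma> \<cdot> f = 0"
    using iso_cancel_left[OF iso gf arr_zero[OF arr_ob[OF gf]]] comp_zero_right[OF iso_arr[OF iso]] by simp
  then obtain f' where f': "arr f' s c" "\<beta> \<cdot> f' = f" using tri_lift'[OF z f] by blast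
  obtain f2 where f2: "arr f2 s t" "f' = \<alpha> \<cdot> f2" using R(3)[OF S_hull[OF s] f'(1)] by blast
  show "f = 0" using f' f2 comp_assoc[OF f2(1) Z(1,2)] tri_comp_zero[OF z] comp_zero_left[OF f2(1)] by simp
qed

lemma left_wakamatsu:
  assumes a: "min_left_approx C \<langle>S\<rangle> y t \<alpha>" and e: "tri C e y t \<epsilon> \<alpha> \<delta>" and s: "s \<in> S"
  shows "e \<bottom> s"
  unfolding perp_def
proof (intro allI impI)
  fix f assume f: "arr f e s"
  note E = tri_arr[OF e] and ob = tri_ob[OF e]
  have r: "left_approx C \<langle>S\<rangle> y t \<alpha>" using a by (simp add: min_left_approx_def)
  note R = left_approx_arr[OF r hull_ob ob(2)]
  note sf = shift_arr[OF f]
  have fd: "arr (\<Sigma>\<^sub>m e s f \<cdot> \<delta>) t (\<Sigma> s)" using arr_comp[OF E(3) sf] .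
  obtain x i p where x: "tri C s x t i p (\<Sigma>\<^sub>m e s f \<cdot> \<delta>)" using extension_exists[OF fd S_ob[OF s]] by blast
  note X = tri_arr[OF x]
  have xL: "x \<in> \<langle>S\<rangle>" using hull_extension[OF S_hull[OF s] R(1)] x triangle_def by blast
  have "(\<Sigma>\<^sub>m e s f \<cdot> \<delta>) \<cdot> \<alpha> = 0"
    using comp_assoc[OF E(2) E(3) sf] tri_comp_zero'[OF e] comp_zero_right[OF sf] by simp
  then obtain a' where a': "arr a' y x" "p \<cdot> a' = \<alpha>" using tri_lift'[OF x E(2)] by blast
  obtain b where b: "arr b t x" "a' = b \<cdot> \<alpha>" using R(3)[OF xL a'(1)] by blast
  have pb: "arr (p \<cdot> b) t t" using arr_comp[OF b(1) X(2)] .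
  have "(p \<cdot> b) \<cdot> \<alpha> = \<alpha>" using comp_assoc[OF E(2) b(1) X(2)] b a' by simp
  then have iso: "iso (p \<cdot> b) t t" using a pb unfolding min_left_approx_def iso_def arr_def by blast
  have "(\<Sigma>\<^sub>m e s f \<cdot> \<delta>) \<cdot> (p \<cdot> b) = 0"
    using comp_assoc[OF b(1) X(2,3)] tri_comp_zero'[OF x] comp_zero_left[OF b(1)] by simp
  then have "\<Sigma>\<^sub>m e s f \<cdot> \<delta> = 0"
    using iso_cancel_right[OF iso fd arr_zero[OF arr_ob[OF fd]]] comp_zero_left[OF iso_arr[OF iso]] by simp
  then obtain q where q: "arr q y s" "q \<cdot> \<epsilon> = f" using tri_extend_first[OF e f] by blast
  obtain q' where q': "arr q' t s" "q = q' \<cdot> \<alpha>" using R(3)[OF S_hull[OF s] q(1)] by blast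
  show "f = 0" using q q' comp_assoc[OF E(1,2) q'(1)] tri_comp_zero[OF e] comp_zero_right[OF q'(1)] by simp
qed

lemma S_shift_perp_hull: "\<lbrakk>t \<in> \<langle>S\<rangle>; s \<in> S; 1 \<le> j; j < w\<rbrakk> \<Longrightarrow> (\<Sigma> ^^ j) s \<bottom> t"
  using shift_perp_filtered[OF _ S] unfolding layers_def by fastforce

text \<open>
  The outer term \<open>Hom(\<Sigma>\<^sup>i s, \<Sigma> t)\<close> of the long exact sequence vanishes for \<open>i > 1\<close>. For \<open>i = 1\<close> it
  is \<open>Hom(s, t)\<close>, which \<open>\<alpha>\<close> embeds in \<open>Hom(s, c)\<close>.
\<close>

lemma right_cone_perp:
  assumes a: "min_right_approx C \<langle>S\<rangle> t c \<alpha>" and z: "tri C t c z \<alpha> \<beta> \<gamma>" and s: "s \<in> S"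
    and i: "1 \<le> i" "i \<le> w" "(\<Sigma> ^^ i) s \<bottom> c"
  shows "(\<Sigma> ^^ i) s \<bottom> z"
proof (cases "i = 1")
  case True
  note Z = tri_arr[OF z] and ob = tri_ob[OF z]
  have sc: "\<Sigma> s \<bottom> c" using i True by simp
  have "\<Sigma> s \<bottom> z" unfolding perp_def
  proof (intro allI impI)
    fix p assume p: "arr p (\<Sigma> s) z"
    have gp: "arr (\<gamma> \<cdot> p) (\<Sigma> s) (\<Sigma> t)" using arr_comp[OF p Z(3)] .
    obtain p' where p': "arr p' s t" "\<Sigma>\<^sub>m s t p' = \<gamma> \<cdot> p" using shift_full[OF gp S_ob[OF s] ob(1)] by blast
    have "\<Sigma>\<^sub>m s c (\<alpha> \<cdot> p') = 0"
      using shift_comp[OF p'(1) Z(1)] p'(2) comp_assoc[OF p Z(3) shift_arr[OF Z(1)]]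
        tri_comp_zero''[OF z] comp_zero_left[OF p] by simp
    then have "\<alpha> \<cdot> p' = 0" using shift_eq_zero_iff[OF arr_comp[OF p'(1) Z(1)]] by blast
    then have "p' = 0" using min_right_approx_injective[OF a ob(2) s p'(1)] by blast
    then have "\<gamma> \<cdot> p = 0" using p' shift_zero S_ob s ob by auto
    then obtain q where q: "arr q (\<Sigma> s) c" "\<beta> \<cdot> q = p" using tri_lift'[OF z p] by blast
    then show "p = 0" using perpD[OF sc q(1)] comp_zero_right[OF Z(2)] by simp
  qed
  then show ?thesis using True by simp
next
  case False
  have t: "t \<in> \<langle>S\<rangle>" using a by (simp add: min_right_approx_def right_approx_def)
  obtain j where j: "i = Suc j" "1 \<le> j" "j < w" using False i(1,2) by (cases i) auto
  have "(\<Sigma> ^^ j) s \<bottom> t" using S_shift_perp_hull[OF t s j(2,3)] .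
  then have "(\<Sigma> ^^ i) s \<bottom> \<Sigma> t" using j(1) shift_perp funpow_shift_in S_ob s layers_ob t by simp
  then show ?thesis using perp_cone_right[OF z i(3)] by blast
qed

lemma left_cocone_perp:
  assumes a: "min_left_approx C \<langle>S\<rangle> y t \<alpha>" and e: "tri C e y t \<epsilon> \<alpha> \<delta>" and s: "s \<in> S"
    and i: "1 \<le> i" "i \<le> w" "(\<Sigma> ^^ i) y \<bottom> s"
  shows "(\<Sigma> ^^ i) e \<bottom> s"
proof (cases "i = 1")
  case True
  note E = tri_arr[OF e] and ob = tri_ob[OF e]
  have ys: "\<Sigma> y \<bottom> s" using i True by simp
  have "\<Sigma> e \<bottom> s" unfolding perp_def
  proof (intro allI impI)
    fix p assume p: "arr p (\<Sigma> e) s"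
    have "(p \<cdot> \<delta>) \<cdot> \<alpha> = 0"
      using comp_assoc[OF E(2,3) p] tri_comp_zero'[OF e] comp_zero_right[OF p] by simp
    then have "p \<cdot> \<delta> = 0" using min_left_approx_injective[OF a ob(2) s arr_comp[OF E(3) p]] by blast
    then obtain q where q: "arr q (\<Sigma> y) s" "q \<cdot> \<Sigma>\<^sub>m e y \<epsilon> = p" using tri_extend''[OF e p] by blast
    then show "p = 0" using perpD[OF ys q(1)] comp_zero_left[OF shift_arr[OF E(1)]] by simp
  qed
  then show ?thesis using True by simp
next
  case False
  have t: "t \<in> \<langle>S\<rangle>" using a by (simp add: min_left_approx_def left_approx_def)
  obtain j where j: "i = Suc j" "1 \<le> j" "j < w" using False i(1,2) by (cases i) auto
  have "(\<Sigma> ^^ j) t \<bottom> s" using shift_layers_perp[OF t S_ob[OF s]] orthogonal_perp[OF S _ s j(2,3)] by blast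
  moreover have "triangle ((\<Sigma> ^^ j) t) ((\<Sigma> ^^ j) (\<Sigma> e)) ((\<Sigma> ^^ j) (\<Sigma> y))"
    using triangle_funpow_shift rotate[OF rotate[OF e]] triangle_def by blast
  ultimately show ?thesis
    using perp_middle_left i(3) j(1) unfolding triangle_def by (auto simp: funpow_swap1)
qed

end

section \<open>Serre duality\<close>

text \<open>
  A nonzero vector extends to a basis, and its coordinate functional differs from zero.
\<close>

lemma zero_of_trivial_dual:
  assumes "subspace V" "\<And>\<phi> \<psi>. \<lbrakk>\<phi> \<in> dual_space C V; \<psi> \<in> dual_space C V\<rbrakk> \<Longrightarrow> \<phi> = \<psi>"
  shows "V = {0}"
proof (rule ccontr)
  assume "V \<noteq> {0}"
  then obtain u where u: "u \<in> V" "u \<noteq> 0" using subspace_0[OF assms(1)] by blast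
  have ind: "independent {u}" using u by (simp add: independent_insert)
  let ?B = "extend_basis {u}"
  have B: "independent ?B" "span ?B = UNIV" "u \<in> ?B"
    using independent_extend_basis[OF ind] span_extend_basis[OF ind] extend_basis_superset[OF ind] by auto
  let ?\<phi> = "restrict (\<lambda>v. representation ?B v u) V"
  have "?\<phi> \<in> dual_space C V" unfolding dual_space_def
    using B subspace_add[OF assms(1)] subspace_scale[OF assms(1)]
    by (auto simp: representation_add representation_scale)
  moreover have "restrict (\<lambda>v. 0) V \<in> dual_space C V" unfolding dual_space_def
    using subspace_add[OF assms(1)] subspace_scale[OF assms(1)] by auto
  ultimately have "?\<phi> u = restrict (\<lambda>v. 0) V u" using assms(2) by metis
  then show False using u B by (simp add: representation_basis)
qed

lemma serre_perp:
  assumes serre: "serre_functor C F F'" and ob: "x \<in> Ob C" "y \<in> Ob C"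
  shows "x \<bottom> y \<longleftrightarrow> y \<bottom> fob F x"
proof -
  let ?V = "Hom C y (fob F x)"
  have Fx: "fob F x \<in> Ob C" using serre ob
    by (auto simp: serre_functor_def autoequivalence_def linear_functor_def)
  obtain \<eta> where bij: "bij_betw \<eta> (Hom C x y) (dual_space C ?V)"
    using serre ob unfolding serre_functor_def by blast
  have sV: "subspace ?V" using Hom_subspace ob Fx by blast
  show ?thesis
  proof
    assume "x \<bottom> y"
    then have "Hom C x y = {0}" using Hom_zero_iff ob by blast
    then have "dual_space C ?V = {\<eta> 0}" using bij by (auto simp: bij_betw_def)
    then have "?V = {0}" using zero_of_trivial_dual[OF sV] by auto
    then show "y \<bottom> fob F x" using Hom_zero_iff ob Fx by blast
  next
    assume "y \<bottom> fob F x"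
    then have V: "?V = {0}" using Hom_zero_iff ob Fx by blast
    have "\<phi> = \<psi>" if "\<phi> \<in> dual_space C ?V" "\<psi> \<in> dual_space C ?V" for \<phi> \<psi>
    proof (rule extensionalityI[of _ ?V])
      show "\<phi> \<in> extensional ?V" "\<psi> \<in> extensional ?V" using that by (auto simp: dual_space_def)
      fix v assume "v \<in> ?V"
      then have v: "v = 0" and V0: "0 \<in> ?V" using V by blast+
      have "\<phi> (scl C 0 0) = 0 * \<phi> 0" "\<psi> (scl C 0 0) = 0 * \<psi> 0"
        using that V0 unfolding dual_space_def mem_Collect_eq by blast+
      then show "\<phi> v = \<psi> v" using v by simp
    qed
    then have "f = g" if "f \<in> Hom C x y" "g \<in> Hom C x y" for f g
      using inj_onD[OF bij_betw_imp_inj_on[OF bij] _ that] bij_betwE[OF bij] that by metis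
    then show "x \<bottom> y" unfolding perp_def using arr_zero[OF ob] by (auto simp: arr_def)
  qed
qed

end

section \<open>The subcategory Z\<close>

locale reduction = triangulated_category C
  for C :: "('k::field, 'o, 'm::ab_group_add) tri_cat" (structure) +
  fixes SS SS' :: "('o, 'm) endo" and w :: nat and S :: "'o set"
    and T U :: "'o \<Rightarrow> 'o" and \<beta> :: "'o \<Rightarrow> 'm"
  assumes hom_finite: "hom_finite C"
    and serre: "serre_functor C SS SS'"
    and w: "1 \<le> w"
    and S_w_orthogonal: "w_orthogonal C w S"
    and S_serre: "serre_subcat C SS SS' (- int w) S"
    and S_functorially_finite: "functorially_finite C (ext_closure C S)"
    and choice: "reduction_choice C w S T \<beta> U"
begin

abbreviation Z where "Z \<equiv> Zob C w S"
abbreviation ZC where "ZC \<equiv> Zcat C w S T \<beta> U"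

lemma S_orth: "orthogonal w S"
  using orthogonal_of_w_orthogonal[OF hom_finite S_w_orthogonal] .

lemma ext_closure_S: "ext_closure C S = \<langle>S\<rangle>"
  using ext_closure_eq_layers[OF S_orth w] .

lemma S_Ob: "s \<in> S \<Longrightarrow> s \<in> Ob C"
  using orthogonal_ob[OF S_orth] .

lemma right_approximation:
  assumes "c \<in> Ob C" shows "\<exists>t \<alpha>. min_right_approx C \<langle>S\<rangle> t c \<alpha>"
  using min_right_approx_exists[OF S_orth w _ assms] S_functorially_finite assms
  unfolding functorially_finite_def ext_closure_S by blast

lemma left_approximation:
  assumes "d \<in> Ob C" shows "\<exists>t \<alpha>. min_left_approx C \<langle>S\<rangle> d t \<alpha>"
  using min_left_approx_exists[OF S_orth w _ assms] S_functorially_finite assms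
  unfolding functorially_finite_def ext_closure_S by blast

text \<open>
  Up to isomorphism \<open>S\<close> consists of the objects \<open>SS (\<Sigma>\<^sup>w s)\<close>, and Serre duality exchanges \<open>Hom(d,
  SS (\<Sigma>\<^sup>w s))\<close> with \<open>Hom(\<Sigma>\<^sup>w s, d)\<close>.
\<close>

lemma serre_S:
  assumes d: "d \<in> Ob C"
  shows "(\<forall>s \<in> S. d \<bottom> s) \<longleftrightarrow> (\<forall>s \<in> S. (\<Sigma> ^^ w) s \<bottom> d)"
proof -
  let ?F = "\<lambda>x. fob SS ((\<Sigma> ^^ w) x)"
  have eq: "S = iso_closure C (?F ` S)"
    using S_serre unfolding serre_subcat_def by (simp add: shift_pow_nonneg)
  have F: "?F s \<in> Ob C" if "s \<in> S" for s
    using serre funpow_shift_in[OF S_Ob[OF that]]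
    by (auto simp: serre_functor_def autoequivalence_def linear_functor_def)
  have d_iff: "(\<Sigma> ^^ w) s \<bottom> d \<longleftrightarrow> d \<bottom> ?F s" if "s \<in> S" for s
    using serre_perp[OF serre funpow_shift_in[OF S_Ob[OF that]] d] .
  show ?thesis
  proof (intro iffI ballI)
    fix s assume h: "\<forall>s \<in> S. d \<bottom> s" "s \<in> S"
    have "?F s \<in> iso_closure C (?F ` S)"
      unfolding iso_closure_def using F h(2) isomorphic_iff iso_ob_refl by blast
    then show "(\<Sigma> ^^ w) s \<bottom> d" using d_iff h eq by blast
  next
    fix s assume h: "\<forall>s \<in> S. (\<Sigma> ^^ w) s \<bottom> d" "s \<in> S"
    then obtain s' where s': "s' \<in> S" "isomorphic C (?F s') s" using eq unfolding iso_closure_def by blast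
    then have "?F s' \<cong> s" using isomorphic_iff F S_Ob h(2) by blast
    then show "d \<bottom> s" using d_iff[OF s'(1)] h(1) s'(1) perp_iso_right by blast
  qed
qed

lemma serre_S_shift:
  assumes d: "d \<in> Ob C" and i: "i \<le> w"
  shows "(\<forall>s \<in> S. (\<Sigma> ^^ i) d \<bottom> s) \<longleftrightarrow> (\<forall>s \<in> S. (\<Sigma> ^^ (w - i)) s \<bottom> d)"
proof -
  have "(\<Sigma> ^^ w) s \<bottom> (\<Sigma> ^^ i) d \<longleftrightarrow> (\<Sigma> ^^ (w - i)) s \<bottom> d" if "s \<in> S" for s
    using funpow_shift_perp_add[OF S_Ob[OF that] d, of i "w - i"] i by simp
  then show ?thesis using serre_S[OF funpow_shift_in[OF d]] by blast
qed

lemma Z_iff: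
  "d \<in> Z \<longleftrightarrow> d \<in> Ob C \<and> (\<forall>i < w. (\<forall>s \<in> S. (\<Sigma> ^^ i) s \<bottom> d) \<and> (\<forall>s \<in> S. (\<Sigma> ^^ i) d \<bottom> s))"
proof (cases "d \<in> Ob C")
  case d: True
  have "Hom C d (shift_pow C (- int i) s) = {0} \<longleftrightarrow> (\<Sigma> ^^ i) d \<bottom> s" if s: "s \<in> S" for i s
  proof -
    let ?u = "(unshift C ^^ i) s"
    note so = S_Ob[OF s] and uo = funpow_unshift_in[OF S_Ob[OF s], of i]
    have iso: "(\<Sigma> ^^ i) ?u \<cong> s" using funpow_shift_unshift[OF so] .
    have "Hom C d (shift_pow C (- int i) s) = {0} \<longleftrightarrow> d \<bottom> ?u"
      using Hom_zero_iff[OF d uo] by (simp add: shift_pow_nonpos)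
    also have "\<dots> \<longleftrightarrow> (\<Sigma> ^^ i) d \<bottom> (\<Sigma> ^^ i) ?u" using funpow_shift_perp[OF d uo] by blast
    also have "\<dots> \<longleftrightarrow> (\<Sigma> ^^ i) d \<bottom> s" using perp_iso_right iso iso_ob_sym[OF iso] by blast
    finally show ?thesis .
  qed
  moreover have "Hom C (shift_pow C (int i) s) d = {0} \<longleftrightarrow> (\<Sigma> ^^ i) s \<bottom> d" if s: "s \<in> S" for i s
    using Hom_zero_iff[OF funpow_shift_in[OF S_Ob[OF s]] d] by (simp add: shift_pow_nonneg)
  moreover have "i \<in> {0..w - 1} \<longleftrightarrow> i < w" for i using w by auto
  ultimately show ?thesis unfolding Zob_def using d by auto
qed (simp add: Zob_def)

text \<open>
  Serre duality turns the conditions on morphisms from \<open>d\<close> into conditions on morphisms to \<open>d\<close>, at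
  the price of the further degree \<open>i = w\<close>. This one-sided form makes the closure properties of \<open>Z\<close>
  accessible to right approximations alone.
\<close>

lemma Z_iff_right: "d \<in> Z \<longleftrightarrow> d \<in> Ob C \<and> (\<forall>i \<le> w. \<forall>s \<in> S. (\<Sigma> ^^ i) s \<bottom> d)"
proof
  assume d: "d \<in> Z"
  then have ob: "d \<in> Ob C" by (simp add: Z_iff)
  have "\<forall>s \<in> S. (\<Sigma> ^^ w) s \<bottom> d" using serre_S_shift[OF ob, of 0] d w unfolding Z_iff by auto
  then show "d \<in> Ob C \<and> (\<forall>i \<le> w. \<forall>s \<in> S. (\<Sigma> ^^ i) s \<bottom> d)" using d unfolding Z_iff by (metis le_neq_implies_less)
next
  assume d: "d \<in> Ob C \<and> (\<forall>i \<le> w. \<forall>s \<in> S. (\<Sigma> ^^ i) s \<bottom> d)"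
  have "\<forall>s \<in> S. (\<Sigma> ^^ i) d \<bottom> s" if "i < w" for i
    using serre_S_shift[of d i] d that by (meson diff_le_self less_imp_le)
  then show "d \<in> Z" using d unfolding Z_iff by (meson less_imp_le)
qed

lemma Z_iff_left: "d \<in> Z \<longleftrightarrow> d \<in> Ob C \<and> (\<forall>i \<le> w. \<forall>s \<in> S. (\<Sigma> ^^ i) d \<bottom> s)"
proof -
  have "(\<forall>i \<le> w. \<forall>s \<in> S. (\<Sigma> ^^ i) s \<bottom> d) \<longleftrightarrow> (\<forall>i \<le> w. \<forall>s \<in> S. (\<Sigma> ^^ (w - i)) s \<bottom> d)"
    by (metis diff_diff_cancel diff_le_self)
  then show ?thesis unfolding Z_iff_right using serre_S_shift by blast
qed

lemma Z_ob: "z \<in> Z \<Longrightarrow> z \<in> Ob C"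
  by (simp add: Z_iff)

lemma Z_iso: "\<lbrakk>z \<in> Z; z \<cong> z'\<rbrakk> \<Longrightarrow> z' \<in> Z"
  unfolding Z_iff_right using perp_iso_right iso_ob_in by blast

lemma Z_zero: "is_zero C z \<Longrightarrow> z \<in> Z"
  unfolding Z_iff_right using zero_ob zero_perp(1) funpow_shift_in S_Ob by blast

lemma hull_in_Ob: "t \<in> \<langle>S\<rangle> \<Longrightarrow> t \<in> Ob C"
  using layers_ob .

lemma hull_perp_Z: "\<lbrakk>t \<in> \<langle>S\<rangle>; z \<in> Z; i \<le> w\<rbrakk> \<Longrightarrow> (\<Sigma> ^^ i) t \<bottom> z"
  using shift_layers_perp Z_iff_right by blast

lemma Z_perp_hull: "\<lbrakk>t \<in> \<langle>S\<rangle>; z \<in> Z; i \<le> w\<rbrakk> \<Longrightarrow> (\<Sigma> ^^ i) z \<bottom> t"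
  using perp_layers funpow_shift_in Z_iff_left by blast

text \<open>
  Wakamatsu's lemma supplies the degree \<open>0\<close> that is missing for \<open>c\<close>. This puts \<open>x\<langle>1\<rangle>\<close> and the
  cones of \<open>Z\<close> in \<open>Z\<close>.
\<close>

lemma right_cone_in_Z:
  assumes "min_right_approx C \<langle>S\<rangle> t c \<alpha>" "tri C t c z \<alpha> b g"
    and "\<And>i s. \<lbrakk>1 \<le> i; i \<le> w; s \<in> S\<rbrakk> \<Longrightarrow> (\<Sigma> ^^ i) s \<bottom> c"
  shows "z \<in> Z"
  unfolding Z_iff_right
proof (intro conjI allI impI ballI)
  show "z \<in> Ob C" using tri_ob assms(2) by blast
  fix i s assume i: "i \<le> w" and s: "s \<in> S"
  show "(\<Sigma> ^^ i) s \<bottom> z"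
  proof (cases "i = 0")
    case True then show ?thesis using right_wakamatsu[OF S_orth w assms(1,2) s] by simp
  next
    case False then show ?thesis using right_cone_perp[OF S_orth w assms(1,2) s] assms(3) i s by simp
  qed
qed

lemma left_cocone_in_Z:
  assumes "min_left_approx C \<langle>S\<rangle> y t \<alpha>" "tri C e y t b \<alpha> g"
    and "\<And>i s. \<lbrakk>1 \<le> i; i \<le> w; s \<in> S\<rbrakk> \<Longrightarrow> (\<Sigma> ^^ i) y \<bottom> s"
  shows "e \<in> Z"
  unfolding Z_iff_left
proof (intro conjI allI impI ballI)
  show "e \<in> Ob C" using tri_ob assms(2) by blast
  fix i s assume i: "i \<le> w" and s: "s \<in> S"
  show "(\<Sigma> ^^ i) e \<bottom> s"
  proof (cases "i = 0")
    case True then show ?thesis using left_wakamatsu[OF S_orth w assms(1,2) s] by simp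
  next
    case False then show ?thesis using left_cocone_perp[OF S_orth w assms(1,2) s] assms(3) i s by simp
  qed
qed

lemma T_triangle:
  assumes x: "x \<in> Z"
  shows "\<exists>t \<alpha> \<gamma>. t \<in> \<langle>S\<rangle> \<and> tri C t (\<Sigma> x) (T x) \<alpha> (\<beta> x) \<gamma> \<and> T x \<in> Z \<and>
    min_right_approx C \<langle>S\<rangle> t (\<Sigma> x) \<alpha>"
proof -
  obtain t \<alpha> \<gamma> where t: "min_right_approx C \<langle>S\<rangle> t (\<Sigma> x) \<alpha>" "tri C t (\<Sigma> x) (T x) \<alpha> (\<beta> x) \<gamma>"
    using choice x unfolding reduction_choice_def ext_closure_S by blast
  have "(\<Sigma> ^^ i) s \<bottom> \<Sigma> x" if "1 \<le> i" "i \<le> w" "s \<in> S" for i s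
  proof -
    obtain j where j: "i = Suc j" using \<open>1 \<le> i\<close> by (cases i) auto
    then have "(\<Sigma> ^^ j) s \<bottom> x" using x that unfolding Z_iff_right by simp
    then show ?thesis using j shift_perp funpow_shift_in S_Ob that Z_ob x by simp
  qed
  then have "T x \<in> Z" using right_cone_in_Z[OF t] by blast
  moreover have "t \<in> \<langle>S\<rangle>" using t(1) by (simp add: min_right_approx_def right_approx_def)
  ultimately show ?thesis using t by blast
qed

lemma T_in_Z: "x \<in> Z \<Longrightarrow> T x \<in> Z"
  using T_triangle by blast

lemma U_triangle:
  assumes y: "y \<in> Z" shows "U y \<in> Z" "\<exists>t \<in> \<langle>S\<rangle>. triangle t (\<Sigma> (U y)) y"
proof -
  let ?u = "unshift C y"
  obtain t \<alpha> \<gamma> \<delta> where t: "min_left_approx C \<langle>S\<rangle> ?u t \<alpha>" "tri C (U y) ?u t \<delta> \<alpha> \<gamma>"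
    using choice y unfolding reduction_choice_def ext_closure_S by blast
  note yo = Z_ob[OF y]
  have iso: "\<Sigma> ?u \<cong> y" using shift_unshift[OF yo] .
  have "(\<Sigma> ^^ i) ?u \<bottom> s" if "1 \<le> i" "i \<le> w" "s \<in> S" for i s
  proof -
    obtain j where j: "i = Suc j" using \<open>1 \<le> i\<close> by (cases i) auto
    then have "(\<Sigma> ^^ j) y \<bottom> s" using y that unfolding Z_iff_left by simp
    then have "(\<Sigma> ^^ j) (\<Sigma> ?u) \<bottom> s"
      using perp_iso_left funpow_shift_iso[OF iso_ob_sym[OF iso]] by blast
    then show ?thesis using j by (simp add: funpow_swap1)
  qed
  then show "U y \<in> Z" using left_cocone_in_Z[OF t] by blast
  have tE: "t \<in> \<langle>S\<rangle>" using t(1) by (simp add: min_left_approx_def left_approx_def)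
  have "triangle t (\<Sigma> (U y)) (\<Sigma> ?u)"
    using rotate[OF rotate[OF t(2)]] triangle_def by blast
  then have "triangle t (\<Sigma> (U y)) y"
    using triangle_cong iso iso_ob_refl hull_in_Ob[OF tE] shift_in Z_ob \<open>U y \<in> Z\<close> by blast
  then show "\<exists>t \<in> \<langle>S\<rangle>. triangle t (\<Sigma> (U y)) y" using tE by blast
qed

section \<open>Local morphisms\<close>

text \<open>
  The morphism \<open>u\<close> induces bijections \<open>Hom(e,z) \<rightarrow> Hom(d,z)\<close> for all \<open>z\<close> in \<open>Z\<close>. If moreover \<open>e\<close>
  lies in \<open>Z\<close>, then \<open>u\<close> is the reflection of \<open>d\<close> in \<open>Z\<close> and \<open>e\<close> is determined by \<open>d\<close>. Objects of
  \<open>Z\<close> obtained by different approximations are compared in this way.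
\<close>

definition local :: "'o \<Rightarrow> 'o \<Rightarrow> 'm \<Rightarrow> bool" where
  "local d e u \<longleftrightarrow> arr u d e \<and> (\<forall>z \<in> Z. (\<forall>p. arr p d z \<longrightarrow> (\<exists>q. arr q e z \<and> q \<cdot> u = p)) \<and>
    (\<forall>q. arr q e z \<and> q \<cdot> u = 0 \<longrightarrow> q = 0))"

lemma local_cone:
  assumes t: "tri C e d d' a u b" and e: "\<And>z. z \<in> Z \<Longrightarrow> e \<bottom> z \<and> \<Sigma> e \<bottom> z"
  shows "local d d' u"
proof -
  note A = tri_arr[OF t]
  have 1: "\<exists>q. arr q d' z \<and> q \<cdot> u = p" if "z \<in> Z" "arr p d z" for z p
    using tri_extend[OF t that(2)] perpD e[OF that(1)] arr_comp[OF A(1) that(2)] by blast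
  have 2: "q = 0" if z: "z \<in> Z" and q: "arr q d' z" "q \<cdot> u = 0" for z q
  proof -
    obtain r where "arr r (\<Sigma> e) z" "r \<cdot> b = q" using tri_extend'[OF t q] by blast
    then show ?thesis using perpD e[OF z] comp_zero_left[OF A(3)] by blast
  qed
  show ?thesis unfolding local_def using A(2) 1 2 by blast
qed

lemma local_hull:
  assumes "tri C t d d' a u b" "t \<in> \<langle>S\<rangle>" shows "local d d' u"
proof (rule local_cone[OF assms(1)])
  fix z assume "z \<in> Z"
  then show "t \<bottom> z \<and> \<Sigma> t \<bottom> z" using hull_perp_Z[OF assms(2), of z 0] hull_perp_Z[OF assms(2), of z 1] w by simp
qed

text \<open>
  For a cocone in \<open>\<Sigma>\<langle>S\<rangle>\<close> also \<open>Hom(\<Sigma>\<^sup>2\<langle>S\<rangle>, Z) = 0\<close> is needed, hence \<open>2 \<le> w\<close>.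
\<close>

lemma local_shift_hull:
  assumes "tri C (\<Sigma> t) d d' a u b" "t \<in> \<langle>S\<rangle>" "2 \<le> w" shows "local d d' u"
proof (rule local_cone[OF assms(1)])
  fix z assume "z \<in> Z"
  then show "\<Sigma> t \<bottom> z \<and> \<Sigma> (\<Sigma> t) \<bottom> z"
    using hull_perp_Z[OF assms(2), of z 1] hull_perp_Z[OF assms(2), of z 2] assms(3) by (simp add: numeral_2_eq_2)
qed

lemma local_comp:
  assumes u: "local c d u" and v: "local d e v" shows "local c e (v \<cdot> u)"
proof -
  have a: "arr u c d" "arr v d e" using u v by (auto simp: local_def)
  have 1: "\<exists>q. arr q e z \<and> q \<cdot> (v \<cdot> u) = p" if z: "z \<in> Z" and p: "arr p c z" for z p
  proof -
    obtain q where q: "arr q d z" "q \<cdot> u = p" using u z p unfolding local_def by blast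
    obtain r where r: "arr r e z" "r \<cdot> v = q" using v z q(1) unfolding local_def by blast
    then show ?thesis using comp_assoc[OF a r(1)] q by auto
  qed
  have 2: "q = 0" if z: "z \<in> Z" and q: "arr q e z" "q \<cdot> (v \<cdot> u) = 0" for z q
  proof -
    have "(q \<cdot> v) \<cdot> u = 0" using comp_assoc[OF a q(1)] q(2) by simp
    then have "q \<cdot> v = 0" using u z arr_comp[OF a(2) q(1)] unfolding local_def by blast
    then show ?thesis using v z q(1) unfolding local_def by blast
  qed
  show ?thesis unfolding local_def using arr_comp[OF a] 1 2 by blast
qed

lemma local_cancel:
  assumes "local d e u" "z \<in> Z" "arr p e z" "arr q e z" "p \<cdot> u = q \<cdot> u" shows "p = q"
proof -
  have "arr u d e" using assms(1) by (simp add: local_def)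
  then have "(p - q) \<cdot> u = 0" using comp_diff_left assms(3-5) by simp
  then have "p - q = 0" using assms(1,2) arr_diff[OF assms(3,4)] unfolding local_def by blast
  then show ?thesis by simp
qed

lemma local_unique:
  assumes u: "local d z u" and v: "local d z' v" and z: "z \<in> Z" "z' \<in> Z" shows "z \<cong> z'"
proof -
  have a: "arr u d z" "arr v d z'" using u v by (auto simp: local_def)
  obtain f where f: "arr f z z'" "f \<cdot> u = v" using u z(2) a(2) unfolding local_def by blast
  obtain g where g: "arr g z' z" "g \<cdot> v = u" using v z(1) a(1) unfolding local_def by blast
  have "(g \<cdot> f) \<cdot> u = idm C z \<cdot> u" using comp_assoc[OF a(1) f(1) g(1)] f g comp_id_left[OF a(1)] by simp
  then have 1: "g \<cdot> f = idm C z"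
    using local_cancel[OF u z(1) arr_comp[OF f(1) g(1)] arr_id[OF Z_ob[OF z(1)]]] by blast
  have "(f \<cdot> g) \<cdot> v = idm C z' \<cdot> v" using comp_assoc[OF a(2) g(1) f(1)] f g comp_id_left[OF a(2)] by simp
  then have "f \<cdot> g = idm C z'"
    using local_cancel[OF v z(2) arr_comp[OF g(1) f(1)] arr_id[OF Z_ob[OF z(2)]]] by blast
  then show ?thesis using 1 f g unfolding iso_ob_def iso_iff by blast
qed

text \<open>
  Both \<open>Hom(\<Sigma> p, t)\<close> and \<open>Hom(\<Sigma> p, \<Sigma> t)\<close> vanish, so \<open>v\<close> induces a bijection \<open>Hom(\<Sigma> p, d) \<rightarrow> Hom(\<Sigma>
  p, a)\<close>.
\<close>

lemma desuspension_lift: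
  assumes p: "p \<in> Z" and t: "tri C t d a \<alpha> v \<gamma>" "t \<in> \<langle>S\<rangle>" and u: "arr u (\<Sigma> p) a"
  shows "\<exists>f. arr f (\<Sigma> p) d \<and> v \<cdot> f = u"
    and "\<And>f. \<lbrakk>arr f (\<Sigma> p) d; v \<cdot> f = 0\<rbrakk> \<Longrightarrow> f = 0"
proof -
  note A = tri_arr[OF t(1)]
  have 0: "\<Sigma> p \<bottom> \<Sigma> t" using Z_perp_hull[OF t(2) p, of 0] shift_perp Z_ob[OF p] hull_in_Ob[OF t(2)] by simp
  have 1: "\<Sigma> p \<bottom> t" using Z_perp_hull[OF t(2) p, of 1] w by simp
  show "\<exists>f. arr f (\<Sigma> p) d \<and> v \<cdot> f = u"
    using tri_lift'[OF t(1) u] perpD[OF 0 arr_comp[OF u A(3)]] by blast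
  show "f = 0" if f: "arr f (\<Sigma> p) d" "v \<cdot> f = 0" for f
  proof -
    obtain q where "arr q (\<Sigma> p) t" "\<alpha> \<cdot> q = f" using tri_lift[OF t(1) f] by blast
    then show ?thesis using perpD[OF 1] comp_zero_right[OF A(1)] by blast
  qed
qed

text \<open>
  An object \<open>p\<close> of \<open>Z\<close> is recovered from \<open>a = p\<langle>1\<rangle>\<close>. Since \<open>U\<close> and \<open>T\<close> both give such triangles,
  this also yields \<open>U (T z) \<cong> z\<close>.
\<close>

lemma desuspension_unique:
  assumes pq: "p \<in> Z" "q \<in> Z" and t: "triangle t (\<Sigma> p) a" "t \<in> \<langle>S\<rangle>"
    and t': "triangle t' (\<Sigma> q) a'" "t' \<in> \<langle>S\<rangle>" and a: "a \<cong> a'"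
  shows "p \<cong> q"
proof -
  have "triangle t (\<Sigma> p) a'"
    using triangle_cong[OF t(1) _ _ a] iso_ob_refl triangle_ob[OF t(1)] by blast
  then obtain \<alpha> u \<gamma> where u: "tri C t (\<Sigma> p) a' \<alpha> u \<gamma>" unfolding triangle_def by blast
  obtain \<alpha>' v \<gamma>' where v: "tri C t' (\<Sigma> q) a' \<alpha>' v \<gamma>'" using t' unfolding triangle_def by blast
  note A = tri_arr(2)[OF u] tri_arr(2)[OF v]
  obtain f where f: "arr f (\<Sigma> p) (\<Sigma> q)" "v \<cdot> f = u" using desuspension_lift(1)[OF pq(1) v t'(2) A(1)] by blast
  obtain g where g: "arr g (\<Sigma> q) (\<Sigma> p)" "u \<cdot> g = v" using desuspension_lift(1)[OF pq(2) u t(2) A(2)] by blast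
  have ob: "\<Sigma> p \<in> Ob C" "\<Sigma> q \<in> Ob C" using f arr_ob by auto
  note fg = arr_comp[OF f(1) g(1)] arr_comp[OF g(1) f(1)]
  have "u \<cdot> (g \<cdot> f - idm C (\<Sigma> p)) = 0"
    using comp_diff_right[OF fg(1) arr_id[OF ob(1)] A(1)] comp_assoc[OF f(1) g(1) A(1)] f g comp_id_right[OF A(1)]
    by simp
  then have 1: "g \<cdot> f - idm C (\<Sigma> p) = 0"
    using desuspension_lift(2)[OF pq(1) u t(2) A(1)] arr_diff[OF fg(1) arr_id[OF ob(1)]] by blast
  have "v \<cdot> (f \<cdot> g - idm C (\<Sigma> q)) = 0"
    using comp_diff_right[OF fg(2) arr_id[OF ob(2)] A(2)] comp_assoc[OF g(1) f(1) A(2)] f g comp_id_right[OF A(2)]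
    by simp
  then have "f \<cdot> g - idm C (\<Sigma> q) = 0"
    using desuspension_lift(2)[OF pq(2) v t'(2) A(2)] arr_diff[OF fg(2) arr_id[OF ob(2)]] by blast
  then have "\<Sigma> p \<cong> \<Sigma> q" using 1 f g unfolding iso_ob_def iso_iff by force
  then show ?thesis using shift_iso_ob_reflect Z_ob pq by blast
qed

text \<open>
  Morphisms from \<open>\<Sigma>\<^sup>j (z\<langle>1\<rangle>)\<close> and from \<open>\<Sigma>\<^sup>j\<^sup>+\<^sup>1 z\<close> to \<open>Z\<close> differ by morphisms from \<open>\<Sigma>\<^sup>j\<langle>S\<rangle>\<close> and
  \<open>\<Sigma>\<^sup>j\<^sup>+\<^sup>1\<langle>S\<rangle>\<close>, which vanish in this range of degrees.
\<close>

lemma T_perp: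
  assumes x: "x \<in> Z" and y: "y \<in> Z" and k: "k < w"
  shows "(T ^^ k) x \<in> Z \<and> ((T ^^ k) x \<bottom> y \<longleftrightarrow> (\<Sigma> ^^ k) x \<bottom> y)"
proof -
  have step: "(\<Sigma> ^^ j) (T z) \<bottom> y \<longleftrightarrow> (\<Sigma> ^^ Suc j) z \<bottom> y" if z: "z \<in> Z" and j: "Suc j < w" for z j
  proof -
    obtain t \<alpha> \<gamma> where t: "t \<in> \<langle>S\<rangle>" "tri C t (\<Sigma> z) (T z) \<alpha> (\<beta> z) \<gamma>" using T_triangle[OF z] by blast
    have "triangle t (\<Sigma> z) (T z)" "triangle (\<Sigma> z) (T z) (\<Sigma> t)"
      using t(2) rotate triangle_def by blast+
    then have tr: "triangle ((\<Sigma> ^^ j) t) ((\<Sigma> ^^ j) (\<Sigma> z)) ((\<Sigma> ^^ j) (T z))"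
      "triangle ((\<Sigma> ^^ j) (\<Sigma> z)) ((\<Sigma> ^^ j) (T z)) ((\<Sigma> ^^ j) (\<Sigma> t))"
      using triangle_funpow_shift by blast+
    have "(\<Sigma> ^^ j) t \<bottom> y" "(\<Sigma> ^^ j) (\<Sigma> t) \<bottom> y"
      using hull_perp_Z[OF t(1) y, of j] hull_perp_Z[OF t(1) y, of "Suc j"] j by (simp_all add: funpow_swap1)
    then have "(\<Sigma> ^^ j) (T z) \<bottom> y \<longleftrightarrow> (\<Sigma> ^^ j) (\<Sigma> z) \<bottom> y"
      using tr perp_middle_left unfolding triangle_def by blast
    then show ?thesis by (simp add: funpow_swap1)
  qed
  have "(T ^^ i) x \<in> Z \<and> (i \<le> k \<longrightarrow> ((\<Sigma> ^^ (k - i)) ((T ^^ i) x) \<bottom> y \<longleftrightarrow> (\<Sigma> ^^ k) x \<bottom> y))" for i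
  proof (induction i)
    case (Suc i)
    show ?case
    proof (intro conjI impI)
      show "(T ^^ Suc i) x \<in> Z" using Suc T_in_Z by simp
      assume i: "Suc i \<le> k"
      then show "(\<Sigma> ^^ (k - Suc i)) ((T ^^ Suc i) x) \<bottom> y \<longleftrightarrow> (\<Sigma> ^^ k) x \<bottom> y"
        using Suc step[of "(T ^^ i) x" "k - Suc i"] k by (simp add: Suc_diff_Suc)
    qed
  qed (simp add: x)
  from this[of k] show ?thesis by simp
qed

section \<open>Triangles of Z\<close>

lemma ZC_simps [simp]:
  "Ob ZC = Z" "Hom ZC = Hom C" "idm ZC = idm C" "cmp ZC = cmp C" "scl ZC = scl C"
  "unshift ZC = U" "fob (shift ZC) = T" "tri ZC = Ztri C w S T \<beta>"
  by (simp_all add: Zcat_def Zshift_def)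

lemma isomorphic_ZC: "isomorphic ZC = isomorphic C"
  by (intro ext) (simp add: isomorphic_def is_iso_def)

lemma is_zero_ZC: "is_zero ZC z \<longleftrightarrow> is_zero C z"
proof
  assume z: "is_zero ZC z"
  then have "z \<in> Z" "Hom C z z = {0}" by (auto simp: is_zero_def)
  then show "is_zero C z" using perp_self_zero Hom_zero_iff Z_ob by blast
next
  assume z: "is_zero C z"
  then show "is_zero ZC z" using Z_zero[OF z] Z_ob by (auto simp: is_zero_def)
qed

lemma direct_sum_ZC: "direct_sum ZC b xs \<longleftrightarrow> b \<in> Z \<and> set xs \<subseteq> Z \<and> direct_sum C b xs"
  using Z_ob by (auto simp: direct_sum_def)

lemma shift_pow_ZC: "shift_pow ZC (int k) x = (T ^^ k) x" "shift_pow ZC (- int k) x = (U ^^ k) x"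
  by (simp add: shift_pow_def) (cases "k = 0", auto simp: shift_pow_def)

lemma cone_perp:
  assumes t: "tri C x y c f g h" and xy: "x \<in> Z" "y \<in> Z" and i: "1 \<le> i" "i \<le> w" and s: "s \<in> S"
  shows "(\<Sigma> ^^ i) s \<bottom> c"
proof -
  obtain j where j: "i = Suc j" using i by (cases i) auto
  have "(\<Sigma> ^^ j) s \<bottom> x" using xy(1) j i(2) s unfolding Z_iff_right by simp
  then have "(\<Sigma> ^^ i) s \<bottom> \<Sigma> x" using j shift_perp funpow_shift_in S_Ob s Z_ob xy by simp
  moreover have "(\<Sigma> ^^ i) s \<bottom> y" using xy(2) i s unfolding Z_iff_right by simp
  ultimately show ?thesis using perp_cone_right[OF t] by blast
qed

text \<open>
  The third morphism exists because \<open>b\<close> is local.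
\<close>

lemma Zstandard_intro:
  assumes xy: "x \<in> Z" "y \<in> Z" and c: "tri C x y c f g1 h1"
    and t: "min_right_approx C \<langle>S\<rangle> t c \<alpha>" "tri C t c z \<alpha> b \<gamma>"
  shows "z \<in> Z" "\<exists>h. Zstandard C w S T \<beta> x y z f (b \<cdot> g1) h"
proof -
  show "z \<in> Z" using right_cone_in_Z[OF t] cone_perp[OF c xy] by blast
  have tE: "t \<in> \<langle>S\<rangle>" using t(1) by (simp add: min_right_approx_def right_approx_def)
  obtain tx \<alpha>x \<gamma>x where tx: "tri C tx (\<Sigma> x) (T x) \<alpha>x (\<beta> x) \<gamma>x" using T_triangle[OF xy(1)] by blast
  have "arr (\<beta> x \<cdot> h1) c (T x)" using arr_comp tri_arr(3)[OF c] tri_arr(2)[OF tx] by blast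
  then obtain h where "arr h z (T x)" and h: "h \<cdot> b = \<beta> x \<cdot> h1"
    using local_hull[OF t(2) tE] T_in_Z[OF xy(1)] unfolding local_def by blast
  then have "h \<in> Hom C z (T x)" "f \<in> Hom C x y" using tri_arr(1)[OF c] by (auto simp: arr_def)
  then show "\<exists>h. Zstandard C w S T \<beta> x y z f (b \<cdot> g1) h"
    unfolding Zstandard_def ext_closure_S using xy c t h by blast
qed

definition standard :: "'o \<Rightarrow> 'o \<Rightarrow> 'o \<Rightarrow> bool" where
  "standard x y z \<longleftrightarrow> (\<exists>f g h. Zstandard C w S T \<beta> x y z f g h)"

lemma standard_elim:
  assumes "Zstandard C w S T \<beta> x y z f g h"
  obtains c g1 h1 t \<alpha> b \<gamma> where "x \<in> Z" "y \<in> Z" "z \<in> Z" "tri C x y c f g1 h1"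
    "min_right_approx C \<langle>S\<rangle> t c \<alpha>" "tri C t c z \<alpha> b \<gamma>" "t \<in> \<langle>S\<rangle>" "g = b \<cdot> g1" "arr h z (T x)"
proof -
  obtain c g1 h1 t \<alpha> b \<gamma> where *: "x \<in> Z" "y \<in> Z" "tri C x y c f g1 h1"
    "min_right_approx C \<langle>S\<rangle> t c \<alpha>" "tri C t c z \<alpha> b \<gamma>" "g = b \<cdot> g1" "h \<in> Hom C z (T x)"
    using assms unfolding Zstandard_def ext_closure_S by blast
  moreover have "z \<in> Z" using Zstandard_intro(1)[OF *(1-5)] .
  moreover have "t \<in> \<langle>S\<rangle>" using *(4) by (simp add: min_right_approx_def right_approx_def)
  moreover have "arr h z (T x)" using *(7) Z_ob T_in_Z \<open>z \<in> Z\<close> *(1) by (simp add: arr_def)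
  ultimately show ?thesis using that by blast
qed

lemma standard_in_Z: "standard x y z \<Longrightarrow> x \<in> Z \<and> y \<in> Z \<and> z \<in> Z"
  unfolding standard_def using standard_elim by metis

lemma Zshift_id: "x \<in> Z \<Longrightarrow> fmor (Zshift C T \<beta>) x x (idm C x) = idm C (T x)"
proof -
  assume x: "x \<in> Z"
  obtain t \<alpha> \<gamma> where t: "t \<in> \<langle>S\<rangle>" "tri C t (\<Sigma> x) (T x) \<alpha> (\<beta> x) \<gamma>" "T x \<in> Z" using T_triangle[OF x] by blast
  note b = tri_arr(2)[OF t(2)]
  have e: "idm C (T x) \<cdot> \<beta> x = \<beta> x" "\<beta> x \<cdot> \<Sigma>\<^sub>m x x (idm C x) = \<beta> x"
    using comp_id_left[OF b] comp_id_right[OF b] shift_id[OF Z_ob[OF x]] by auto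
  have u: "f' = idm C (T x)" if "f' \<in> Hom C (T x) (T x)" "f' \<cdot> \<beta> x = \<beta> x" for f'
    using local_cancel[OF local_hull[OF t(2,1)] t(3) _ arr_id] that e(1) Z_ob[OF t(3)] by (simp add: arr_def)
  show ?thesis unfolding Zshift_def endo.simps
    by (rule the_equality) (use e u idm_in Z_ob[OF t(3)] in auto)
qed

lemma Ztri_of_Zstandard:
  assumes s: "Zstandard C w S T \<beta> x y z f g h" shows "Ztri C w S T \<beta> x y z f g h"
proof -
  obtain c g1 h1 t \<alpha> b \<gamma> where *: "x \<in> Z" "y \<in> Z" "z \<in> Z" "tri C x y c f g1 h1"
    "min_right_approx C \<langle>S\<rangle> t c \<alpha>" "tri C t c z \<alpha> b \<gamma>" "t \<in> \<langle>S\<rangle>" "g = b \<cdot> g1" "arr h z (T x)"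
    using standard_elim[OF s] by blast
  have f: "arr f x y" "arr g y z" "arr h z (T x)"
    using tri_arr[OF *(4)] tri_arr[OF *(6)] arr_comp *(8,9) by blast+
  have i: "is_iso C v v (idm C v)" if "v \<in> Z" for v using iso_idm Z_ob[OF that] by (simp add: iso_def)
  have "idm C y \<cdot> f = f \<cdot> idm C x" "idm C z \<cdot> g = g \<cdot> idm C y"
    "fmor (Zshift C T \<beta>) x x (idm C x) \<cdot> h = h \<cdot> idm C z"
    using f comp_id_left comp_id_right Zshift_id *(1) by simp_all
  then show ?thesis unfolding Ztri_def using s i[OF *(1)] i[OF *(2)] i[OF *(3)] *(1-3) f
    unfolding arr_def by blast
qed

lemma standard_exists:
  assumes xy: "x \<in> Z" "y \<in> Z" and c: "tri C x y c f g1 h1"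
  shows "\<exists>t \<alpha> b \<gamma> z. min_right_approx C \<langle>S\<rangle> t c \<alpha> \<and> t \<in> \<langle>S\<rangle> \<and> tri C t c z \<alpha> b \<gamma> \<and> z \<in> Z \<and> standard x y z"
proof -
  obtain t \<alpha> where t: "min_right_approx C \<langle>S\<rangle> t c \<alpha>" using right_approximation tri_ob(3)[OF c] by blast
  then have tE: "t \<in> \<langle>S\<rangle>" "\<alpha> \<in> Hom C t c" by (auto simp: min_right_approx_def right_approx_def)
  then have "arr \<alpha> t c" using hull_in_Ob tri_ob(3)[OF c] by (simp add: arr_def)
  then obtain z b \<gamma> where z: "tri C t c z \<alpha> b \<gamma>" using cone_exists by blast
  have "standard x y z" using Zstandard_intro(2)[OF xy c t z] unfolding standard_def by blast
  then show ?thesis using t tE z Zstandard_intro(1)[OF xy c t z] by blast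
qed

text \<open>
  Extension-closed subcategories of \<open>Z\<close> in terms of standard triangles only; the next two lemmas
  show that this is the same as \<open>ext_closed ZC\<close>.
\<close>

definition Zclosed :: "'o set \<Rightarrow> bool" where
  "Zclosed Y \<longleftrightarrow> Y \<subseteq> Z \<and> (\<forall>z. is_zero C z \<longrightarrow> z \<in> Y) \<and> (\<forall>x y. x \<in> Y \<and> x \<cong> y \<longrightarrow> y \<in> Y) \<and>
    (\<forall>x d y. x \<in> Y \<and> y \<in> Y \<and> standard x d y \<longrightarrow> d \<in> Y)"

lemma Zclosed_of_ext_closed:
  assumes Y: "ext_closed ZC Y" shows "Zclosed Y"
proof -
  have YZ: "Y \<subseteq> Z" using Y by (simp add: ext_closed_def strict_subcat_def)
  have "y \<in> Y" if "x \<in> Y" "x \<cong> y" for x y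
  proof -
    have "y \<in> Z" using Z_iso YZ that by blast
    moreover have "isomorphic C x y" using isomorphic_iff iso_ob_in that(2) by blast
    ultimately show ?thesis
      using Y that(1) by (simp add: ext_closed_def strict_subcat_def isomorphic_ZC)
  qed
  moreover have "d \<in> Y" if x: "x \<in> Y" "y \<in> Y" and s: "standard x d y" for x d y
  proof -
    obtain f g h where "Ztri C w S T \<beta> x d y f g h" using s Ztri_of_Zstandard unfolding standard_def by blast
    moreover have "d \<in> Z" using standard_in_Z s by blast
    ultimately have "d \<in> ext_star ZC Y Y" unfolding ext_star_def ZC_simps using x by blast
    then show ?thesis using Y by (simp add: ext_closed_def)
  qed
  moreover have "\<forall>z. is_zero C z \<longrightarrow> z \<in> Y" using Y by (simp add: ext_closed_def is_zero_ZC)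
  ultimately show ?thesis unfolding Zclosed_def using YZ by blast
qed

lemma ext_closed_of_Zclosed:
  assumes Y: "Zclosed Y" shows "ext_closed ZC Y"
proof -
  have YZ: "Y \<subseteq> Z" and zero: "\<And>z. is_zero C z \<Longrightarrow> z \<in> Y" and iso: "\<And>x y. \<lbrakk>x \<in> Y; x \<cong> y\<rbrakk> \<Longrightarrow> y \<in> Y"
    and ext: "\<And>x d y. \<lbrakk>x \<in> Y; y \<in> Y; standard x d y\<rbrakk> \<Longrightarrow> d \<in> Y"
    using Y unfolding Zclosed_def by blast+
  have strict: "strict_subcat ZC Y"
    unfolding strict_subcat_def isomorphic_ZC ZC_simps
  proof (intro conjI ballI impI YZ)
    fix x y assume "x \<in> Y" "y \<in> Z" "isomorphic C x y"
    then show "y \<in> Y" using iso isomorphic_iff Z_ob YZ by blast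
  qed
  have "ext_star ZC Y Y \<subseteq> Y"
  proof
    fix d assume "d \<in> ext_star ZC Y Y"
    then obtain x y f g h where x: "x \<in> Y" "y \<in> Y" and d: "d \<in> Z" and t: "Ztri C w S T \<beta> x d y f g h"
      unfolding ext_star_def by auto
    obtain x' d' y' f' g' h' a b c where s: "Zstandard C w S T \<beta> x' d' y' f' g' h'"
      and i: "is_iso C x x' a" "is_iso C d d' b" "is_iso C y y' c"
      using t unfolding Ztri_def by blast
    have st: "standard x' d' y'" using s standard_def by blast
    have "x \<cong> x'" "d \<cong> d'" "y \<cong> y'"
      using i standard_in_Z[OF st] Z_ob YZ x d unfolding iso_ob_def iso_def by blast+
    then show "d \<in> Y" using iso x ext st iso_ob_sym by blast
  qed
  moreover have "Y \<subseteq> ext_star ZC Y Y"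
  proof
    fix d assume d: "d \<in> Y"
    then have dZ: "d \<in> Z" using YZ by blast
    obtain o' where o': "is_zero C o'" using zero_exists by blast
    have c: "tri C d d o' (idm C d) 0 0" using tri_id[OF Z_ob[OF dZ] o'] .
    obtain t \<alpha> b \<gamma> z where t: "min_right_approx C \<langle>S\<rangle> t o' \<alpha>" "tri C t o' z \<alpha> b \<gamma>" "z \<in> Z" "standard d d z"
      "t \<in> \<langle>S\<rangle>" using standard_exists[OF dZ dZ c] by blast
    have "b = 0" using zero_arr(2)[OF o' tri_arr(2)[OF t(2)]] .
    moreover have "local o' z b" using local_hull[OF t(2,5)] .
    ultimately have "idm C z = 0"
      using t(3) arr_id[OF Z_ob[OF t(3)]] comp_zero_right[OF arr_id[OF Z_ob[OF t(3)]]]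
      unfolding local_def by blast
    then have "z \<in> Y" using zero zero_iff Z_ob[OF t(3)] by blast
    moreover obtain f g h where "Ztri C w S T \<beta> d d z f g h"
      using t(4) Ztri_of_Zstandard unfolding standard_def by blast
    ultimately show "d \<in> ext_star ZC Y Y" unfolding ext_star_def ZC_simps using d dZ by blast
  qed
  ultimately have "ext_star ZC Y Y = Y" by (rule subset_antisym)
  then show ?thesis unfolding ext_closed_def using strict zero by (simp add: is_zero_ZC)
qed

lemma U_iso:
  assumes "a \<in> Z" "a \<cong> b" shows "U a \<cong> U b"
proof -
  have b: "b \<in> Z" using Z_iso assms by blast
  obtain t where t: "t \<in> \<langle>S\<rangle>" "triangle t (\<Sigma> (U a)) a" using U_triangle(2)[OF assms(1)] by blast
  obtain t' where t': "t' \<in> \<langle>S\<rangle>" "triangle t' (\<Sigma> (U b)) b" using U_triangle(2)[OF b] by blast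
  show ?thesis
    using desuspension_unique[OF U_triangle(1)[OF assms(1)] U_triangle(1)[OF b] t(2,1) t'(2,1) assms(2)] .
qed

lemma U_zero:
  assumes a: "is_zero C a" shows "is_zero C (U a)"
proof -
  have aZ: "a \<in> Z" using Z_zero a .
  obtain t where t: "t \<in> \<langle>S\<rangle>" "triangle t (\<Sigma> (U a)) a" using U_triangle(2)[OF aZ] by blast
  have sa: "is_zero C (\<Sigma> a)" using shift_zero_ob Z_ob aZ a by blast
  have "\<Sigma> a \<cong> a" using zero_iso_zero[OF sa a] iso_ob_def by blast
  then have "triangle a (\<Sigma> a) a" using triangle_trivial_right a by blast
  then have "a \<cong> U a"
    using desuspension_unique[OF aZ U_triangle(1)[OF aZ] _ layers_zero[OF a] t(2,1) iso_ob_refl[OF Z_ob[OF aZ]]]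
    by blast
  then show ?thesis using zero_iso a by blast
qed

lemma U_T:
  assumes z: "z \<in> Z" shows "U (T z) \<cong> z"
proof -
  obtain t where t: "t \<in> \<langle>S\<rangle>" "triangle t (\<Sigma> z) (T z)" "T z \<in> Z"
    using T_triangle[OF z] unfolding triangle_def by blast
  obtain t' where t': "t' \<in> \<langle>S\<rangle>" "triangle t' (\<Sigma> (U (T z))) (T z)" using U_triangle(2)[OF t(3)] by blast
  show ?thesis
    using desuspension_unique[OF U_triangle(1)[OF t(3)] z t'(2,1) t(2,1) iso_ob_refl[OF Z_ob[OF t(3)]]] .
qed

text \<open>
  Exactness of \<open>\<langle>-1\<rangle>\<close> on objects. Let \<open>f'\<close> lift \<open>f\<close> to \<open>U x \<rightarrow> U y\<close>, with cone \<open>c'\<close> in the ambient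
  category and \<open>z'\<close> in \<open>Z\<close>. The octahedra over \<open>\<Sigma>(U x) \<rightarrow> \<Sigma>(U y) \<rightarrow> y\<close> and \<open>\<Sigma>(U x) \<rightarrow> x \<rightarrow> y\<close> share
  the cone \<open>k\<close> of the composite and give local morphisms \<open>\<Sigma> c' \<rightarrow> k \<rightarrow> c \<rightarrow> z\<close>. On the other side \<open>\<Sigma>
  c' \<rightarrow> \<Sigma> z' \<rightarrow> T z'\<close> are local as well. So \<open>T z' \<cong> z\<close>, that is, \<open>z' \<cong> U z\<close>.
\<close>

lemma U_standard:
  assumes s: "standard x y z" and w2: "2 \<le> w" shows "\<exists>z'. standard (U x) (U y) z' \<and> z' \<cong> U z"
proof -
  obtain f g h where "Zstandard C w S T \<beta> x y z f g h" using s standard_def by blast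
  then obtain c g1 h1 t \<alpha> b \<gamma> where x: "x \<in> Z" "y \<in> Z" "z \<in> Z" and c: "tri C x y c f g1 h1"
    and t: "tri C t c z \<alpha> b \<gamma>" "t \<in> \<langle>S\<rangle>" by (rule standard_elim) blast
  note U = U_triangle(1)[OF x(1)] U_triangle(1)[OF x(2)] U_triangle(1)[OF x(3)]
  obtain tx \<alpha>x ux \<gamma>x where tx: "tx \<in> \<langle>S\<rangle>" "tri C tx (\<Sigma> (U x)) x \<alpha>x ux \<gamma>x"
    using U_triangle(2)[OF x(1)] unfolding triangle_def by blast
  obtain ty \<alpha>y uy \<gamma>y where ty: "ty \<in> \<langle>S\<rangle>" "tri C ty (\<Sigma> (U y)) y \<alpha>y uy \<gamma>y"
    using U_triangle(2)[OF x(2)] unfolding triangle_def by blast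
  note f = tri_arr(1)[OF c] and ux = tri_arr(2)[OF tx(2)] and uy = tri_arr(2)[OF ty(2)]
  obtain F where F: "arr F (\<Sigma> (U x)) (\<Sigma> (U y))" "uy \<cdot> F = f \<cdot> ux"
    using desuspension_lift(1)[OF U(1) ty(2,1) arr_comp[OF ux f]] by blast
  obtain f' where f': "arr f' (U x) (U y)" "\<Sigma>\<^sub>m (U x) (U y) f' = F"
    using shift_full[OF F(1)] Z_ob U by blast
  obtain c' g' h' where c': "tri C (U x) (U y) c' f' g' h'" using cone_exists f'(1) by blast
  obtain t' \<alpha>' b' \<gamma>' z' where t': "t' \<in> \<langle>S\<rangle>" "tri C t' c' z' \<alpha>' b' \<gamma>'" and z': "z' \<in> Z" "standard (U x) (U y) z'"
    using standard_exists[OF U(1,2) c'] by blast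
  obtain k q q' where k: "tri C (\<Sigma> (U x)) y k (uy \<cdot> F) q q'" using cone_exists arr_comp[OF F(1) uy] by blast
  have ob: "ty \<in> Ob C" "tx \<in> Ob C" using ty tx hull_in_Ob by auto
  obtain v1 j1 i1 where "tri C (\<Sigma> c') k (\<Sigma> ty) v1 j1 i1"
    using octahedral_cones[OF shift_triangle[OF c', unfolded f'(2)] k uy rotate[OF ty(2)]] by blast
  then obtain e1 where l1: "tri C ty (\<Sigma> c') k e1 v1 j1" using rotate_back_full ob by blast
  have k2: "tri C (\<Sigma> (U x)) y k (f \<cdot> ux) q q'" using k F(2) by simp
  obtain e2 v2 i2 where l2: "tri C (\<Sigma> tx) k c e2 v2 i2"
    using octahedral_cones[OF rotate[OF tx(2)] k2 f c] by blast
  have "local (\<Sigma> c') z (b \<cdot> (v2 \<cdot> v1))"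
    using local_comp[OF local_comp[OF local_hull[OF l1 ty(1)] local_shift_hull[OF l2 tx(1) w2]] local_hull[OF t]] .
  moreover obtain tz \<alpha>z \<gamma>z where tz: "tz \<in> \<langle>S\<rangle>" "tri C tz (\<Sigma> z') (T z') \<alpha>z (\<beta> z') \<gamma>z" "T z' \<in> Z"
    using T_triangle[OF z'(1)] by blast
  moreover have "local (\<Sigma> c') (T z') (\<beta> z' \<cdot> \<Sigma>\<^sub>m c' z' b')"
    using local_comp[OF local_shift_hull[OF shift_triangle[OF t'(2)] t'(1) w2] local_hull[OF tz(2,1)]] .
  ultimately have iso: "T z' \<cong> z" using local_unique x(3) by blast
  obtain tu where tu: "tu \<in> \<langle>S\<rangle>" "triangle tu (\<Sigma> (U z)) z" using U_triangle(2)[OF x(3)] by blast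
  have "triangle tz (\<Sigma> z') (T z')" using tz(2) triangle_def by blast
  then have "z' \<cong> U z" using desuspension_unique[OF z'(1) U(3) _ tz(1) tu(2,1) iso] by blast
  then show ?thesis using z'(2) by blast
qed

lemma Zclosed_preimage_U:
  assumes Y: "Zclosed Y" and w2: "2 \<le> w" shows "Zclosed {a \<in> Z. U a \<in> Y}"
proof -
  have zero: "\<And>z. is_zero C z \<Longrightarrow> z \<in> Y" and iso: "\<And>x y. \<lbrakk>x \<in> Y; x \<cong> y\<rbrakk> \<Longrightarrow> y \<in> Y"
    and ext: "\<And>x d y. \<lbrakk>x \<in> Y; y \<in> Y; standard x d y\<rbrakk> \<Longrightarrow> d \<in> Y"
    using Y unfolding Zclosed_def by blast+
  have "U d \<in> Y" if xy: "U x \<in> Y" "U y \<in> Y" and s: "standard x d y" for x d y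
  proof -
    obtain z' where z': "standard (U x) (U d) z'" "z' \<cong> U y" using U_standard[OF s w2] by blast
    then have "z' \<in> Y" using iso xy(2) iso_ob_sym by blast
    then show ?thesis using ext xy(1) z'(1) by blast
  qed
  moreover have "U y \<in> Y \<and> y \<in> Z" if "x \<in> Z" "U x \<in> Y" "x \<cong> y" for x y
    using U_iso[OF that(1,3)] iso that(2) Z_iso[OF that(1,3)] by blast
  moreover have "U z \<in> Y \<and> z \<in> Z" if "is_zero C z" for z using zero U_zero Z_zero that by blast
  ultimately show ?thesis unfolding Zclosed_def using standard_in_Z by blast
qed

section \<open>Orthogonal collections in D and in Z\<close>

lemma S_Z_disjoint: "S \<inter> Z = {}"
proof -
  have False if s: "s \<in> S" "s \<in> Z" for s
  proof -
    have "(\<Sigma> ^^ 0) s \<bottom> s" using s unfolding Z_iff_right by blast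
    then show False using perpD arr_id[OF S_Ob[OF s(1)]] S_orth s(1) by (auto simp: orthogonal_def)
  qed
  then show ?thesis by blast
qed

text \<open>
  An \<open>x\<close> outside \<open>S\<close> is not isomorphic to a member of \<open>S\<close>, so the Schur lemma gives degree \<open>0\<close> of
  the conditions that define \<open>Z\<close>.
\<close>

lemma orthogonal_cases:
  assumes X: "orthogonal w X" "S \<subseteq> X" and x: "x \<in> X" shows "x \<in> S \<or> x \<in> Z"
proof (cases "x \<in> S")
  case False
  have ob: "x \<in> Ob C" using orthogonal_ob X x by blast
  have p: "(\<Sigma> ^^ i) s \<bottom> x \<and> (\<Sigma> ^^ i) x \<bottom> s" if i: "i < w" and s: "s \<in> S" for i s
  proof (cases "i = 0")
    case True
    have "\<not> s \<cong> x" using orthogonal_iso_closed[OF S_orth s] False by blast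
    then have "s \<bottom> x" "x \<bottom> s"
      using orthogonal_iso[OF X(1)] X(2) s x iso_ob_def iso_ob_sym unfolding perp_def by blast+
    then show ?thesis using True by simp
  next
    case False
    then have "1 \<le> i" by simp
    then show ?thesis using orthogonal_perp[OF X(1)] X(2) s x i by blast
  qed
  then show ?thesis using ob unfolding Z_iff by blast
qed simp

lemma w_orthogonal_restrict:
  assumes X: "w_orthogonal C w X" shows "w_orthogonal ZC w (X \<inter> Z)"
proof -
  have o: "orthogonal w X" using orthogonal_of_w_orthogonal[OF hom_finite X] .
  have "strict_subcat ZC (X \<inter> Z)"
    using X Z_ob unfolding w_orthogonal_def strict_subcat_def isomorphic_ZC by auto
  moreover have "Hom C ((T ^^ k) x) y = {0}" if "k \<in> {1..w - 1}" "x \<in> X \<inter> Z" "y \<in> X \<inter> Z" for k x y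
  proof -
    have k: "1 \<le> k" "k < w" using that(1) by auto
    have "(\<Sigma> ^^ k) x \<bottom> y" using orthogonal_perp[OF o _ _ k] that by blast
    moreover have xy: "x \<in> Z" "y \<in> Z" using that by auto
    ultimately show ?thesis
      using T_perp[OF xy k(2)] Hom_zero_iff[of "(T ^^ k) x" y] Z_ob by blast
  qed
  moreover have "dim (Hom C x y) = (if isomorphic C x y then 1 else 0)" if "x \<in> X" "y \<in> X" for x y
    using X that by (simp add: w_orthogonal_def)
  ultimately show ?thesis
    unfolding w_orthogonal_def isomorphic_ZC ZC_simps shift_pow_ZC by simp
qed

lemma w_orthogonal_extend:
  assumes R: "w_orthogonal ZC w R" shows "w_orthogonal C w (R \<union> S)"
proof -
  have RZ: "R \<subseteq> Z" using R by (simp add: w_orthogonal_def strict_subcat_def)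
  have dimR: "dim (Hom C x y) = (if isomorphic C x y then 1 else 0)" if "x \<in> R" "y \<in> R" for x y
    using R that unfolding w_orthogonal_def isomorphic_ZC by simp
  have dimS: "dim (Hom C x y) = (if isomorphic C x y then 1 else 0)" if "x \<in> S" "y \<in> S" for x y
    using S_w_orthogonal that unfolding w_orthogonal_def by simp
  have ob: "x \<in> R \<union> S \<Longrightarrow> x \<in> Ob C" for x using RZ Z_ob S_Ob by blast
  have cross: "(\<Sigma> ^^ k) r \<bottom> s" "(\<Sigma> ^^ k) s \<bottom> r" if "r \<in> R" "s \<in> S" "k \<le> w" for r s k
    using that RZ Z_iff_left[of r] Z_iff_right[of r] by auto
  have nis: "\<not> isomorphic C r s" "\<not> isomorphic C s r" if "r \<in> R" "s \<in> S" for r s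
  proof -
    have "\<not> s \<cong> r" using orthogonal_iso_closed[OF S_orth that(2)] that(1) RZ S_Z_disjoint by blast
    then show "\<not> isomorphic C r s" "\<not> isomorphic C s r"
      using isomorphic_iff[of r s] isomorphic_iff[of s r] iso_ob_sym ob that by blast+
  qed
  have dimX: "dim (Hom C r s) = 0" "dim (Hom C s r) = 0" if "r \<in> R" "s \<in> S" for r s
  proof -
    have "Hom C r s = {0}" "Hom C s r = {0}"
      using cross[OF that, of 0] Hom_zero_iff ob that by auto
    then show "dim (Hom C r s) = 0" "dim (Hom C s r) = 0" using dim_zero_Hom by auto
  qed
  have strict: "strict_subcat C (R \<union> S)"
    unfolding strict_subcat_def
  proof (intro conjI subsetI ballI impI)
    fix x y assume h: "x \<in> R \<union> S" "y \<in> Ob C" "isomorphic C x y"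
    then have i: "x \<cong> y" using isomorphic_iff ob by blast
    show "y \<in> R \<union> S"
    proof (cases "x \<in> S")
      case True then show ?thesis using orthogonal_iso_closed[OF S_orth _ i] by blast
    next
      case False
      then have "x \<in> R" "y \<in> Z" using h(1) Z_iso[OF _ i] RZ by blast+
      then show ?thesis using R h(3) unfolding w_orthogonal_def strict_subcat_def isomorphic_ZC by auto
    qed
  qed (rule ob)
  have "Hom C ((\<Sigma> ^^ k) x) y = {0}" if k: "k \<in> {1..w - 1}" and xy: "x \<in> R \<union> S" "y \<in> R \<union> S" for k x y
  proof -
    have k': "1 \<le> k" "k < w" "k \<le> w" "2 \<le> w" using k by auto
    have "(\<Sigma> ^^ k) x \<bottom> y" if "x \<in> R" "y \<in> R"
    proof -
      have "Hom ZC (shift_pow ZC (int k) x) y = {0}" using R k k' that unfolding w_orthogonal_def by blast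
      then have H: "Hom C ((T ^^ k) x) y = {0}" by (simp add: shift_pow_ZC)
      have xyZ: "x \<in> Z" "y \<in> Z" using that RZ by auto
      note T = T_perp[OF xyZ k'(2)]
      have "(T ^^ k) x \<bottom> y" using H Hom_zero_iff[of "(T ^^ k) x" y] Z_ob T xyZ by blast
      then show ?thesis using T by blast
    qed
    then have "(\<Sigma> ^^ k) x \<bottom> y"
      using xy cross k' orthogonal_perp[OF S_orth _ _ k'(1,2)] by blast
    then show ?thesis using Hom_zero_iff funpow_shift_in ob xy by blast
  qed
  moreover have "dim (Hom C x y) = (if isomorphic C x y then 1 else 0)" if xy: "x \<in> R \<union> S" "y \<in> R \<union> S" for x y
  proof -
    consider "x \<in> R" "y \<in> R" | "x \<in> R" "y \<in> S" | "x \<in> S" "y \<in> R" | "x \<in> S" "y \<in> S" using xy by blast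
    then show ?thesis
      by cases (simp_all add: dimR dimS dimX nis)
  qed
  ultimately show ?thesis unfolding w_orthogonal_def shift_pow_nonneg using strict by blast
qed

lemma U_funpow_in_Z: "z \<in> Z \<Longrightarrow> (U ^^ j) z \<in> Z"
  by (induction j) (auto intro: U_triangle(1))

section \<open>Restricting simple-minded systems to Z\<close>

text \<open>
  The heart of the restriction. The first factor \<open>x\<close> of \<open>z\<close> cannot lie in \<open>S\<close>, since \<open>Hom(S, Z) =
  0\<close>; so it lies in \<open>Z\<close>. Dividing \<open>z\<close> by \<open>x\<close> and then by the minimal approximation from \<open>\<langle>S\<rangle>\<close>
  computes the third object of a triangle in \<open>Z\<close>. The first division shortens the filtration and
  the second does not lengthen it. If the layer of unshifted factors is empty, then \<open>\<Sigma> z\<close>, and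
  with it \<open>z\<langle>1\<rangle>\<close>, has one layer less, and the claim for \<open>z\<langle>1\<rangle>\<close> and the preimage of \<open>Y\<close> under
  \<open>\<langle>-1\<rangle>\<close> gives the one for \<open>z\<close>.
\<close>

lemma filtered_in_Zclosed:
  assumes X: "orthogonal w X" "S \<subseteq> X" and "filtered X k n z" "z \<in> Z" "k \<le> w" "Zclosed Y"
    "\<And>j. j < k \<Longrightarrow> (U ^^ j) ` (X \<inter> Z) \<subseteq> Y"
  shows "z \<in> Y"
  using assms(3-)
proof (induction "k + n" arbitrary: k n z Y rule: less_induct)
  case less
  note z = less.prems(2) and Y = less.prems(4)
  have cone: "\<exists>m \<le> n. filtered X k m z'"
    if "min_right_approx C \<langle>S\<rangle> t c \<alpha>" "tri C t c z' \<alpha> b \<gamma>" "filtered X k n c" "k \<le> w" for t c \<alpha> z' b \<gamma> k n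
  proof -
    have "t \<in> \<langle>S\<rangle>" using that(1) by (simp add: min_right_approx_def right_approx_def)
    then obtain a where a: "filtered S (Suc 0) a t" unfolding layers_def by blast
    have "a \<le> n \<and> filtered X k (n - a) z'"
      by (rule filtered_cone_of_injective[OF a refl that(3) X(1) that(4) X(2) that(2)])
        (use min_right_approx_injective[OF S_orth w that(1)] tri_ob(2)[OF that(2)] in blast)
    then show ?thesis by (meson diff_le_self)
  qed
  from less.prems(1) show ?case
  proof (cases rule: filtered.cases)
    case zero then show ?thesis using Y unfolding Zclosed_def by blast
  next
    case (step x c f g h k0 n0)
    have "x \<notin> S"
    proof
      assume "x \<in> S"
      then have "(\<Sigma> ^^ 0) x \<bottom> z" using z unfolding Z_iff_right by blast
      then show False using perpD tri_arr(1)[OF step(4)] step(5) by auto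
    qed
    then have x: "x \<in> X \<inter> Z" using orthogonal_cases[OF X step(3)] step(3) by blast
    then have xY: "x \<in> Y" using less.prems(5)[of 0] step(1) by auto
    obtain t \<alpha> b \<gamma> z' where t: "min_right_approx C \<langle>S\<rangle> t c \<alpha>" "tri C t c z' \<alpha> b \<gamma>" "z' \<in> Z" "standard x z z'"
      using standard_exists[OF _ z step(4)] x by blast
    obtain m where m: "m \<le> n0" "filtered X k m z'" using cone[OF t(1,2)] step less.prems(3) by blast
    have "k + m < k + n" using m(1) step(2) by simp
    then have "z' \<in> Y" using less.hyps[OF _ m(2) t(3) less.prems(3) Y less.prems(5)] by blast
    then show ?thesis using Y xY t(4) unfolding Zclosed_def by blast
  next
    case (shift k0)
    show ?thesis
    proof (cases "k0 = 0")
      case True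
      then have "is_zero C z" using shift filtered_no_layers shift_zero_ob by blast
      then show ?thesis using Y unfolding Zclosed_def by blast
    next
      case False
      then have w2: "2 \<le> w" using shift(1) less.prems(3) by simp
      let ?Y = "{a \<in> Z. U a \<in> Y}"
      obtain t \<alpha> \<gamma> where t: "min_right_approx C \<langle>S\<rangle> t (\<Sigma> z) \<alpha>" "tri C t (\<Sigma> z) (T z) \<alpha> (\<beta> z) \<gamma>" "T z \<in> Z"
        using T_triangle[OF z] by blast
      have k0: "k0 \<le> w" using shift(1) less.prems(3) by simp
      obtain m where m: "m \<le> n" "filtered X k0 m (T z)" using cone[OF t(1,2) shift(3) k0] by blast
      have "(U ^^ j) ` (X \<inter> Z) \<subseteq> ?Y" if "j < k0" for j
        using less.prems(5)[of "Suc j"] that shift(1) U_funpow_in_Z by auto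
      moreover have "k0 + m < k + n" using m(1) shift(1) by simp
      ultimately have "T z \<in> ?Y"
        using less.hyps[OF _ m(2) t(3) k0 Zclosed_preimage_U[OF Y w2]] by blast
      then show ?thesis using Y U_T[OF z] unfolding Zclosed_def by blast
    qed
  qed
qed

lemma sms_layers:
  assumes "simple_minded_system C w X" shows "orthogonal w X" "Ob C = layers X w"
proof -
  show X: "orthogonal w X"
    using assms orthogonal_of_w_orthogonal[OF hom_finite] unfolding simple_minded_system_def by blast
  have "Ob C = add_closure C (layers X w)"
    using assms ext_closure_shifts[OF X w le_refl] unfolding simple_minded_system_def by simp
  then show "Ob C = layers X w" using add_closure_layers[OF X le_refl] layers_ob by blast
qed

lemma sms_restrict:
  assumes sms: "simple_minded_system C w X" and SX: "S \<subseteq> X"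
  shows "simple_minded_system ZC w (X \<inter> Z)"
proof -
  note X = sms_layers[OF sms]
  let ?G = "\<Union>k \<in> {0..w - 1}. shift_pow ZC (- int k) ` (X \<inter> Z)"
  have mem: "z \<in> ext_closure ZC ?G" if z: "z \<in> Z" for z
    unfolding ext_closure_def
  proof (clarify)
    fix Y assume Y: "ext_closed ZC Y" "?G \<subseteq> Y"
    have "z \<in> layers X w" using X(2) Z_ob[OF z] by blast
    then obtain n where n: "filtered X w n z" unfolding layers_def by blast
    show "z \<in> Y"
    proof (rule filtered_in_Zclosed[OF X(1) SX n z le_refl Zclosed_of_ext_closed[OF Y(1)]])
      fix j assume "j < w"
      then have "j \<in> {0..w - 1}" by auto
      then show "(U ^^ j) ` (X \<inter> Z) \<subseteq> Y" using Y(2) unfolding shift_pow_ZC by blast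
    qed
  qed
  have "Z \<subseteq> add_closure ZC (ext_closure ZC ?G)"
  proof
    fix d assume d: "d \<in> Z"
    obtain o' where o': "is_zero C o'" using zero_exists by blast
    have "direct_sum ZC d [d]" "direct_sum ZC d [d, o']"
      using direct_sum_ZC d Z_zero[OF o'] direct_sum_self[OF Z_ob[OF d] o'] by auto
    then show "d \<in> add_closure ZC (ext_closure ZC ?G)"
      unfolding add_closure_def mem_Collect_eq ZC_simps using mem[OF d] d
      by (intro conjI exI[of _ "[d]"] exI[of _ d] exI[of _ o']) simp_all
  qed
  moreover have "add_closure ZC (ext_closure ZC ?G) \<subseteq> Z" unfolding add_closure_def by auto
  moreover have "w_orthogonal ZC w (X \<inter> Z)"
    using w_orthogonal_restrict sms unfolding simple_minded_system_def by blast
  ultimately show ?thesis unfolding simple_minded_system_def by auto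
qed

section \<open>Extending simple-minded systems from Z\<close>

lemma hull_layers:
  assumes "t \<in> \<langle>S\<rangle>" "S \<subseteq> X" "1 \<le> k" shows "t \<in> layers X k"
proof -
  obtain n where "filtered S (Suc 0) n t" using assms(1) unfolding layers_def by blast
  then have "filtered X (Suc 0) n t" using filtered_mono assms(2) by blast
  then have "filtered X k n t" using filtered_le assms(3) by simp
  then show ?thesis by (rule layersI)
qed

text \<open>
  The triangle \<open>t \<rightarrow> \<Sigma>(U y) \<rightarrow> y\<close> has \<open>t\<close> in \<open>\<langle>S\<rangle>\<close>, so \<open>\<Sigma>(U y)\<close> has no more layers than \<open>y\<close>.
\<close>

lemma U_layers:
  assumes X: "orthogonal w X" "S \<subseteq> X" and y: "y \<in> Z" "y \<in> layers X (Suc k)" and k: "Suc k \<le> w"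
  shows "U y \<in> layers X (Suc (Suc k))"
proof -
  obtain t where t: "t \<in> \<langle>S\<rangle>" "triangle t (\<Sigma> (U y)) y" using U_triangle(2)[OF y(1)] by blast
  have "\<Sigma> (U y) \<in> layers X (Suc k)"
    using layers_extension[OF X(1) k hull_layers[OF t(1) X(2)] y(2) t(2)] by simp
  then show ?thesis using layers_shift Z_ob U_triangle(1)[OF y(1)] by blast
qed

text \<open>
  A standard triangle in \<open>Z\<close> on \<open>x, d, y\<close> exhibits \<open>d\<close> as an object of \<open>x * \<langle>S\<rangle> * y\<close>, so
  extensions in \<open>Z\<close> stay within the extension closure of \<open>R \<union> S\<close> in the ambient category.
\<close>

lemma Z_in_layers:
  assumes R: "simple_minded_system ZC w R" and z: "z \<in> Z" shows "z \<in> layers (R \<union> S) w"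
proof -
  let ?X = "R \<union> S"
  let ?G = "\<Union>k \<in> {0..w - 1}. shift_pow ZC (- int k) ` R"
  let ?Y = "Z \<inter> layers ?X w"
  have wR: "w_orthogonal ZC w R" using R by (simp add: simple_minded_system_def)
  have RZ: "R \<subseteq> Z" using wR by (simp add: w_orthogonal_def strict_subcat_def)
  have X: "orthogonal w ?X" using orthogonal_of_w_orthogonal[OF hom_finite w_orthogonal_extend[OF wR]] .
  have "d \<in> layers ?X w" if xy: "x \<in> ?Y" "y \<in> ?Y" and s: "standard x d y" for x d y
  proof -
    obtain f g h where "Zstandard C w S T \<beta> x d y f g h" using s standard_def by blast
    then obtain c t where c: "triangle x d c" "triangle t c y" "t \<in> \<langle>S\<rangle>"
      unfolding triangle_def by (rule standard_elim) blast
    have "c \<in> layers ?X w" using layers_extension[OF X le_refl hull_layers[OF c(3) _ w] _ c(2)] xy by blast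
    then show ?thesis using layers_extension[OF X le_refl _ _ c(1)] xy by blast
  qed
  then have "Zclosed ?Y" unfolding Zclosed_def
    using Z_zero layers_zero Z_iso layers_iso standard_in_Z by blast
  then have Y: "ext_closed ZC ?Y" by (rule ext_closed_of_Zclosed)
  have U: "(U ^^ j) r \<in> layers ?X (Suc j)" if r: "r \<in> R" and j: "j < w" for r j
    using j
  proof (induction j)
    case 0 then show ?case using layers_object[OF X] r by simp
  next
    case (Suc j)
    then show ?case using U_layers[OF X _ U_funpow_in_Z] r RZ by auto
  qed
  have "?G \<subseteq> ?Y"
  proof
    fix g assume "g \<in> ?G"
    then obtain j r where g: "j \<le> w - 1" "r \<in> R" "g = (U ^^ j) r" by (auto simp: shift_pow_ZC)
    then have j: "j < w" using w by simp
    have "g \<in> layers ?X (Suc j)" using U[OF g(2) j] g(3) by simp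
    then have "g \<in> layers ?X w" unfolding layers_def using filtered_le j Suc_leI by blast
    then show "g \<in> ?Y" using U_funpow_in_Z g RZ by blast
  qed
  then have ec: "ext_closure ZC ?G \<subseteq> ?Y" unfolding ext_closure_def using Y by blast
  have "z \<in> add_closure ZC (ext_closure ZC ?G)" using R z unfolding simple_minded_system_def by simp
  then obtain xs b e where xs: "set xs \<subseteq> ext_closure ZC ?G" "direct_sum ZC b xs" "direct_sum ZC b [z, e]"
    unfolding add_closure_def by blast
  have "set xs \<subseteq> layers ?X w" using xs(1) ec by blast
  moreover have "direct_sum C b xs" "direct_sum C b [z, e]" using xs direct_sum_ZC by blast+
  ultimately have "z \<in> add_closure C (layers ?X w)" unfolding add_closure_def using Z_ob[OF z] by blast
  then show ?thesis using add_closure_layers[OF X le_refl] by blast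
qed

text \<open>
  Left approximations by \<open>\<Sigma>\<^sup>1\<^sup>-\<^sup>w\<langle>S\<rangle>, \<dots>, \<Sigma>\<^sup>-\<^sup>1\<langle>S\<rangle>, \<langle>S\<rangle>\<close>, in this order, remove the morphisms from
  \<open>d\<close> to these subcategories one after the other; each leaves the degrees already treated
  unchanged. By Serre duality the resulting object satisfies all conditions of \<open>Z\<close> except degree
  \<open>0\<close>, and a final right approximation by \<open>\<langle>S\<rangle>\<close> leads into \<open>Z\<close>. So every object lies in \<open>\<langle>S\<rangle> * Z *
  \<langle>S\<rangle> * \<Sigma>\<^sup>-\<^sup>1\<langle>S\<rangle> * \<dots> * \<Sigma>\<^sup>1\<^sup>-\<^sup>w\<langle>S\<rangle>\<close>.
\<close>

lemma generated_by_Z: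
  assumes X: "orthogonal w X" "S \<subseteq> X" and ZX: "Z \<subseteq> layers X w" and "j \<le> w" "d \<in> Ob C"
    "\<And>i s. \<lbrakk>j \<le> i; i < w; s \<in> S\<rbrakk> \<Longrightarrow> (\<Sigma> ^^ i) d \<bottom> s"
  shows "d \<in> layers X w"
  using assms(4-)
proof (induction j arbitrary: d)
  case (0 d)
  have perp: "(\<Sigma> ^^ i) s \<bottom> d" if i: "1 \<le> i" "i \<le> w" and s: "s \<in> S" for i s
  proof -
    have "\<forall>s \<in> S. (\<Sigma> ^^ (w - i)) d \<bottom> s" using 0(3) i by simp
    then show ?thesis using serre_S_shift[OF 0(2), of "w - i"] i s by simp
  qed
  obtain t \<alpha> where t: "min_right_approx C \<langle>S\<rangle> t d \<alpha>" using right_approximation 0(2) by blast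
  then have tE: "t \<in> \<langle>S\<rangle>" "\<alpha> \<in> Hom C t d" by (auto simp: min_right_approx_def right_approx_def)
  then have "arr \<alpha> t d" using hull_in_Ob 0(2) by (simp add: arr_def)
  then obtain z b \<gamma> where z: "tri C t d z \<alpha> b \<gamma>" using cone_exists by blast
  have "z \<in> Z" using right_cone_in_Z[OF t z perp] by blast
  then show ?case
    using layers_extension[OF X(1) le_refl hull_layers[OF tE(1) X(2) w]] ZX z triangle_def by blast
next
  case (Suc j d)
  let ?y = "(\<Sigma> ^^ j) d"
  have y: "?y \<in> Ob C" using funpow_shift_in Suc.prems(2) by blast
  obtain t \<alpha> where t: "min_left_approx C \<langle>S\<rangle> ?y t \<alpha>" using left_approximation y by blast
  then have tE: "t \<in> \<langle>S\<rangle>" "\<alpha> \<in> Hom C ?y t" by (auto simp: min_left_approx_def left_approx_def)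
  then have "arr \<alpha> ?y t" using hull_in_Ob y by (simp add: arr_def)
  then obtain e b \<delta> where e: "tri C e ?y t b \<alpha> \<delta>" using cocone_exists by blast
  let ?e = "(unshift C ^^ j) e" and ?t = "(unshift C ^^ j) t"
  have ob: "e \<in> Ob C" "t \<in> Ob C" using tri_ob e by auto
  note iso = iso_ob_sym[OF funpow_shift_unshift[OF ob(1), of j]] iso_ob_sym[OF funpow_shift_unshift[OF ob(2), of j]]
  have "triangle e ?y t" using e triangle_def by blast
  then have "triangle ((\<Sigma> ^^ j) ?e) ?y ((\<Sigma> ^^ j) ?t)" by (rule triangle_cong[OF _ iso(1) iso_ob_refl[OF y] iso(2)])
  then have tr: "triangle ?e d ?t" using triangle_funpow_unshift funpow_unshift_in ob Suc.prems(2) by blast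
  have "?e \<in> layers X w"
  proof (rule Suc.IH)
    show "j \<le> w" using Suc.prems(1) by simp
    show "?e \<in> Ob C" using funpow_unshift_in ob by blast
    fix i s assume i: "j \<le> i" "i < w" and s: "s \<in> S"
    have "(\<Sigma> ^^ (i - j)) e \<bottom> s"
    proof (cases "i = j")
      case True then show ?thesis using left_wakamatsu[OF S_orth w t e s] by simp
    next
      case False
      have "(\<Sigma> ^^ i) d \<bottom> s" using Suc.prems(3) i False s by simp
      then have "(\<Sigma> ^^ (i - j)) ?y \<bottom> s" using i(1) by (metis comp_apply funpow_add le_add_diff_inverse2)
      then show ?thesis using left_cocone_perp[OF S_orth w t e s, of "i - j"] i False by simp
    qed
    then have "(\<Sigma> ^^ (i - j)) ((\<Sigma> ^^ j) ?e) \<bottom> s" using perp_iso_left funpow_shift_iso[OF iso(1)] by blast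
    then show "(\<Sigma> ^^ i) ?e \<bottom> s" using i(1) by (metis comp_apply funpow_add le_add_diff_inverse2)
  qed
  moreover have "?t \<in> layers X w"
  proof -
    have "(\<Sigma> ^^ j) ?t \<in> layers X (Suc 0)" using layers_iso[OF hull_layers[OF tE(1) X(2)] iso(2)] by simp
    then obtain n where "filtered X (Suc 0) n ((\<Sigma> ^^ j) ?t)" unfolding layers_def by blast
    then have "filtered X (j + Suc 0) n ?t" using filtered_funpow funpow_unshift_in ob by blast
    then have "filtered X w n ?t" using filtered_le Suc.prems(1) by simp
    then show ?thesis by (rule layersI)
  qed
  ultimately show ?case using layers_extension[OF X(1) le_refl _ _ tr] by blast
qed

lemma sms_extend:
  assumes R: "simple_minded_system ZC w R" shows "simple_minded_system C w (R \<union> S)"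
proof -
  let ?X = "R \<union> S"
  have wX: "w_orthogonal C w ?X"
    using w_orthogonal_extend R by (simp add: simple_minded_system_def)
  have X: "orthogonal w ?X" using orthogonal_of_w_orthogonal[OF hom_finite wX] .
  have "Ob C \<subseteq> layers ?X w"
  proof
    fix d assume d: "d \<in> Ob C"
    show "d \<in> layers ?X w"
      by (rule generated_by_Z[OF X _ _ le_refl d]) (use Z_in_layers[OF R] in auto)
  qed
  moreover obtain o' where o': "is_zero C o'" using zero_exists by blast
  ultimately have "d \<in> add_closure C (layers ?X w)" if "d \<in> Ob C" for d
    unfolding add_closure_def mem_Collect_eq using direct_sum_self[OF that o'] that
    by (intro conjI exI[of _ "[d]"] exI[of _ d] exI[of _ o']) auto
  then have "Ob C = add_closure C (layers ?X w)" unfolding add_closure_def by blast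
  then show ?thesis
    using wX ext_closure_shifts[OF X w le_refl] unfolding simple_minded_system_def by simp
qed

lemma sms_bijection:
  "bij_betw (\<lambda>X. X \<inter> Z) {X. simple_minded_system C w X \<and> S \<subseteq> X} {R. simple_minded_system ZC w R}"
proof (rule bij_betw_byWitness[where f' = "\<lambda>R. R \<union> S"])
  show "\<forall>X \<in> {X. simple_minded_system C w X \<and> S \<subseteq> X}. X \<inter> Z \<union> S = X"
    using sms_layers(1) orthogonal_cases by blast
  show "\<forall>R \<in> {R. simple_minded_system ZC w R}. (R \<union> S) \<inter> Z = R"
  proof clarify
    fix R assume "simple_minded_system ZC w R"
    then have "strict_subcat ZC R" unfolding simple_minded_system_def w_orthogonal_def by blast
    then have "R \<subseteq> Z" unfolding strict_subcat_def ZC_simps by blast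
    then show "(R \<union> S) \<inter> Z = R" using S_Z_disjoint by blast
  qed
  show "(\<lambda>X. X \<inter> Z) ` {X. simple_minded_system C w X \<and> S \<subseteq> X} \<subseteq> {R. simple_minded_system ZC w R}"
    using sms_restrict by blast
  show "(\<lambda>R. R \<union> S) ` {R. simple_minded_system ZC w R} \<subseteq> {X. simple_minded_system C w X \<and> S \<subseteq> X}"
    using sms_extend by blast
qed

end

theorem theorem2:
  fixes D :: "('k::alg_closed_field, 'o, 'm::ab_group_add) tri_cat"
    and SS SS' :: "('o, 'm) endo"
    and w :: nat
    and S :: "'o set"
    and T U :: "'o \<Rightarrow> 'o"
    and \<beta> :: "'o \<Rightarrow> 'm"
  assumes "triangulated_category D"
    and "hom_finite D"
    and "krull_schmidt D"
    and "serre_functor D SS SS'"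
    and "1 \<le> w"
    and "w_orthogonal D w S"
    and "serre_subcat D SS SS' (- int w) S"
    and "functorially_finite D (ext_closure D S)"
    and "reduction_choice D w S T \<beta> U"
  shows "\<exists>\<Phi>. bij_betw \<Phi> {X. simple_minded_system D w X \<and> S \<subseteq> X}
                        {R. simple_minded_system (Zcat D w S T \<beta> U) w R}"
proof -
  interpret reduction D SS SS' w S T U \<beta>
    using assms by (intro reduction.intro reduction_axioms.intro)
  show ?thesis using sms_bijection by blast
qed

end
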